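(* Let $G$ be a finite group and let $A$ and $B$ be $G$-graded finite-dimensional $k$-algebras over a field $k$. Suppose that there is a $G$-graded stable equivalence of Morita type between $A$ and $B$. Then there is a stable equivalence of Morita type between the Beilinson-Green algebras $\bar A$ and $\bar B$ of $A$ and $B$, respectively.
   Context: All modules are finitely generated. Beilinson-Green algebra: for a $G$-graded algebra $A=\bigoplus_{g\in G}A_g$, $\bar A$ is the $G\times G$-matrix algebra consisting of matrices $(a_{g,h})_{g,h\in G}$ with $a_{g,h}\in \bar A_{gh}:=A_{gh^{-1}}$, with matrix multiplication induced by the multiplication of $A$. $G$-graded stable equivalence of Morita type between $A$ and $B$: there are a $G$-graded $A$-$B$-bimodule $M$ and a $G$-graded $B$-$A$-bimodule $N$ such that (1) $M$ is graded projective as a left $A$-module and as a right $B$-module, and $N$ is graded projective as a left $B$-module and as a right $A$-module; (2) $M\otimes_BN\simeq A\oplus P$ as graded $A$-$A$-bimodules for some graded projective $A$-$A$-bimodule $P$, and $N\otimes_AM\simeq B\oplus Q$ as graded $B$-$B$-bimodules for some graded projective $B$-$B$-bimodule $Q$. Stable equivalence of Morita type between (ungraded) algebras $C$ and $D$: there are bimodules ${}_CU_D$ and ${}_DV_C$, projective as one-sided modules on both sides, such that $U\otimes_DV\simeq C\oplus P'$ as $C$-$C$-bimodules and $V\otimes_CU\simeq D\oplus Q'$ as $D$-$D$-bimodules for some projective bimodules $P'$ and $Q'$. *)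

theory Defs
  imports
    "HOL-Algebra.Free_Abelian_Groups"
    "Jordan_Normal_Form.Missing_VectorSpace"
begin

section \<open>Algebras over a field\<close>

text \<open>The locale \<^locale>\<open>algebra\<close> of \<^theory>\<open>HOL-Algebra.Module\<close> is restricted to commutative
  algebras. Here an algebra is associative and unital, but not necessarily commutative.\<close>

locale k_algebra =
  fixes K (structure) and A (structure)
  assumes vs: "vectorspace K A"
    and ring: "ring A"
    and smult_mult_left: "\<lbrakk>k \<in> carrier K; a \<in> carrier A; b \<in> carrier A\<rbrakk> \<Longrightarrow>
          (k \<odot>\<^bsub>A\<^esub> a) \<otimes>\<^bsub>A\<^esub> b = k \<odot>\<^bsub>A\<^esub> (a \<otimes>\<^bsub>A\<^esub> b)"
    and smult_mult_right: "\<lbrakk>k \<in> carrier K; a \<in> carrier A; b \<in> carrier A\<rbrakk> \<Longrightarrow>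
          a \<otimes>\<^bsub>A\<^esub> (k \<odot>\<^bsub>A\<^esub> b) = k \<odot>\<^bsub>A\<^esub> (a \<otimes>\<^bsub>A\<^esub> b)"

definition fd_algebra :: "('k, 'q) ring_scheme \<Rightarrow> ('k, 'a) module \<Rightarrow> bool"
  where "fd_algebra K A \<longleftrightarrow> k_algebra K A \<and> vectorspace.fin_dim K A"

definition self_algebra :: "('k, 'q) ring_scheme \<Rightarrow> ('k, 'k) module"
  where "self_algebra K =
    \<lparr>carrier = carrier K, monoid.mult = monoid.mult K, one = \<one>\<^bsub>K\<^esub>,
     zero = \<zero>\<^bsub>K\<^esub>, add = add K, smult = monoid.mult K\<rparr>"


section \<open>Bimodules\<close>

text \<open>As for every \<^typ>\<open>('k, 'm) module\<close> record, the fields \<open>mult\<close> and \<open>one\<close> inherited from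
  rings carry no information about a bimodule.\<close>

record ('k, 'c, 'd, 'm) bimodule = "('k, 'm) module" +
  lact :: "'c \<Rightarrow> 'm \<Rightarrow> 'm"
  ract :: "'m \<Rightarrow> 'd \<Rightarrow> 'm"

text \<open>The field acts centrally, that is, the scalar actions induced by \<open>C\<close> and \<open>D\<close> both coincide with
  the vector space structure.\<close>

locale bimodule =
  fixes K :: "('k, 'q) ring_scheme" and C :: "('k, 'c) module" and D :: "('k, 'd) module"
    and U :: "('k, 'c, 'd, 'm) bimodule"
  assumes left_algebra: "k_algebra K C"
    and right_algebra: "k_algebra K D"
    and vs: "vectorspace K U"
    and lact_closed: "\<lbrakk>c \<in> carrier C; u \<in> carrier U\<rbrakk> \<Longrightarrow> lact U c u \<in> carrier U"
    and lact_add_left: "\<lbrakk>c \<in> carrier C; c' \<in> carrier C; u \<in> carrier U\<rbrakk> \<Longrightarrow>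
          lact U (c \<oplus>\<^bsub>C\<^esub> c') u = lact U c u \<oplus>\<^bsub>U\<^esub> lact U c' u"
    and lact_add_right: "\<lbrakk>c \<in> carrier C; u \<in> carrier U; u' \<in> carrier U\<rbrakk> \<Longrightarrow>
          lact U c (u \<oplus>\<^bsub>U\<^esub> u') = lact U c u \<oplus>\<^bsub>U\<^esub> lact U c u'"
    and lact_smult_left: "\<lbrakk>k \<in> carrier K; c \<in> carrier C; u \<in> carrier U\<rbrakk> \<Longrightarrow>
          lact U (k \<odot>\<^bsub>C\<^esub> c) u = k \<odot>\<^bsub>U\<^esub> lact U c u"
    and lact_smult_right: "\<lbrakk>k \<in> carrier K; c \<in> carrier C; u \<in> carrier U\<rbrakk> \<Longrightarrow>
          lact U c (k \<odot>\<^bsub>U\<^esub> u) = k \<odot>\<^bsub>U\<^esub> lact U c u"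
    and lact_mult: "\<lbrakk>c \<in> carrier C; c' \<in> carrier C; u \<in> carrier U\<rbrakk> \<Longrightarrow>
          lact U (c \<otimes>\<^bsub>C\<^esub> c') u = lact U c (lact U c' u)"
    and lact_one: "u \<in> carrier U \<Longrightarrow> lact U \<one>\<^bsub>C\<^esub> u = u"
    and ract_closed: "\<lbrakk>u \<in> carrier U; d \<in> carrier D\<rbrakk> \<Longrightarrow> ract U u d \<in> carrier U"
    and ract_add_right: "\<lbrakk>u \<in> carrier U; d \<in> carrier D; d' \<in> carrier D\<rbrakk> \<Longrightarrow>
          ract U u (d \<oplus>\<^bsub>D\<^esub> d') = ract U u d \<oplus>\<^bsub>U\<^esub> ract U u d'"
    and ract_add_left: "\<lbrakk>u \<in> carrier U; u' \<in> carrier U; d \<in> carrier D\<rbrakk> \<Longrightarrow>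
          ract U (u \<oplus>\<^bsub>U\<^esub> u') d = ract U u d \<oplus>\<^bsub>U\<^esub> ract U u' d"
    and ract_smult_right: "\<lbrakk>k \<in> carrier K; u \<in> carrier U; d \<in> carrier D\<rbrakk> \<Longrightarrow>
          ract U u (k \<odot>\<^bsub>D\<^esub> d) = k \<odot>\<^bsub>U\<^esub> ract U u d"
    and ract_smult_left: "\<lbrakk>k \<in> carrier K; u \<in> carrier U; d \<in> carrier D\<rbrakk> \<Longrightarrow>
          ract U (k \<odot>\<^bsub>U\<^esub> u) d = k \<odot>\<^bsub>U\<^esub> ract U u d"
    and ract_mult: "\<lbrakk>u \<in> carrier U; d \<in> carrier D; d' \<in> carrier D\<rbrakk> \<Longrightarrow>
          ract U u (d \<otimes>\<^bsub>D\<^esub> d') = ract U (ract U u d) d'"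
    and ract_one: "u \<in> carrier U \<Longrightarrow> ract U u \<one>\<^bsub>D\<^esub> = u"
    and lact_ract: "\<lbrakk>c \<in> carrier C; u \<in> carrier U; d \<in> carrier D\<rbrakk> \<Longrightarrow>
          ract U (lact U c u) d = lact U c (ract U u d)"

definition subbimodule ::
    "('k, 'q) ring_scheme \<Rightarrow> ('k, 'c) module \<Rightarrow> ('k, 'd) module \<Rightarrow> 'm set \<Rightarrow>
     ('k, 'c, 'd, 'm) bimodule \<Rightarrow> bool"
  where "subbimodule K C D W U \<longleftrightarrow> subspace K W U \<and>
    (\<forall>c\<in>carrier C. \<forall>w\<in>W. lact U c w \<in> W) \<and> (\<forall>w\<in>W. \<forall>d\<in>carrier D. ract U w d \<in> W)"

definition fg_bimodule ::
    "('k, 'q) ring_scheme \<Rightarrow> ('k, 'c) module \<Rightarrow> ('k, 'd) module \<Rightarrow>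
     ('k, 'c, 'd, 'm) bimodule \<Rightarrow> bool"
  where "fg_bimodule K C D U \<longleftrightarrow> bimodule K C D U \<and>
    (\<exists>S. finite S \<and> S \<subseteq> carrier U \<and>
      (\<forall>W. subbimodule K C D W U \<and> S \<subseteq> W \<longrightarrow> W = carrier U))"

definition bimodule_hom ::
    "('k, 'q) ring_scheme \<Rightarrow> ('k, 'c) module \<Rightarrow> ('k, 'd) module \<Rightarrow>
     ('k, 'c, 'd, 'm) bimodule \<Rightarrow> ('k, 'c, 'd, 'n) bimodule \<Rightarrow> ('m \<Rightarrow> 'n) set"
  where "bimodule_hom K C D U V = {f \<in> module_hom K U V.
    (\<forall>c\<in>carrier C. \<forall>u\<in>carrier U. f (lact U c u) = lact V c (f u)) \<and>
    (\<forall>u\<in>carrier U. \<forall>d\<in>carrier D. f (ract U u d) = ract V (f u) d)}"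

definition isomorphic_bimodules ::
    "('k, 'q) ring_scheme \<Rightarrow> ('k, 'c) module \<Rightarrow> ('k, 'd) module \<Rightarrow>
     ('k, 'c, 'd, 'm) bimodule \<Rightarrow> ('k, 'c, 'd, 'n) bimodule \<Rightarrow> bool"
  where "isomorphic_bimodules K C D U V \<longleftrightarrow>
    (\<exists>f\<in>bimodule_hom K C D U V. bij_betw f (carrier U) (carrier V))"

definition regular_bimodule :: "('k, 'c) module \<Rightarrow> ('k, 'c, 'c, 'c) bimodule"
  where "regular_bimodule C =
    module.extend C (bimodule.fields (monoid.mult C) (monoid.mult C))"

definition bimodule_sum ::
    "('k, 'c, 'd, 'm) bimodule \<Rightarrow> ('k, 'c, 'd, 'n) bimodule \<Rightarrow> ('k, 'c, 'd, 'm \<times> 'n) bimodule"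
  where "bimodule_sum U V = module.extend (direct_sum U V) (bimodule.fields
    (\<lambda>c (u, v). (lact U c u, lact V c v)) (\<lambda>(u, v) d. (ract U u d, ract V v d)))"

text \<open>A left \<open>C\<close>-module is the same thing as a \<open>C\<close>-\<open>K\<close>-bimodule, and a right \<open>D\<close>-module is the
  same thing as a \<open>K\<close>-\<open>D\<close>-bimodule: by centrality, the action of \<open>K\<close> is necessarily scalar
  multiplication. One-sided modules, their homomorphisms and their projectivity are therefore
  not introduced separately.\<close>

definition as_left_module ::
    "('k, 'c, 'd, 'm) bimodule \<Rightarrow> ('k, 'c, 'k, 'm) bimodule"
  where "as_left_module U =
    module.extend (module.truncate U) (bimodule.fields (lact U) (\<lambda>u k. k \<odot>\<^bsub>U\<^esub> u))"

definition as_right_module ::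
    "('k, 'c, 'd, 'm) bimodule \<Rightarrow> ('k, 'k, 'd, 'm) bimodule"
  where "as_right_module U =
    module.extend (module.truncate U) (bimodule.fields (\<lambda>k u. k \<odot>\<^bsub>U\<^esub> u) (ract U))"

text \<open>Projective objects in the category of finitely generated \<open>C\<close>-\<open>D\<close>-bimodules. The algebras
  are meant to be finite-dimensional, so that a finitely generated bimodule is a
  finite-dimensional vector space and hence isomorphic to one whose carrier consists of
  functions \<^typ>\<open>nat \<Rightarrow> 'k\<close>, for instance those that vanish from some index on. Quantifying over
  bimodules with elements of this type thus covers all of them up to isomorphism.\<close>

definition projective_bimodule ::
    "('k, 'q) ring_scheme \<Rightarrow> ('k, 'c) module \<Rightarrow> ('k, 'd) module \<Rightarrow>
     ('k, 'c, 'd, 'm) bimodule \<Rightarrow> bool"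
  where "projective_bimodule K C D P \<longleftrightarrow> fg_bimodule K C D P \<and>
    (\<forall>(X :: ('k, 'c, 'd, nat \<Rightarrow> 'k) bimodule) (Y :: ('k, 'c, 'd, nat \<Rightarrow> 'k) bimodule) e f.
      fg_bimodule K C D X \<and> fg_bimodule K C D Y \<and>
      e \<in> bimodule_hom K C D X Y \<and> e ` carrier X = carrier Y \<and> f \<in> bimodule_hom K C D P Y \<longrightarrow>
      (\<exists>h\<in>bimodule_hom K C D P X. \<forall>p\<in>carrier P. e (h p) = f p))"

definition left_projective ::
    "('k, 'q) ring_scheme \<Rightarrow> ('k, 'c) module \<Rightarrow> ('k, 'c, 'd, 'm) bimodule \<Rightarrow> bool"
  where "left_projective K C U \<longleftrightarrow> projective_bimodule K C (self_algebra K) (as_left_module U)"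

definition right_projective ::
    "('k, 'q) ring_scheme \<Rightarrow> ('k, 'd) module \<Rightarrow> ('k, 'c, 'd, 'm) bimodule \<Rightarrow> bool"
  where "right_projective K D U \<longleftrightarrow> projective_bimodule K (self_algebra K) D (as_right_module U)"


section \<open>Tensor products of bimodules\<close>

text \<open>\<open>U \<otimes>\<^sub>D V\<close> is the free abelian group on pairs \<open>(u, v)\<close> modulo the subgroup generated by the
  biadditivity and \<open>D\<close>-balancedness relations. The scalars of \<open>K\<close> need no separate relation,
  since they act through \<open>D\<close>.\<close>

abbreviation tensor_free ::
    "('k, 'c, 'd, 'm) bimodule \<Rightarrow> ('k, 'd, 'e, 'n) bimodule \<Rightarrow> ('m \<times> 'n \<Rightarrow>\<^sub>0 int) monoid"
  where "tensor_free U V \<equiv> free_Abelian_group (carrier U \<times> carrier V)"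

definition tensor_relators ::
    "('k, 'd) module \<Rightarrow> ('k, 'c, 'd, 'm) bimodule \<Rightarrow> ('k, 'd, 'e, 'n) bimodule \<Rightarrow>
     ('m \<times> 'n \<Rightarrow>\<^sub>0 int) set"
  where "tensor_relators D U V =
    {frag_of (u \<oplus>\<^bsub>U\<^esub> u', v) - frag_of (u, v) - frag_of (u', v) | u u' v.
       u \<in> carrier U \<and> u' \<in> carrier U \<and> v \<in> carrier V} \<union>
    {frag_of (u, v \<oplus>\<^bsub>V\<^esub> v') - frag_of (u, v) - frag_of (u, v') | u v v'.
       u \<in> carrier U \<and> v \<in> carrier V \<and> v' \<in> carrier V} \<union>
    {frag_of (ract U u d, v) - frag_of (u, lact V d v) | u d v.
       u \<in> carrier U \<and> d \<in> carrier D \<and> v \<in> carrier V}"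

definition tensor_relations ::
    "('k, 'd) module \<Rightarrow> ('k, 'c, 'd, 'm) bimodule \<Rightarrow> ('k, 'd, 'e, 'n) bimodule \<Rightarrow>
     ('m \<times> 'n \<Rightarrow>\<^sub>0 int) set"
  where "tensor_relations D U V = generate (tensor_free U V) (tensor_relators D U V)"

definition pure_tensor ::
    "('k, 'd) module \<Rightarrow> ('k, 'c, 'd, 'm) bimodule \<Rightarrow> ('k, 'd, 'e, 'n) bimodule \<Rightarrow>
     'm \<Rightarrow> 'n \<Rightarrow> ('m \<times> 'n \<Rightarrow>\<^sub>0 int) set"
  where "pure_tensor D U V u v =
    tensor_relations D U V #>\<^bsub>tensor_free U V\<^esub> frag_of (u, v)"

text \<open>The map induced on \<open>U \<otimes>\<^sub>D V\<close> by a map \<open>\<phi>\<close> on pairs: if the additive extension of \<open>\<phi>\<close>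
  preserves the subgroup of relations, the coset of \<open>x\<close> is sent to the coset of its image.\<close>

definition tensor_map ::
    "('k, 'd) module \<Rightarrow> ('k, 'c, 'd, 'm) bimodule \<Rightarrow> ('k, 'd, 'e, 'n) bimodule \<Rightarrow>
     ('m \<times> 'n \<Rightarrow> 'm \<times> 'n) \<Rightarrow> ('m \<times> 'n \<Rightarrow>\<^sub>0 int) set \<Rightarrow> ('m \<times> 'n \<Rightarrow>\<^sub>0 int) set"
  where "tensor_map D U V \<phi> X =
    tensor_relations D U V <#>\<^bsub>tensor_free U V\<^esub> (frag_extend (\<lambda>p. frag_of (\<phi> p)) ` X)"

definition tensor_product ::
    "('k, 'd) module \<Rightarrow> ('k, 'c, 'd, 'm) bimodule \<Rightarrow> ('k, 'd, 'e, 'n) bimodule \<Rightarrow>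
     ('k, 'c, 'e, ('m \<times> 'n \<Rightarrow>\<^sub>0 int) set) bimodule"
  where "tensor_product D U V = (let T = tensor_free U V Mod tensor_relations D U V in
    \<lparr>carrier = carrier T,
     monoid.mult = (\<lambda>_ _. \<one>\<^bsub>T\<^esub>),
     one = \<one>\<^bsub>T\<^esub>,
     zero = \<one>\<^bsub>T\<^esub>,
     add = monoid.mult T,
     smult = (\<lambda>k. tensor_map D U V (\<lambda>(u, v). (k \<odot>\<^bsub>U\<^esub> u, v))),
     lact = (\<lambda>c. tensor_map D U V (\<lambda>(u, v). (lact U c u, v))),
     ract = (\<lambda>X e. tensor_map D U V (\<lambda>(u, v). (u, ract V v e)) X)\<rparr>)"


section \<open>Stable equivalences of Morita type\<close>

text \<open>All modules are finitely generated; as above, the type \<^typ>\<open>nat \<Rightarrow> 'k\<close> is large enough for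
  finitely generated bimodules over finite-dimensional algebras.\<close>

definition stably_equivalent_Morita ::
    "('k, 'q) ring_scheme \<Rightarrow> ('k, 'c) module \<Rightarrow> ('k, 'd) module \<Rightarrow> bool"
  where "stably_equivalent_Morita K C D \<longleftrightarrow>
    (\<exists>(U :: ('k, 'c, 'd, nat \<Rightarrow> 'k) bimodule) (V :: ('k, 'd, 'c, nat \<Rightarrow> 'k) bimodule)
      (P :: ('k, 'c, 'c, nat \<Rightarrow> 'k) bimodule) (Q :: ('k, 'd, 'd, nat \<Rightarrow> 'k) bimodule).
      fg_bimodule K C D U \<and> left_projective K C U \<and> right_projective K D U \<and>
      fg_bimodule K D C V \<and> left_projective K D V \<and> right_projective K C V \<and>
      projective_bimodule K C C P \<and> projective_bimodule K D D Q \<and>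
      isomorphic_bimodules K C C (tensor_product D U V) (bimodule_sum (regular_bimodule C) P) \<and>
      isomorphic_bimodules K D D (tensor_product C V U) (bimodule_sum (regular_bimodule D) Q))"


section \<open>Gradings by a finite group\<close>

text \<open>A grading is given by its family \<open>\<G>\<close> of homogeneous components. Since the group is finite,
  the internal direct sum decomposition can be stated with families indexed by the whole
  group.\<close>

definition grading ::
    "('g, 'p) monoid_scheme \<Rightarrow> ('k, 'q) ring_scheme \<Rightarrow> ('k, 'm, 'r) module_scheme \<Rightarrow>
     ('g \<Rightarrow> 'm set) \<Rightarrow> bool"
  where "grading G K M \<G> \<longleftrightarrow> (\<forall>g\<in>carrier G. subspace K (\<G> g) M) \<and>
    (\<forall>m\<in>carrier M. \<exists>!c. c \<in> PiE (carrier G) \<G> \<and> m = (\<Oplus>\<^bsub>M\<^esub>g\<in>carrier G. c g))"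

definition graded_algebra ::
    "('g, 'p) monoid_scheme \<Rightarrow> ('k, 'q) ring_scheme \<Rightarrow> ('k, 'a) module \<Rightarrow>
     ('g \<Rightarrow> 'a set) \<Rightarrow> bool"
  where "graded_algebra G K A \<A> \<longleftrightarrow> k_algebra K A \<and> grading G K A \<A> \<and>
    (\<forall>g\<in>carrier G. \<forall>h\<in>carrier G. \<forall>a\<in>\<A> g. \<forall>b\<in>\<A> h. a \<otimes>\<^bsub>A\<^esub> b \<in> \<A> (g \<otimes>\<^bsub>G\<^esub> h))"

definition trivial_grading ::
    "('g, 'p) monoid_scheme \<Rightarrow> ('k, 'a) module \<Rightarrow> 'g \<Rightarrow> 'a set"
  where "trivial_grading G A g = (if g = \<one>\<^bsub>G\<^esub> then carrier A else {\<zero>\<^bsub>A\<^esub>})"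

definition graded_bimodule ::
    "('g, 'p) monoid_scheme \<Rightarrow> ('k, 'q) ring_scheme \<Rightarrow> ('k, 'c) module \<Rightarrow> ('g \<Rightarrow> 'c set) \<Rightarrow>
     ('k, 'd) module \<Rightarrow> ('g \<Rightarrow> 'd set) \<Rightarrow> ('k, 'c, 'd, 'm) bimodule \<Rightarrow> ('g \<Rightarrow> 'm set) \<Rightarrow> bool"
  where "graded_bimodule G K C \<C> D \<D> U \<U> \<longleftrightarrow> fg_bimodule K C D U \<and> grading G K U \<U> \<and>
    (\<forall>g\<in>carrier G. \<forall>h\<in>carrier G. \<forall>c\<in>\<C> g. \<forall>u\<in>\<U> h. lact U c u \<in> \<U> (g \<otimes>\<^bsub>G\<^esub> h)) \<and>
    (\<forall>g\<in>carrier G. \<forall>h\<in>carrier G. \<forall>u\<in>\<U> g. \<forall>d\<in>\<D> h. ract U u d \<in> \<U> (g \<otimes>\<^bsub>G\<^esub> h))"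

definition graded_hom ::
    "('g, 'p) monoid_scheme \<Rightarrow> ('k, 'q) ring_scheme \<Rightarrow> ('k, 'c) module \<Rightarrow> ('k, 'd) module \<Rightarrow>
     ('k, 'c, 'd, 'm) bimodule \<Rightarrow> ('g \<Rightarrow> 'm set) \<Rightarrow>
     ('k, 'c, 'd, 'n) bimodule \<Rightarrow> ('g \<Rightarrow> 'n set) \<Rightarrow> ('m \<Rightarrow> 'n) set"
  where "graded_hom G K C D U \<U> V \<V> =
    {f \<in> bimodule_hom K C D U V. \<forall>g\<in>carrier G. f ` \<U> g \<subseteq> \<V> g}"

definition isomorphic_graded ::
    "('g, 'p) monoid_scheme \<Rightarrow> ('k, 'q) ring_scheme \<Rightarrow> ('k, 'c) module \<Rightarrow> ('k, 'd) module \<Rightarrow>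
     ('k, 'c, 'd, 'm) bimodule \<Rightarrow> ('g \<Rightarrow> 'm set) \<Rightarrow>
     ('k, 'c, 'd, 'n) bimodule \<Rightarrow> ('g \<Rightarrow> 'n set) \<Rightarrow> bool"
  where "isomorphic_graded G K C D U \<U> V \<V> \<longleftrightarrow>
    (\<exists>f\<in>graded_hom G K C D U \<U> V \<V>. bij_betw f (carrier U) (carrier V))"

text \<open>Projective objects in the category of finitely generated graded bimodules and
  degree-preserving homomorphisms.\<close>

definition graded_projective ::
    "('g, 'p) monoid_scheme \<Rightarrow> ('k, 'q) ring_scheme \<Rightarrow> ('k, 'c) module \<Rightarrow> ('g \<Rightarrow> 'c set) \<Rightarrow>
     ('k, 'd) module \<Rightarrow> ('g \<Rightarrow> 'd set) \<Rightarrow> ('k, 'c, 'd, 'm) bimodule \<Rightarrow> ('g \<Rightarrow> 'm set) \<Rightarrow> bool"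
  where "graded_projective G K C \<C> D \<D> P \<P> \<longleftrightarrow> graded_bimodule G K C \<C> D \<D> P \<P> \<and>
    (\<forall>(X :: ('k, 'c, 'd, nat \<Rightarrow> 'k) bimodule) \<X> (Y :: ('k, 'c, 'd, nat \<Rightarrow> 'k) bimodule) \<Y> e f.
      graded_bimodule G K C \<C> D \<D> X \<X> \<and> graded_bimodule G K C \<C> D \<D> Y \<Y> \<and>
      e \<in> graded_hom G K C D X \<X> Y \<Y> \<and> e ` carrier X = carrier Y \<and>
      f \<in> graded_hom G K C D P \<P> Y \<Y> \<longrightarrow>
      (\<exists>h\<in>graded_hom G K C D P \<P> X \<X>. \<forall>p\<in>carrier P. e (h p) = f p))"

text \<open>Graded one-sided modules are graded bimodules over \<open>K\<close> concentrated in degree \<open>1\<close> on the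
  other side.\<close>

definition left_graded_projective ::
    "('g, 'p) monoid_scheme \<Rightarrow> ('k, 'q) ring_scheme \<Rightarrow> ('k, 'c) module \<Rightarrow> ('g \<Rightarrow> 'c set) \<Rightarrow>
     ('k, 'c, 'd, 'm) bimodule \<Rightarrow> ('g \<Rightarrow> 'm set) \<Rightarrow> bool"
  where "left_graded_projective G K C \<C> U \<U> \<longleftrightarrow>
    graded_projective G K C \<C> (self_algebra K) (trivial_grading G (self_algebra K))
      (as_left_module U) \<U>"

definition right_graded_projective ::
    "('g, 'p) monoid_scheme \<Rightarrow> ('k, 'q) ring_scheme \<Rightarrow> ('k, 'd) module \<Rightarrow> ('g \<Rightarrow> 'd set) \<Rightarrow>
     ('k, 'c, 'd, 'm) bimodule \<Rightarrow> ('g \<Rightarrow> 'm set) \<Rightarrow> bool"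
  where "right_graded_projective G K D \<D> U \<U> \<longleftrightarrow>
    graded_projective G K (self_algebra K) (trivial_grading G (self_algebra K)) D \<D>
      (as_right_module U) \<U>"

text \<open>The component of degree \<open>g\<close> of \<open>U \<otimes>\<^sub>D V\<close> is additively generated by the tensors \<open>u \<otimes> v\<close> of
  homogeneous elements whose degrees multiply to \<open>g\<close>.\<close>

definition tensor_grading ::
    "('g, 'p) monoid_scheme \<Rightarrow> ('k, 'd) module \<Rightarrow>
     ('k, 'c, 'd, 'm) bimodule \<Rightarrow> ('g \<Rightarrow> 'm set) \<Rightarrow>
     ('k, 'd, 'e, 'n) bimodule \<Rightarrow> ('g \<Rightarrow> 'n set) \<Rightarrow> 'g \<Rightarrow> ('m \<times> 'n \<Rightarrow>\<^sub>0 int) set set"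
  where "tensor_grading G D U \<U> V \<V> g =
    generate (tensor_free U V Mod tensor_relations D U V)
      {pure_tensor D U V u v | x y u v.
         x \<in> carrier G \<and> y \<in> carrier G \<and> x \<otimes>\<^bsub>G\<^esub> y = g \<and> u \<in> \<U> x \<and> v \<in> \<V> y}"

definition sum_grading :: "('g \<Rightarrow> 'm set) \<Rightarrow> ('g \<Rightarrow> 'n set) \<Rightarrow> 'g \<Rightarrow> ('m \<times> 'n) set"
  where "sum_grading \<U> \<V> g = \<U> g \<times> \<V> g"

definition graded_stably_equivalent_Morita ::
    "('g, 'p) monoid_scheme \<Rightarrow> ('k, 'q) ring_scheme \<Rightarrow> ('k, 'a) module \<Rightarrow> ('g \<Rightarrow> 'a set) \<Rightarrow>
     ('k, 'b) module \<Rightarrow> ('g \<Rightarrow> 'b set) \<Rightarrow> bool"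
  where "graded_stably_equivalent_Morita G K A \<A> B \<B> \<longleftrightarrow>
    (\<exists>(M :: ('k, 'a, 'b, nat \<Rightarrow> 'k) bimodule) \<M> (N :: ('k, 'b, 'a, nat \<Rightarrow> 'k) bimodule) \<N>
      (P :: ('k, 'a, 'a, nat \<Rightarrow> 'k) bimodule) \<P> (Q :: ('k, 'b, 'b, nat \<Rightarrow> 'k) bimodule) \<Q>.
      graded_bimodule G K A \<A> B \<B> M \<M> \<and>
      left_graded_projective G K A \<A> M \<M> \<and> right_graded_projective G K B \<B> M \<M> \<and>
      graded_bimodule G K B \<B> A \<A> N \<N> \<and>
      left_graded_projective G K B \<B> N \<N> \<and> right_graded_projective G K A \<A> N \<N> \<and>
      graded_projective G K A \<A> A \<A> P \<P> \<and> graded_projective G K B \<B> B \<B> Q \<Q> \<and>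
      isomorphic_graded G K A A (tensor_product B M N) (tensor_grading G B M \<M> N \<N>)
        (bimodule_sum (regular_bimodule A) P) (sum_grading \<A> \<P>) \<and>
      isomorphic_graded G K B B (tensor_product A N M) (tensor_grading G A N \<N> M \<M>)
        (bimodule_sum (regular_bimodule B) Q) (sum_grading \<B> \<Q>))"


section \<open>The Beilinson--Green algebra\<close>

definition Beilinson_Green ::
    "('g, 'p) monoid_scheme \<Rightarrow> ('k, 'a) module \<Rightarrow> ('g \<Rightarrow> 'a set) \<Rightarrow> ('k, 'g \<times> 'g \<Rightarrow> 'a) module"
  where "Beilinson_Green G A \<A> = (let I = carrier G \<times> carrier G in
    \<lparr>carrier = PiE I (\<lambda>(g, h). \<A> (g \<otimes>\<^bsub>G\<^esub> inv\<^bsub>G\<^esub> h)),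
     monoid.mult = (\<lambda>a b. \<lambda>(g, l)\<in>I. \<Oplus>\<^bsub>A\<^esub>h\<in>carrier G. a (g, h) \<otimes>\<^bsub>A\<^esub> b (h, l)),
     one = (\<lambda>(g, h)\<in>I. if g = h then \<one>\<^bsub>A\<^esub> else \<zero>\<^bsub>A\<^esub>),
     zero = (\<lambda>p\<in>I. \<zero>\<^bsub>A\<^esub>),
     add = (\<lambda>a b. \<lambda>p\<in>I. a p \<oplus>\<^bsub>A\<^esub> b p),
     smult = (\<lambda>k a. \<lambda>p\<in>I. k \<odot>\<^bsub>A\<^esub> a p)\<rparr>)"

end

theory Submission
  imports Defs
begin

text \<open>For a graded bimodule \<open>U\<close> let \<open>bar U\<close> consist of the matrices whose \<open>(g, h)\<close> entry has degree
  \<open>g h\<inverse>\<close>; it is a bimodule over the Beilinson--Green algebras. The equivalence is given by \<open>bar M\<close>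
  and \<open>bar N\<close>.

  Sending \<open>a\<close> to the matrix of its homogeneous components embeds \<open>A\<close> into its Beilinson--Green
  algebra. Restricting a bimodule \<open>Y\<close> along this embedding on both sides, with \<open>e\<^sub>g Y e\<^sub>h\<close> placed in
  degree \<open>g h\<inverse>\<close>, is an exact right adjoint of \<open>bar\<close>, so \<open>bar\<close> preserves projectivity, directly from
  the lifting property. For one-sided modules the same argument is applied to one column (or row)
  at a time.

  An isomorphism of \<open>M \<otimes> N\<close> with \<open>A \<oplus> P\<close> is a graded pairing with values in \<open>A \<oplus> P\<close>, and the matrix
  product with respect to this pairing induces the isomorphism of \<open>bar M \<otimes> bar N\<close> with
  \<open>bar A \<oplus> bar P\<close>. Its inverse is assembled from the maps sending \<open>m \<otimes> n\<close> to \<open>e\<^sub>g m \<otimes> n e\<^sub>l\<close>.\<close>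

section \<open>Additive maps and finite sums\<close>

text \<open>Projectivity is a lifting property against test bimodules with elements of type
  \<open>nat \<Rightarrow> 'k\<close>. Restriction of scalars leaves carriers untouched, so
  restricted test objects belong again to the class over which the graded lifting property
  quantifies. Finite generation has to be carried along in both directions, since both properties
  speak of finitely generated objects.

  The one-sided statements are not the two-sided one applied to one-sided modules. Over a left
  module \<open>bar\<close> yields a bimodule over the Beilinson--Green algebra of K, which consists
  of diagonal matrices, whereas left projectivity of \<open>bar U\<close> concerns scalars from K
  itself. These do not separate the columns, so each column has to be lifted for itself. The locale
  \<open>side\<close> describes both situations at once, and a bimodule has one such side on the
  left and one on the right; lifts are indexed by classes of matrix indices, a class being the whole
  group for the matrix algebra and a single index for K.\<close>

definition additive_map :: "('m, 'r) ring_scheme \<Rightarrow> ('n, 's) ring_scheme \<Rightarrow> ('m \<Rightarrow> 'n) \<Rightarrow> bool"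
  where "additive_map M N f \<longleftrightarrow> f \<in> carrier M \<rightarrow> carrier N \<and>
    (\<forall>x\<in>carrier M. \<forall>y\<in>carrier M. f (x \<oplus>\<^bsub>M\<^esub> y) = f x \<oplus>\<^bsub>N\<^esub> f y)"

lemma additive_mapI:
  assumes "\<And>x. x \<in> carrier M \<Longrightarrow> f x \<in> carrier N"
    and "\<And>x y. x \<in> carrier M \<Longrightarrow> y \<in> carrier M \<Longrightarrow> f (x \<oplus>\<^bsub>M\<^esub> y) = f x \<oplus>\<^bsub>N\<^esub> f y"
  shows "additive_map M N f"
  using assms by (auto simp: additive_map_def)

lemma additive_map_closed: "additive_map M N f \<Longrightarrow> x \<in> carrier M \<Longrightarrow> f x \<in> carrier N"
  by (auto simp: additive_map_def)

lemma additive_map_add: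
  "additive_map M N f \<Longrightarrow> x \<in> carrier M \<Longrightarrow> y \<in> carrier M \<Longrightarrow> f (x \<oplus>\<^bsub>M\<^esub> y) = f x \<oplus>\<^bsub>N\<^esub> f y"
  by (auto simp: additive_map_def)

lemma additive_map_compose:
  "additive_map M N f \<Longrightarrow> additive_map N L g \<Longrightarrow> additive_map M L (\<lambda>x. g (f x))"
  by (auto simp: additive_map_def Pi_iff)

lemma additive_map_zero:
  assumes "abelian_group M" "abelian_group N" "additive_map M N f"
  shows "f \<zero>\<^bsub>M\<^esub> = \<zero>\<^bsub>N\<^esub>"
proof -
  interpret M: abelian_group M by fact
  interpret N: abelian_group N by fact
  have "f \<zero>\<^bsub>M\<^esub> \<oplus>\<^bsub>N\<^esub> f \<zero>\<^bsub>M\<^esub> = f \<zero>\<^bsub>M\<^esub>"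
    using additive_map_add[OF assms(3), of "\<zero>\<^bsub>M\<^esub>" "\<zero>\<^bsub>M\<^esub>"] by simp
  then show ?thesis
    using additive_map_closed[OF assms(3) M.zero_closed] by (simp add: N.add.l_cancel_one)
qed

text \<open>Induction on the index set; over an infinite one both sums are zero by convention, and f
  preserves zero. Actions, homogeneous projections, entries of matrices and maps out of tensor
  products are all moved past sums this way.\<close>

lemma additive_map_finsum:
  assumes M: "abelian_group M" and N: "abelian_group N" and f: "additive_map M N f"
    and x: "\<And>i. i \<in> I \<Longrightarrow> x i \<in> carrier M"
  shows "f (finsum M x I) = finsum N (\<lambda>i. f (x i)) I"
proof -
  interpret M: abelian_group M by fact
  interpret N: abelian_group N by fact
  have fx: "\<And>i. i \<in> I \<Longrightarrow> f (x i) \<in> carrier N" using x additive_map_closed[OF f] by blast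
  show ?thesis
    using x fx
  proof (induction I rule: infinite_finite_induct)
    case (insert i I)
    then have "f (finsum M x (insert i I)) = f (x i) \<oplus>\<^bsub>N\<^esub> f (finsum M x I)"
      by (simp add: M.finsum_insert Pi_iff additive_map_add[OF f])
    with insert show ?case by (simp add: N.finsum_insert Pi_iff)
  qed (simp_all add: M.finsum_infinite N.finsum_infinite additive_map_zero[OF M N f])
qed

text \<open>Restricted, one-sided and regular bimodules are different records on one additive group;
  this lets a sum formed in one of them be read in another.\<close>

lemma finsum_eq_structure:
  assumes "carrier M = carrier N" "add M = add N" "zero M = zero N"
  shows "finsum M f I = finsum N f I"
  using assms unfolding finsum_def finprod_def by simp

context abelian_group
begin

lemma finsum_eqI:
  assumes "\<And>i. i \<in> I \<Longrightarrow> f i = g i" "\<And>i. i \<in> I \<Longrightarrow> g i \<in> carrier G"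
  shows "finsum G f I = finsum G g I"
  using assms by (intro finsum_cong') auto

lemma finsum_all_zero: "(\<And>i. i \<in> I \<Longrightarrow> f i = \<zero>) \<Longrightarrow> finsum G f I = \<zero>"
  by (rule add.finprod_one_eqI)

lemma finsum_only:
  assumes "finite I" "i \<in> I" "\<And>j. j \<in> I \<Longrightarrow> j \<noteq> i \<Longrightarrow> f j = \<zero>" "f i \<in> carrier G"
  shows "finsum G f I = f i"
proof -
  have c: "f j \<in> carrier G" if "j \<in> I" for j
    using assms that by (cases "j = i") auto
  have "finsum G f I = finsum G (\<lambda>j. if i = j then f j else \<zero>) I"
  proof (rule finsum_eqI)
    show "f j = (if i = j then f j else \<zero>)" if "j \<in> I" for j
      using assms(3) that by auto
  qed (simp add: c)
  also have "\<dots> = f i"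
    using assms(1,2) c by (intro finsum_singleton) auto
  finally show ?thesis .
qed

lemma finsum_swap:
  assumes "finite I" "finite J" "\<And>i j. i \<in> I \<Longrightarrow> j \<in> J \<Longrightarrow> f i j \<in> carrier G"
  shows "finsum G (\<lambda>i. finsum G (\<lambda>j. f i j) J) I = finsum G (\<lambda>j. finsum G (\<lambda>i. f i j) I) J"
  using assms(1,3)
proof (induction I)
  case empty
  then show ?case by (simp add: finsum_all_zero)
next
  case (insert i I)
  have "finsum G (\<lambda>i. finsum G (\<lambda>j. f i j) J) (insert i I) =
      finsum G (\<lambda>j. f i j) J \<oplus> finsum G (\<lambda>j. finsum G (\<lambda>i. f i j) I) J"
    using insert by (simp add: finsum_insert Pi_iff)
  also have "\<dots> = finsum G (\<lambda>j. f i j \<oplus> finsum G (\<lambda>i. f i j) I) J"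
    using insert by (intro finsum_addf[symmetric]) (auto simp: Pi_iff)
  also have "\<dots> = finsum G (\<lambda>j. finsum G (\<lambda>i. f i j) (insert i I)) J"
    using insert by (intro finsum_eqI) (auto simp: finsum_insert Pi_iff)
  finally show ?case .
qed

lemma finsum_mem:
  assumes "\<zero> \<in> W" "\<And>v w. v \<in> W \<Longrightarrow> w \<in> W \<Longrightarrow> v \<oplus> w \<in> W" "W \<subseteq> carrier G"
    and "\<And>i. i \<in> I \<Longrightarrow> f i \<in> W"
  shows "finsum G f I \<in> W"
  using assms(4)
proof (induction I rule: infinite_finite_induct)
  case (insert i I)
  then have "f \<in> I \<rightarrow> carrier G" "f i \<in> carrier G" using assms(3) by auto
  with insert show ?case by (simp add: finsum_insert assms(2))
qed (simp_all add: finsum_infinite assms(1))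

end

lemma additive_map_const_zero:
  "abelian_group N \<Longrightarrow> additive_map M N (\<lambda>_. \<zero>\<^bsub>N\<^esub>)"
  by (rule additive_mapI) (simp_all add: abelian_monoid.zero_closed abelian_group.axioms(1)
      abelian_monoid.l_zero)

lemma additive_map_sum:
  assumes "abelian_group N" and "\<And>i. i \<in> I \<Longrightarrow> additive_map M N (f i)"
  shows "additive_map M N (\<lambda>x. finsum N (\<lambda>i. f i x) I)"
proof -
  interpret N: abelian_group N by fact
  show ?thesis
  proof (rule additive_mapI)
    fix x assume x: "x \<in> carrier M"
    show "finsum N (\<lambda>i. f i x) I \<in> carrier N"
      using x assms(2) by (intro N.finsum_closed) (auto intro: additive_map_closed)
    fix y assume y: "y \<in> carrier M"
    have "finsum N (\<lambda>i. f i (x \<oplus>\<^bsub>M\<^esub> y)) I = finsum N (\<lambda>i. f i x \<oplus>\<^bsub>N\<^esub> f i y) I"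
      using x y assms(2)
      by (intro N.finsum_eqI) (auto intro!: additive_map_add N.a_closed intro: additive_map_closed)
    also have "\<dots> = finsum N (\<lambda>i. f i x) I \<oplus>\<^bsub>N\<^esub> finsum N (\<lambda>i. f i y) I"
      using x y assms(2) by (intro N.finsum_addf) (auto intro: additive_map_closed)
    finally show "finsum N (\<lambda>i. f i (x \<oplus>\<^bsub>M\<^esub> y)) I =
      finsum N (\<lambda>i. f i x) I \<oplus>\<^bsub>N\<^esub> finsum N (\<lambda>i. f i y) I" .
  qed
qed

section \<open>Graded vector spaces\<close>

lemma vectorspace_abelian_group: "vectorspace K V \<Longrightarrow> abelian_group V"
  by (simp add: vectorspace_def module_def)

lemma vectorspace_module: "vectorspace K V \<Longrightarrow> module K V"
  by (simp add: vectorspace_def)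

lemma vectorspace_field: "vectorspace K V \<Longrightarrow> field K"
  by (simp add: vectorspace_def)

lemma subspaceI:
  assumes "vectorspace K V" "W \<subseteq> carrier V" "\<zero>\<^bsub>V\<^esub> \<in> W"
    and "\<And>v w. v \<in> W \<Longrightarrow> w \<in> W \<Longrightarrow> v \<oplus>\<^bsub>V\<^esub> w \<in> W"
    and "\<And>k v. k \<in> carrier K \<Longrightarrow> v \<in> W \<Longrightarrow> k \<odot>\<^bsub>V\<^esub> v \<in> W"
  shows "subspace K W V"
  using assms by (auto simp: subspace_def intro!: LinearCombinations.submodule.intro vectorspace_module)

lemma
  assumes "subspace K W V"
  shows subspace_subset: "W \<subseteq> carrier V" and subspace_zero: "\<zero>\<^bsub>V\<^esub> \<in> W"
    and subspace_add: "\<And>v w. v \<in> W \<Longrightarrow> w \<in> W \<Longrightarrow> v \<oplus>\<^bsub>V\<^esub> w \<in> W"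
    and subspace_smult: "\<And>k v. k \<in> carrier K \<Longrightarrow> v \<in> W \<Longrightarrow> k \<odot>\<^bsub>V\<^esub> v \<in> W"
  using assms by (auto simp: subspace_def LinearCombinations.submodule_def)

lemma subspace_finsum:
  assumes "subspace K W V" "\<And>i. i \<in> I \<Longrightarrow> f i \<in> W"
  shows "finsum V f I \<in> W"
  using assms vectorspace_abelian_group[of K V]
  by (intro abelian_group.finsum_mem)
    (auto simp: subspace_def LinearCombinations.submodule_def)

section \<open>Projections onto homogeneous components\<close>

definition hcomp :: "('g, 'p) monoid_scheme \<Rightarrow> ('m, 'r) ring_scheme \<Rightarrow> ('g \<Rightarrow> 'm set) \<Rightarrow>
    'g \<Rightarrow> 'm \<Rightarrow> 'm"
  where "hcomp G M \<G> x m = (THE c. c \<in> PiE (carrier G) \<G> \<and> m = (\<Oplus>\<^bsub>M\<^esub>g\<in>carrier G. c g)) x"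

locale graded_space =
  fixes G :: "('g, 'p) monoid_scheme" and K :: "('k, 'q) ring_scheme"
    and M :: "('k, 'm, 'r) module_scheme" and \<G> :: "'g \<Rightarrow> 'm set"
  assumes G: "group G" and fin: "finite (carrier G)" and vs: "vectorspace K M"
    and gr: "grading G K M \<G>"
begin

sublocale grp: group G by (rule G)
sublocale ab: abelian_group M by (rule vectorspace_abelian_group[OF vs])
sublocale md: module K M by (rule vectorspace_module[OF vs])

lemma homog_subspace: "x \<in> carrier G \<Longrightarrow> subspace K (\<G> x) M"
  using gr by (simp add: grading_def)

lemma homog_carrier: "x \<in> carrier G \<Longrightarrow> m \<in> \<G> x \<Longrightarrow> m \<in> carrier M"
  using subspace_subset[OF homog_subspace] by blast

text \<open>Uniqueness in \<open>grading\<close>, freed from \<open>PiE\<close>: the family is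
  restricted to the group before it is compared. Linearity of the projections and their values on
  homogeneous elements follow by exhibiting a suitable family.\<close>

lemma hcomp_eqI:
  assumes "\<And>x. x \<in> carrier G \<Longrightarrow> c x \<in> \<G> x" "m = finsum M c (carrier G)" "x \<in> carrier G"
  shows "hcomp G M \<G> x m = c x"
proof -
  have "m \<in> carrier M"
    using assms homog_carrier by (auto intro!: ab.finsum_closed)
  then have ex: "\<exists>!c. c \<in> PiE (carrier G) \<G> \<and> m = finsum M c (carrier G)"
    using gr by (simp add: grading_def)
  have "m = finsum M (restrict c (carrier G)) (carrier G)"
    using assms homog_carrier by (auto intro!: ab.finsum_eqI)
  then have "(THE c. c \<in> PiE (carrier G) \<G> \<and> m = finsum M c (carrier G)) = restrict c (carrier G)"
    using assms(1) by (intro the1_equality[OF ex]) auto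
  then show ?thesis using assms(3) by (simp add: hcomp_def)
qed

lemma
  assumes "m \<in> carrier M"
  shows hcomp_in: "\<And>x. x \<in> carrier G \<Longrightarrow> hcomp G M \<G> x m \<in> \<G> x"
    and sum_hcomp: "finsum M (\<lambda>x. hcomp G M \<G> x m) (carrier G) = m"
proof -
  have ex: "\<exists>!c. c \<in> PiE (carrier G) \<G> \<and> m = finsum M c (carrier G)"
    using gr assms by (simp add: grading_def)
  from theI'[OF ex] show "\<And>x. x \<in> carrier G \<Longrightarrow> hcomp G M \<G> x m \<in> \<G> x"
    and "finsum M (\<lambda>x. hcomp G M \<G> x m) (carrier G) = m"
    by (auto simp: hcomp_def)
qed

lemma hcomp_carrier: "m \<in> carrier M \<Longrightarrow> x \<in> carrier G \<Longrightarrow> hcomp G M \<G> x m \<in> carrier M"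
  using hcomp_in homog_carrier by blast

lemma hcomp_add:
  assumes "m \<in> carrier M" "n \<in> carrier M" "x \<in> carrier G"
  shows "hcomp G M \<G> x (m \<oplus>\<^bsub>M\<^esub> n) = hcomp G M \<G> x m \<oplus>\<^bsub>M\<^esub> hcomp G M \<G> x n"
proof (rule hcomp_eqI[where c = "\<lambda>x. hcomp G M \<G> x m \<oplus>\<^bsub>M\<^esub> hcomp G M \<G> x n"])
  show "m \<oplus>\<^bsub>M\<^esub> n = (\<Oplus>\<^bsub>M\<^esub>x\<in>carrier G. hcomp G M \<G> x m \<oplus>\<^bsub>M\<^esub> hcomp G M \<G> x n)"
    using assms by (subst ab.finsum_addf) (auto simp: hcomp_carrier sum_hcomp)
qed (use assms in \<open>auto intro!: subspace_add[OF homog_subspace] hcomp_in\<close>)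

lemma hcomp_smult:
  assumes "k \<in> carrier K" "m \<in> carrier M" "x \<in> carrier G"
  shows "hcomp G M \<G> x (k \<odot>\<^bsub>M\<^esub> m) = k \<odot>\<^bsub>M\<^esub> hcomp G M \<G> x m"
proof (rule hcomp_eqI[where c = "\<lambda>x. k \<odot>\<^bsub>M\<^esub> hcomp G M \<G> x m"])
  have "additive_map M M (\<lambda>m. k \<odot>\<^bsub>M\<^esub> m)"
    using assms by (intro additive_mapI) (auto simp: md.smult_r_distr)
  from additive_map_finsum[OF ab.abelian_group_axioms ab.abelian_group_axioms this,
      of "carrier G" "\<lambda>x. hcomp G M \<G> x m"]
  show "k \<odot>\<^bsub>M\<^esub> m = (\<Oplus>\<^bsub>M\<^esub>x\<in>carrier G. k \<odot>\<^bsub>M\<^esub> hcomp G M \<G> x m)"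
    using assms by (simp add: hcomp_carrier sum_hcomp)
qed (use assms in \<open>auto intro!: subspace_smult[OF homog_subspace] hcomp_in\<close>)

lemma hcomp_homog:
  assumes "m \<in> \<G> y" "x \<in> carrier G" "y \<in> carrier G"
  shows "hcomp G M \<G> x m = (if x = y then m else \<zero>\<^bsub>M\<^esub>)"
proof (rule hcomp_eqI[where c = "\<lambda>x. if x = y then m else \<zero>\<^bsub>M\<^esub>"])
  show "m = (\<Oplus>\<^bsub>M\<^esub>x\<in>carrier G. if x = y then m else \<zero>\<^bsub>M\<^esub>)"
    using assms fin homog_carrier by (subst ab.finsum_only[of _ y]) auto
qed (use assms in \<open>auto intro!: subspace_zero[OF homog_subspace]\<close>)

lemma hcomp_additive: "x \<in> carrier G \<Longrightarrow> additive_map M M (hcomp G M \<G> x)"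
  by (intro additive_mapI) (auto simp: hcomp_carrier hcomp_add)

lemma hcomp_finsum:
  "x \<in> carrier G \<Longrightarrow> (\<And>i. i \<in> I \<Longrightarrow> f i \<in> carrier M) \<Longrightarrow>
    hcomp G M \<G> x (finsum M f I) = (\<Oplus>\<^bsub>M\<^esub>i\<in>I. hcomp G M \<G> x (f i))"
  by (rule additive_map_finsum[OF ab.abelian_group_axioms ab.abelian_group_axioms hcomp_additive])

end

text \<open>Unique decomposition is obtained from a system of projections: applying
  \<open>\<pi> x\<close> to a decomposition of m kills every term but the one of degree x, so the
  family is recovered from m. In this form the corners of a bimodule will be recognised as a
  grading.\<close>

lemma gradingI:
  assumes M: "vectorspace K M" and fin: "finite (carrier G)"
    and sub: "\<And>x. x \<in> carrier G \<Longrightarrow> subspace K (\<G> x) M"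
    and in_comp: "\<And>x m. x \<in> carrier G \<Longrightarrow> m \<in> carrier M \<Longrightarrow> \<pi> x m \<in> \<G> x"
    and add: "\<And>x. x \<in> carrier G \<Longrightarrow> additive_map M M (\<pi> x)"
    and sum: "\<And>m. m \<in> carrier M \<Longrightarrow> finsum M (\<lambda>x. \<pi> x m) (carrier G) = m"
    and proj: "\<And>x y m. x \<in> carrier G \<Longrightarrow> y \<in> carrier G \<Longrightarrow> m \<in> \<G> y \<Longrightarrow>
      \<pi> x m = (if x = y then m else \<zero>\<^bsub>M\<^esub>)"
  shows "grading G K M \<G>"
  unfolding grading_def
proof (intro conjI ballI)
  interpret M: abelian_group M by (rule vectorspace_abelian_group[OF M])
  fix m assume m: "m \<in> carrier M"
  show "\<exists>!c. c \<in> PiE (carrier G) \<G> \<and> m = (\<Oplus>\<^bsub>M\<^esub>g\<in>carrier G. c g)"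
  proof (rule ex1I[of _ "\<lambda>x\<in>carrier G. \<pi> x m"])
    have "(\<Oplus>\<^bsub>M\<^esub>g\<in>carrier G. (\<lambda>x\<in>carrier G. \<pi> x m) g) = m"
      using m additive_map_closed[OF add] by (subst sum[OF m, symmetric]) (auto intro!: M.finsum_eqI)
    with m in_comp show "(\<lambda>x\<in>carrier G. \<pi> x m) \<in> PiE (carrier G) \<G> \<and>
      m = (\<Oplus>\<^bsub>M\<^esub>g\<in>carrier G. (\<lambda>x\<in>carrier G. \<pi> x m) g)" by auto
  next
    fix c assume c: "c \<in> PiE (carrier G) \<G> \<and> m = (\<Oplus>\<^bsub>M\<^esub>g\<in>carrier G. c g)"
    then have cG: "c y \<in> \<G> y" "c y \<in> carrier M" if "y \<in> carrier G" for y
      using subspace_subset[OF sub] that by auto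
    have "\<pi> x m = c x" if x: "x \<in> carrier G" for x
    proof -
      have "\<pi> x m = (\<Oplus>\<^bsub>M\<^esub>y\<in>carrier G. \<pi> x (c y))"
        using c cG additive_map_finsum[OF M.abelian_group_axioms M.abelian_group_axioms add[OF x],
            of "carrier G" c] by auto
      also have "\<dots> = c x"
        using x cG fin proj[OF x] by (subst M.finsum_only[of _ x]) auto
      finally show ?thesis .
    qed
    then show "c = (\<lambda>x\<in>carrier G. \<pi> x m)"
      using c by (intro PiE_ext[of c "carrier G" \<G>]) (auto intro: in_comp m)
  qed
qed (rule sub)

section \<open>Matrices of homogeneous elements\<close>

lemma (in group) mult_inv_middle:
  "g \<in> carrier G \<Longrightarrow> h \<in> carrier G \<Longrightarrow> l \<in> carrier G \<Longrightarrow>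
    (g \<otimes> inv h) \<otimes> (h \<otimes> inv l) = g \<otimes> inv l"
  by (metis inv_closed inv_solve_right m_assoc m_closed)

lemma (in group) mult_cancel_inv:
  "g \<in> carrier G \<Longrightarrow> h \<in> carrier G \<Longrightarrow> g \<otimes> (inv g \<otimes> h) = h"
  by (simp add: m_assoc[symmetric])

lemma (in group) mult_inv_cancel:
  "g \<in> carrier G \<Longrightarrow> h \<in> carrier G \<Longrightarrow> (g \<otimes> inv h) \<otimes> h = g"
  by (simp add: m_assoc)

lemma (in group) mult_inv_eq_one_iff:
  "g \<in> carrier G \<Longrightarrow> h \<in> carrier G \<Longrightarrow> g \<otimes> inv h = \<one> \<longleftrightarrow> g = h"
  by (metis inv_closed inv_equality inv_inv r_inv)

definition matrices :: "('g, 'p) monoid_scheme \<Rightarrow> ('g \<Rightarrow> 'm set) \<Rightarrow> ('g \<times> 'g \<Rightarrow> 'm) set"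
  where "matrices G \<U> = PiE (carrier G \<times> carrier G) (\<lambda>(g, h). \<U> (g \<otimes>\<^bsub>G\<^esub> inv\<^bsub>G\<^esub> h))"

text \<open>The entrywise product is an arbitrary pairing, so that one operation covers
  multiplication in the Beilinson--Green algebra, its two actions on \<open>bar U\<close>, and the
  matrix product formed with a pairing of M and N.\<close>

definition mmul :: "('g, 'p) monoid_scheme \<Rightarrow> ('s, 'r) ring_scheme \<Rightarrow> ('u \<Rightarrow> 'v \<Rightarrow> 's) \<Rightarrow>
    ('g \<times> 'g \<Rightarrow> 'u) \<Rightarrow> ('g \<times> 'g \<Rightarrow> 'v) \<Rightarrow> 'g \<times> 'g \<Rightarrow> 's"
  where "mmul G S \<mu> a b =
    (\<lambda>(g, l)\<in>carrier G \<times> carrier G. \<Oplus>\<^bsub>S\<^esub>h\<in>carrier G. \<mu> (a (g, h)) (b (h, l)))"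

text \<open>For \<open>U = A\<close> this embeds \<open>A\<close> into its Beilinson--Green algebra, and for bimodules it is
  semilinear with respect to that embedding.\<close>

definition spread :: "('g, 'p) monoid_scheme \<Rightarrow> ('m, 'r) ring_scheme \<Rightarrow> ('g \<Rightarrow> 'm set) \<Rightarrow>
    'm \<Rightarrow> 'g \<times> 'g \<Rightarrow> 'm"
  where "spread G U \<U> u =
    (\<lambda>(g, h)\<in>carrier G \<times> carrier G. hcomp G U \<U> (g \<otimes>\<^bsub>G\<^esub> inv\<^bsub>G\<^esub> h) u)"

lemma mmul_entry [simp]:
  "g \<in> carrier G \<Longrightarrow> l \<in> carrier G \<Longrightarrow>
    mmul G S \<mu> a b (g, l) = (\<Oplus>\<^bsub>S\<^esub>h\<in>carrier G. \<mu> (a (g, h)) (b (h, l)))"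
  by (simp add: mmul_def)

lemma spread_entry [simp]:
  "g \<in> carrier G \<Longrightarrow> h \<in> carrier G \<Longrightarrow>
    spread G U \<U> u (g, h) = hcomp G U \<U> (g \<otimes>\<^bsub>G\<^esub> inv\<^bsub>G\<^esub> h) u"
  by (simp add: spread_def)

lemma mmul_extensional: "mmul G S \<mu> a b \<in> extensional (carrier G \<times> carrier G)"
  by (simp add: mmul_def)

lemma spread_extensional: "spread G U \<U> u \<in> extensional (carrier G \<times> carrier G)"
  by (simp add: spread_def)

lemma matrices_extensional: "a \<in> matrices G \<U> \<Longrightarrow> a \<in> extensional (carrier G \<times> carrier G)"
  by (simp add: matrices_def PiE_def)

lemma matrix_ext:
  assumes "a \<in> extensional (carrier G \<times> carrier G)" "b \<in> extensional (carrier G \<times> carrier G)"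
    and "\<And>g h. g \<in> carrier G \<Longrightarrow> h \<in> carrier G \<Longrightarrow> a (g, h) = b (g, h)"
  shows "a = b"
  using assms(1,2)
  by (rule extensionalityI) (use assms(3) in auto)

lemma matricesI:
  assumes "a \<in> extensional (carrier G \<times> carrier G)"
    and "\<And>g h. g \<in> carrier G \<Longrightarrow> h \<in> carrier G \<Longrightarrow> a (g, h) \<in> \<U> (g \<otimes>\<^bsub>G\<^esub> inv\<^bsub>G\<^esub> h)"
  shows "a \<in> matrices G \<U>"
  using assms by (auto simp: matrices_def PiE_def)

lemma matrices_entry:
  "a \<in> matrices G \<U> \<Longrightarrow> g \<in> carrier G \<Longrightarrow> h \<in> carrier G \<Longrightarrow>
    a (g, h) \<in> \<U> (g \<otimes>\<^bsub>G\<^esub> inv\<^bsub>G\<^esub> h)"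
  by (auto simp: matrices_def)

context graded_space
begin

lemma matrices_carrier:
  "a \<in> matrices G \<G> \<Longrightarrow> g \<in> carrier G \<Longrightarrow> h \<in> carrier G \<Longrightarrow> a (g, h) \<in> carrier M"
  by (rule homog_carrier[OF _ matrices_entry]) auto

lemma hcomp_entry:
  "a \<in> matrices G \<G> \<Longrightarrow> g \<in> carrier G \<Longrightarrow> h \<in> carrier G \<Longrightarrow>
    hcomp G M \<G> (g \<otimes>\<^bsub>G\<^esub> inv\<^bsub>G\<^esub> h) (a (g, h)) = a (g, h)"
  using hcomp_homog[where y = "g \<otimes>\<^bsub>G\<^esub> inv\<^bsub>G\<^esub> h"] matrices_entry by fastforce

lemma spread_matrices: "m \<in> carrier M \<Longrightarrow> spread G M \<G> m \<in> matrices G \<G>"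
  by (intro matricesI spread_extensional) (simp add: hcomp_in)

text \<open>The record is left open because the Beilinson--Green algebra and \<open>bar U\<close>
  carry the same kind of space with different further fields.\<close>

lemma matrix_vectorspace:
  fixes N :: "('k, 'g \<times> 'g \<Rightarrow> 'm, 's) module_scheme"
  assumes "carrier N = matrices G \<G>"
    and "zero N = (\<lambda>p\<in>carrier G \<times> carrier G. \<zero>\<^bsub>M\<^esub>)"
    and "add N = (\<lambda>a b. \<lambda>p\<in>carrier G \<times> carrier G. a p \<oplus>\<^bsub>M\<^esub> b p)"
    and "smult N = (\<lambda>k a. \<lambda>p\<in>carrier G \<times> carrier G. k \<odot>\<^bsub>M\<^esub> a p)"
  shows "vectorspace K N"
proof -
  interpret F: field K by (rule vectorspace_field[OF vs])
  note sub = homog_subspace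
  have cl: "a (g, h) \<in> \<G> (g \<otimes>\<^bsub>G\<^esub> inv\<^bsub>G\<^esub> h)" "a (g, h) \<in> carrier M"
    if "a \<in> matrices G \<G>" "g \<in> carrier G" "h \<in> carrier G" for a g h
    using that matrices_entry matrices_carrier by auto
  have add: "(\<lambda>p\<in>carrier G \<times> carrier G. a p \<oplus>\<^bsub>M\<^esub> b p) \<in> matrices G \<G>"
    if "a \<in> matrices G \<G>" "b \<in> matrices G \<G>" for a b
    using that by (intro matricesI) (auto simp: subspace_add[OF sub] cl)
  have smult: "(\<lambda>p\<in>carrier G \<times> carrier G. k \<odot>\<^bsub>M\<^esub> a p) \<in> matrices G \<G>"
    if "k \<in> carrier K" "a \<in> matrices G \<G>" for k a
    using that by (intro matricesI) (auto simp: subspace_smult[OF sub] cl)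
  have zero: "(\<lambda>p\<in>carrier G \<times> carrier G. \<zero>\<^bsub>M\<^esub>) \<in> matrices G \<G>"
    by (intro matricesI) (auto intro!: subspace_zero[OF sub])
  have "abelian_group N"
  proof (rule abelian_groupI)
    fix a assume a: "a \<in> carrier N"
    \<comment> \<open>Negatives are taken as multiples by -1, since the components are known to be
      closed under scalars.\<close>
    have "(\<lambda>p\<in>carrier G \<times> carrier G. \<ominus>\<^bsub>K\<^esub> \<one>\<^bsub>K\<^esub> \<odot>\<^bsub>M\<^esub> a p) \<in> carrier N"
      using a assms smult by simp
    moreover have "(\<lambda>p\<in>carrier G \<times> carrier G. \<ominus>\<^bsub>K\<^esub> \<one>\<^bsub>K\<^esub> \<odot>\<^bsub>M\<^esub> a p) \<oplus>\<^bsub>N\<^esub> a = \<zero>\<^bsub>N\<^esub>"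
      using a unfolding assms
      by (intro matrix_ext) (auto simp: md.smult_l_minus ab.l_neg cl)
    ultimately show "\<exists>b\<in>carrier N. b \<oplus>\<^bsub>N\<^esub> a = \<zero>\<^bsub>N\<^esub>" by blast
  qed (unfold assms, auto intro!: add zero matrix_ext intro: matrices_extensional simp: ab.a_ac cl)
  moreover from this have "module K N"
  proof (intro moduleI md.R.cring_axioms)
  qed (unfold assms, auto intro!: add smult matrix_ext intro: matrices_extensional
      simp: cl md.smult_l_distr md.smult_r_distr md.smult_assoc1)
  ultimately show ?thesis
    by (simp add: vectorspace_def F.field_axioms)
qed

end

text \<open>Instances are the multiplication of a graded algebra, the two actions on a graded
  bimodule, and the pairing of M with N induced by a graded map out of their tensor product.
  Biadditivity is what they share; compatibility with scalars enters as a separate hypothesis where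
  matrices are scaled.\<close>

locale graded_pairing =
  U: graded_space G K U \<U> + V: graded_space G K V \<V> + S: graded_space G K S \<S>
  for G :: "('g, 'p) monoid_scheme" and K :: "('k, 'q) ring_scheme"
    and U :: "('k, 'u, 'ru) module_scheme" and \<U>
    and V :: "('k, 'v, 'rv) module_scheme" and \<V>
    and S :: "('k, 's, 'rs) module_scheme" and \<S> +
  fixes \<mu> :: "'u \<Rightarrow> 'v \<Rightarrow> 's"
  assumes closed: "u \<in> carrier U \<Longrightarrow> v \<in> carrier V \<Longrightarrow> \<mu> u v \<in> carrier S"
    and add_left: "u \<in> carrier U \<Longrightarrow> u' \<in> carrier U \<Longrightarrow> v \<in> carrier V \<Longrightarrow>
      \<mu> (u \<oplus>\<^bsub>U\<^esub> u') v = \<mu> u v \<oplus>\<^bsub>S\<^esub> \<mu> u' v"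
    and add_right: "u \<in> carrier U \<Longrightarrow> v \<in> carrier V \<Longrightarrow> v' \<in> carrier V \<Longrightarrow>
      \<mu> u (v \<oplus>\<^bsub>V\<^esub> v') = \<mu> u v \<oplus>\<^bsub>S\<^esub> \<mu> u v'"
    and homog: "x \<in> carrier G \<Longrightarrow> y \<in> carrier G \<Longrightarrow> u \<in> \<U> x \<Longrightarrow> v \<in> \<V> y \<Longrightarrow>
      \<mu> u v \<in> \<S> (x \<otimes>\<^bsub>G\<^esub> y)"
begin

lemma additive_left: "v \<in> carrier V \<Longrightarrow> additive_map U S (\<lambda>u. \<mu> u v)"
  by (intro additive_mapI) (auto simp: closed add_left)

lemma additive_right: "u \<in> carrier U \<Longrightarrow> additive_map V S (\<mu> u)"
  by (intro additive_mapI) (auto simp: closed add_right)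

lemma zero_left: "v \<in> carrier V \<Longrightarrow> \<mu> \<zero>\<^bsub>U\<^esub> v = \<zero>\<^bsub>S\<^esub>"
  by (rule additive_map_zero[OF U.ab.abelian_group_axioms S.ab.abelian_group_axioms additive_left])

lemma zero_right: "u \<in> carrier U \<Longrightarrow> \<mu> u \<zero>\<^bsub>V\<^esub> = \<zero>\<^bsub>S\<^esub>"
  by (rule additive_map_zero[OF V.ab.abelian_group_axioms S.ab.abelian_group_axioms additive_right])

lemma finsum_left: "v \<in> carrier V \<Longrightarrow> (\<And>i. i \<in> I \<Longrightarrow> u i \<in> carrier U) \<Longrightarrow>
    \<mu> (finsum U u I) v = finsum S (\<lambda>i. \<mu> (u i) v) I"
  by (rule additive_map_finsum[OF U.ab.abelian_group_axioms S.ab.abelian_group_axioms additive_left])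

lemma finsum_right: "u \<in> carrier U \<Longrightarrow> (\<And>i. i \<in> I \<Longrightarrow> v i \<in> carrier V) \<Longrightarrow>
    \<mu> u (finsum V v I) = finsum S (\<lambda>i. \<mu> u (v i)) I"
  by (rule additive_map_finsum[OF V.ab.abelian_group_axioms S.ab.abelian_group_axioms additive_right])

lemma mmul_matrices:
  assumes "a \<in> matrices G \<U>" "b \<in> matrices G \<V>"
  shows "mmul G S \<mu> a b \<in> matrices G \<S>"
proof (intro matricesI mmul_extensional)
  fix g l assume gl: "g \<in> carrier G" "l \<in> carrier G"
  have "\<mu> (a (g, h)) (b (h, l)) \<in> \<S> (g \<otimes>\<^bsub>G\<^esub> inv\<^bsub>G\<^esub> l)" if "h \<in> carrier G" for h
    using homog[OF _ _ matrices_entry[OF assms(1)] matrices_entry[OF assms(2)], of g h h l] gl that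
    by (simp add: U.grp.mult_inv_middle)
  with gl show "mmul G S \<mu> a b (g, l) \<in> \<S> (g \<otimes>\<^bsub>G\<^esub> inv\<^bsub>G\<^esub> l)"
    by (auto intro!: subspace_finsum S.homog_subspace)
qed

lemma mmul_add_left:
  assumes "a \<in> matrices G \<U>" "a' \<in> matrices G \<U>" "b \<in> matrices G \<V>"
  shows "mmul G S \<mu> (\<lambda>p\<in>carrier G \<times> carrier G. a p \<oplus>\<^bsub>U\<^esub> a' p) b =
    (\<lambda>p\<in>carrier G \<times> carrier G. mmul G S \<mu> a b p \<oplus>\<^bsub>S\<^esub> mmul G S \<mu> a' b p)"
proof (rule matrix_ext[OF mmul_extensional])
  fix g l assume gl: "g \<in> carrier G" "l \<in> carrier G"
  then have "mmul G S \<mu> (\<lambda>p\<in>carrier G \<times> carrier G. a p \<oplus>\<^bsub>U\<^esub> a' p) b (g, l) =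
     (\<Oplus>\<^bsub>S\<^esub>h\<in>carrier G. \<mu> (a (g, h)) (b (h, l)) \<oplus>\<^bsub>S\<^esub> \<mu> (a' (g, h)) (b (h, l)))"
    using assms by (auto intro!: S.ab.finsum_eqI add_left closed intro: U.matrices_carrier V.matrices_carrier)
  also have "\<dots> = mmul G S \<mu> a b (g, l) \<oplus>\<^bsub>S\<^esub> mmul G S \<mu> a' b (g, l)"
    using gl assms by (subst S.ab.finsum_addf) (auto intro!: closed U.matrices_carrier V.matrices_carrier)
  finally show "mmul G S \<mu> (\<lambda>p\<in>carrier G \<times> carrier G. a p \<oplus>\<^bsub>U\<^esub> a' p) b (g, l) =
    (\<lambda>p\<in>carrier G \<times> carrier G. mmul G S \<mu> a b p \<oplus>\<^bsub>S\<^esub> mmul G S \<mu> a' b p) (g, l)"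
    using gl by simp
qed simp

lemma mmul_add_right:
  assumes "a \<in> matrices G \<U>" "b \<in> matrices G \<V>" "b' \<in> matrices G \<V>"
  shows "mmul G S \<mu> a (\<lambda>p\<in>carrier G \<times> carrier G. b p \<oplus>\<^bsub>V\<^esub> b' p) =
    (\<lambda>p\<in>carrier G \<times> carrier G. mmul G S \<mu> a b p \<oplus>\<^bsub>S\<^esub> mmul G S \<mu> a b' p)"
proof (rule matrix_ext[OF mmul_extensional])
  fix g l assume gl: "g \<in> carrier G" "l \<in> carrier G"
  then have "mmul G S \<mu> a (\<lambda>p\<in>carrier G \<times> carrier G. b p \<oplus>\<^bsub>V\<^esub> b' p) (g, l) =
     (\<Oplus>\<^bsub>S\<^esub>h\<in>carrier G. \<mu> (a (g, h)) (b (h, l)) \<oplus>\<^bsub>S\<^esub> \<mu> (a (g, h)) (b' (h, l)))"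
    using assms by (auto intro!: S.ab.finsum_eqI add_right closed intro: U.matrices_carrier V.matrices_carrier)
  also have "\<dots> = mmul G S \<mu> a b (g, l) \<oplus>\<^bsub>S\<^esub> mmul G S \<mu> a b' (g, l)"
    using gl assms by (subst S.ab.finsum_addf) (auto intro!: closed U.matrices_carrier V.matrices_carrier)
  finally show "mmul G S \<mu> a (\<lambda>p\<in>carrier G \<times> carrier G. b p \<oplus>\<^bsub>V\<^esub> b' p) (g, l) =
    (\<lambda>p\<in>carrier G \<times> carrier G. mmul G S \<mu> a b p \<oplus>\<^bsub>S\<^esub> mmul G S \<mu> a b' p) (g, l)"
    using gl by simp
qed simp

lemma smult_finsum:
  assumes "k \<in> carrier K" "\<And>i. i \<in> I \<Longrightarrow> f i \<in> carrier S"
  shows "k \<odot>\<^bsub>S\<^esub> finsum S f I = finsum S (\<lambda>i. k \<odot>\<^bsub>S\<^esub> f i) I"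
proof -
  have "additive_map S S (\<lambda>m. k \<odot>\<^bsub>S\<^esub> m)"
    using assms by (intro additive_mapI) (auto simp: S.md.smult_r_distr)
  from additive_map_finsum[OF S.ab.abelian_group_axioms S.ab.abelian_group_axioms this assms(2)]
  show ?thesis .
qed

lemma mmul_smult_left:
  assumes "k \<in> carrier K" "a \<in> matrices G \<U>" "b \<in> matrices G \<V>"
    and "\<And>u v. u \<in> carrier U \<Longrightarrow> v \<in> carrier V \<Longrightarrow> \<mu> (k \<odot>\<^bsub>U\<^esub> u) v = k \<odot>\<^bsub>S\<^esub> \<mu> u v"
  shows "mmul G S \<mu> (\<lambda>p\<in>carrier G \<times> carrier G. k \<odot>\<^bsub>U\<^esub> a p) b =
    (\<lambda>p\<in>carrier G \<times> carrier G. k \<odot>\<^bsub>S\<^esub> mmul G S \<mu> a b p)"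
proof (rule matrix_ext[OF mmul_extensional])
  fix g l assume gl: "g \<in> carrier G" "l \<in> carrier G"
  have ab: "a (g, h) \<in> carrier U" "b (h, l) \<in> carrier V" if "h \<in> carrier G" for h
    using gl that assms U.matrices_carrier V.matrices_carrier by auto
  then show "mmul G S \<mu> (\<lambda>p\<in>carrier G \<times> carrier G. k \<odot>\<^bsub>U\<^esub> a p) b (g, l) =
    (\<lambda>p\<in>carrier G \<times> carrier G. k \<odot>\<^bsub>S\<^esub> mmul G S \<mu> a b p) (g, l)"
    using gl assms by (auto simp: smult_finsum closed assms(4) intro!: S.ab.finsum_eqI)
qed simp

lemma mmul_smult_right:
  assumes "k \<in> carrier K" "a \<in> matrices G \<U>" "b \<in> matrices G \<V>"
    and "\<And>u v. u \<in> carrier U \<Longrightarrow> v \<in> carrier V \<Longrightarrow> \<mu> u (k \<odot>\<^bsub>V\<^esub> v) = k \<odot>\<^bsub>S\<^esub> \<mu> u v"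
  shows "mmul G S \<mu> a (\<lambda>p\<in>carrier G \<times> carrier G. k \<odot>\<^bsub>V\<^esub> b p) =
    (\<lambda>p\<in>carrier G \<times> carrier G. k \<odot>\<^bsub>S\<^esub> mmul G S \<mu> a b p)"
proof (rule matrix_ext[OF mmul_extensional])
  fix g l assume gl: "g \<in> carrier G" "l \<in> carrier G"
  have ab: "a (g, h) \<in> carrier U" "b (h, l) \<in> carrier V" if "h \<in> carrier G" for h
    using gl that assms U.matrices_carrier V.matrices_carrier by auto
  then show "mmul G S \<mu> a (\<lambda>p\<in>carrier G \<times> carrier G. k \<odot>\<^bsub>V\<^esub> b p) (g, l) =
    (\<lambda>p\<in>carrier G \<times> carrier G. k \<odot>\<^bsub>S\<^esub> mmul G S \<mu> a b p) (g, l)"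
    using gl assms by (auto simp: smult_finsum closed assms(4) intro!: S.ab.finsum_eqI)
qed simp

text \<open>Decompose u into degrees g h\<inverse> and v into degrees k l\<inverse>. The product of
  two such components has degree g l\<inverse> exactly when k = h, so only the diagonal of the
  double sum contributes. Labelling degrees by matrix positions turns the result into a
  row-by-column product.\<close>

lemma hcomp_pairing:
  assumes u: "u \<in> carrier U" and v: "v \<in> carrier V" and gl: "g \<in> carrier G" "l \<in> carrier G"
  shows "hcomp G S \<S> (g \<otimes>\<^bsub>G\<^esub> inv\<^bsub>G\<^esub> l) (\<mu> u v) =
    (\<Oplus>\<^bsub>S\<^esub>h\<in>carrier G. \<mu> (hcomp G U \<U> (g \<otimes>\<^bsub>G\<^esub> inv\<^bsub>G\<^esub> h) u) (hcomp G V \<V> (h \<otimes>\<^bsub>G\<^esub> inv\<^bsub>G\<^esub> l) v))"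
proof -
  note G = U.fin gl and cl = U.hcomp_carrier[OF u] V.hcomp_carrier[OF v]
  let ?u = "\<lambda>h. hcomp G U \<U> (g \<otimes>\<^bsub>G\<^esub> inv\<^bsub>G\<^esub> h) u" and ?v = "\<lambda>h. hcomp G V \<V> (h \<otimes>\<^bsub>G\<^esub> inv\<^bsub>G\<^esub> l) v"
  \<comment> \<open>As h runs through the group, so does g h\<inverse>; this reindexes the
    decomposition of u by the positions in row g.\<close>
  have bij1: "bij_betw (\<lambda>h. g \<otimes>\<^bsub>G\<^esub> inv\<^bsub>G\<^esub> h) (carrier G) (carrier G)"
    using gl by (intro bij_betw_byWitness[where f' = "\<lambda>x. inv\<^bsub>G\<^esub> x \<otimes>\<^bsub>G\<^esub> g"])
      (auto simp: U.grp.inv_mult_group U.grp.m_assoc U.grp.mult_cancel_inv)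
  have bij2: "bij_betw (\<lambda>h. h \<otimes>\<^bsub>G\<^esub> inv\<^bsub>G\<^esub> l) (carrier G) (carrier G)"
    using gl by (intro bij_betw_byWitness[where f' = "\<lambda>x. x \<otimes>\<^bsub>G\<^esub> l"]) (auto simp: U.grp.m_assoc)
  have su: "u = finsum U ?u (carrier G)"
    using U.ab.finsum_reindex[of "\<lambda>x. hcomp G U \<U> x u" "\<lambda>h. g \<otimes>\<^bsub>G\<^esub> inv\<^bsub>G\<^esub> h" "carrier G"] bij1 cl U.sum_hcomp[OF u]
    by (auto simp: bij_betw_def)
  have sv: "v = finsum V ?v (carrier G)"
    using V.ab.finsum_reindex[of "\<lambda>x. hcomp G V \<V> x v" "\<lambda>h. h \<otimes>\<^bsub>G\<^esub> inv\<^bsub>G\<^esub> l" "carrier G"] bij2 cl V.sum_hcomp[OF v]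
    by (auto simp: bij_betw_def)
  have "\<mu> u v = (\<Oplus>\<^bsub>S\<^esub>h\<in>carrier G. \<Oplus>\<^bsub>S\<^esub>k\<in>carrier G. \<mu> (?u h) (?v k))"
    using gl v cl
    apply (subst su, subst finsum_left)
      apply simp_all
    apply (rule S.ab.finsum_eqI)
    subgoal for h by (subst sv, subst finsum_right) simp_all
    subgoal by (intro S.ab.finsum_closed) (auto intro!: closed)
    done
  then have "hcomp G S \<S> (g \<otimes>\<^bsub>G\<^esub> inv\<^bsub>G\<^esub> l) (\<mu> u v) =
    (\<Oplus>\<^bsub>S\<^esub>h\<in>carrier G. \<Oplus>\<^bsub>S\<^esub>k\<in>carrier G. hcomp G S \<S> (g \<otimes>\<^bsub>G\<^esub> inv\<^bsub>G\<^esub> l) (\<mu> (?u h) (?v k)))"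
    using gl cl
    apply (simp only:)
    apply (subst S.hcomp_finsum)
      apply (auto intro!: S.ab.finsum_closed closed)[2]
    apply (rule S.ab.finsum_eqI)
     apply (subst S.hcomp_finsum)
       apply (auto intro!: S.ab.finsum_closed closed S.hcomp_carrier)
    done
  also have "\<dots> = (\<Oplus>\<^bsub>S\<^esub>h\<in>carrier G. \<mu> (?u h) (?v h))"
  proof (rule S.ab.finsum_eqI)
    fix h assume h: "h \<in> carrier G"
    have *: "hcomp G S \<S> (g \<otimes>\<^bsub>G\<^esub> inv\<^bsub>G\<^esub> l) (\<mu> (?u h) (?v k)) = (if k = h then \<mu> (?u h) (?v h) else \<zero>\<^bsub>S\<^esub>)"
      if k: "k \<in> carrier G" for k
    proof -
      have "\<mu> (?u h) (?v k) \<in> \<S> ((g \<otimes>\<^bsub>G\<^esub> inv\<^bsub>G\<^esub> h) \<otimes>\<^bsub>G\<^esub> (k \<otimes>\<^bsub>G\<^esub> inv\<^bsub>G\<^esub> l))"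
        using u v gl h k by (intro homog U.hcomp_in V.hcomp_in) auto
      \<comment> \<open>Writing g l\<inverse> as the product of g h\<inverse> and h l\<inverse> and
        cancelling on both sides leaves k = h.\<close>
      moreover have "g \<otimes>\<^bsub>G\<^esub> inv\<^bsub>G\<^esub> l = (g \<otimes>\<^bsub>G\<^esub> inv\<^bsub>G\<^esub> h) \<otimes>\<^bsub>G\<^esub> (k \<otimes>\<^bsub>G\<^esub> inv\<^bsub>G\<^esub> l) \<longleftrightarrow> k = h"
        using gl h k
        by (metis U.grp.inv_closed U.grp.Units_eq U.grp.Units_l_cancel U.grp.right_cancel U.grp.m_closed U.grp.mult_inv_middle)
      ultimately show ?thesis
        using gl h k S.hcomp_homog[of "\<mu> (?u h) (?v k)" "(g \<otimes>\<^bsub>G\<^esub> inv\<^bsub>G\<^esub> h) \<otimes>\<^bsub>G\<^esub> (k \<otimes>\<^bsub>G\<^esub> inv\<^bsub>G\<^esub> l)"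
            "g \<otimes>\<^bsub>G\<^esub> inv\<^bsub>G\<^esub> l"] by auto
    qed
    show "(\<Oplus>\<^bsub>S\<^esub>k\<in>carrier G. hcomp G S \<S> (g \<otimes>\<^bsub>G\<^esub> inv\<^bsub>G\<^esub> l) (\<mu> (?u h) (?v k))) = \<mu> (?u h) (?v h)"
      using h gl cl U.fin * by (subst S.ab.finsum_only[of _ h]) (auto intro!: closed)
    show "\<mu> (?u h) (?v h) \<in> carrier S"
      using h gl cl by (auto intro!: closed)
  qed
  finally show ?thesis .
qed

text \<open>For the multiplication of A this says that \<open>spread\<close> is multiplicative, for
  an action that it is semilinear. For a pairing of M and N it will identify the matrix product of
  two spread elements.\<close>

lemma spread_pairing:
  assumes "u \<in> carrier U" "v \<in> carrier V"
  shows "spread G S \<S> (\<mu> u v) = mmul G S \<mu> (spread G U \<U> u) (spread G V \<V> v)"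
  by (rule matrix_ext[OF spread_extensional mmul_extensional])
    (use assms in \<open>auto simp: hcomp_pairing intro!: S.ab.finsum_eqI closed U.hcomp_carrier V.hcomp_carrier\<close>)

end

text \<open>The four pairings may differ, so that associativity of the algebra, the module axioms,
  commutation of the two actions and balancedness of the tensor pairing are all instances. Each
  comes down to the interchange of two finite sums.\<close>

lemma mmul_assoc:
  assumes 1: "graded_pairing G K U \<U> V \<V> R \<R> \<mu>1" and 2: "graded_pairing G K R \<R> W \<W> S \<S> \<mu>2"
    and 3: "graded_pairing G K V \<V> W \<W> Q \<Q> \<mu>3" and 4: "graded_pairing G K U \<U> Q \<Q> S \<S> \<mu>4"
    and assoc: "\<And>u v w. u \<in> carrier U \<Longrightarrow> v \<in> carrier V \<Longrightarrow> w \<in> carrier W \<Longrightarrow>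
      \<mu>2 (\<mu>1 u v) w = \<mu>4 u (\<mu>3 v w)"
    and a: "a \<in> matrices G \<U>" and b: "b \<in> matrices G \<V>" and c: "c \<in> matrices G \<W>"
  shows "mmul G S \<mu>2 (mmul G R \<mu>1 a b) c = mmul G S \<mu>4 a (mmul G Q \<mu>3 b c)"
proof (rule matrix_ext[OF mmul_extensional mmul_extensional])
  interpret p1: graded_pairing G K U \<U> V \<V> R \<R> \<mu>1 by fact
  interpret p2: graded_pairing G K R \<R> W \<W> S \<S> \<mu>2 by fact
  interpret p3: graded_pairing G K V \<V> W \<W> Q \<Q> \<mu>3 by fact
  interpret p4: graded_pairing G K U \<U> Q \<Q> S \<S> \<mu>4 by fact
  note cl = p1.closed p2.closed p3.closed p4.closed
    p1.U.matrices_carrier[OF a] p1.V.matrices_carrier[OF b] p2.V.matrices_carrier[OF c]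
  fix g l assume gl: "g \<in> carrier G" "l \<in> carrier G"
  have "mmul G S \<mu>2 (mmul G R \<mu>1 a b) c (g, l) =
      (\<Oplus>\<^bsub>S\<^esub>h\<in>carrier G. \<Oplus>\<^bsub>S\<^esub>s\<in>carrier G. \<mu>2 (\<mu>1 (a (g, s)) (b (s, h))) (c (h, l)))"
    using gl cl p1.U.fin
    by (auto simp: p2.finsum_left intro!: p2.S.ab.finsum_eqI p2.S.ab.finsum_closed)
  also have "\<dots> = (\<Oplus>\<^bsub>S\<^esub>h\<in>carrier G. \<Oplus>\<^bsub>S\<^esub>s\<in>carrier G. \<mu>4 (a (g, s)) (\<mu>3 (b (s, h)) (c (h, l))))"
    using gl cl by (auto simp: assoc intro!: p2.S.ab.finsum_eqI p2.S.ab.finsum_closed)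
  also have "\<dots> = (\<Oplus>\<^bsub>S\<^esub>s\<in>carrier G. \<Oplus>\<^bsub>S\<^esub>h\<in>carrier G. \<mu>4 (a (g, s)) (\<mu>3 (b (s, h)) (c (h, l))))"
    using gl cl p1.U.fin by (intro p2.S.ab.finsum_swap) auto
  also have "\<dots> = mmul G S \<mu>4 a (mmul G Q \<mu>3 b c) (g, l)"
    using gl cl p1.U.fin
    by (auto simp: p4.finsum_right intro!: p2.S.ab.finsum_eqI p3.S.ab.finsum_closed)
  finally show "mmul G S \<mu>2 (mmul G R \<mu>1 a b) c (g, l) = mmul G S \<mu>4 a (mmul G Q \<mu>3 b c) (g, l)" .
qed

section \<open>Beilinson--Green algebras and bimodules\<close>

lemma (in graded_pairing) mmul_unit_left:
  assumes "e \<in> carrier U" "b \<in> matrices G \<V>" "g \<in> carrier G" "l \<in> carrier G"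
  shows "mmul G S \<mu> (\<lambda>(g, h)\<in>carrier G \<times> carrier G. if g = h then e else \<zero>\<^bsub>U\<^esub>) b (g, l) = \<mu> e (b (g, l))"
  using assms U.fin V.matrices_carrier[OF assms(2)]
  by simp (subst S.ab.finsum_only[of _ g], auto simp: zero_left intro!: closed)

lemma (in graded_pairing) mmul_unit_right:
  assumes "e \<in> carrier V" "a \<in> matrices G \<U>" "g \<in> carrier G" "l \<in> carrier G"
  shows "mmul G S \<mu> a (\<lambda>(g, h)\<in>carrier G \<times> carrier G. if g = h then e else \<zero>\<^bsub>V\<^esub>) (g, l) = \<mu> (a (g, l)) e"
  using assms U.fin U.matrices_carrier[OF assms(2)]
  by simp (subst S.ab.finsum_only[of _ l], auto simp: zero_right intro!: closed)

locale graded_alg =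
  fixes G :: "('g, 'p) monoid_scheme" and K :: "('k, 'q) ring_scheme"
    and A :: "('k, 'a) module" and \<A> :: "'g \<Rightarrow> 'a set"
  assumes G: "group G" and fin: "finite (carrier G)" and alg: "graded_algebra G K A \<A>"
begin

sublocale al: k_algebra K A
  using alg by (simp add: graded_algebra_def)

sublocale rg: ring A by (rule al.ring)

sublocale sp: graded_space G K A \<A>
  using alg by (intro graded_space.intro) (simp_all add: G fin al.vs graded_algebra_def)

sublocale pr: graded_pairing G K A \<A> A \<A> A \<A> "monoid.mult A"
  using alg by (intro graded_pairing.intro graded_pairing_axioms.intro sp.graded_space_axioms)
    (auto simp: graded_algebra_def rg.l_distr rg.r_distr)

text \<open>Homogeneity of the unit is derived rather than postulated. Let e be the component of 1
  in degree 1. Comparing parts of degree g in a = a 1 shows a = a e for a of degree g; summing over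
  the components of 1 gives 1 = 1 e = e. This is why the identity matrix has its entries in the
  prescribed degrees.\<close>

lemma one_homog: "\<one>\<^bsub>A\<^esub> \<in> \<A> \<one>\<^bsub>G\<^esub>"
proof -
  let ?e = "hcomp G A \<A> \<one>\<^bsub>G\<^esub> \<one>\<^bsub>A\<^esub>"
  have e: "?e \<in> carrier A" by (simp add: sp.hcomp_carrier)
  have *: "a \<otimes>\<^bsub>A\<^esub> ?e = a" if g: "g \<in> carrier G" and a: "a \<in> \<A> g" for g a
  proof -
    have ac: "a \<in> carrier A" using sp.homog_carrier g a .
    \<comment> \<open>The degree g is written as g 1\<inverse> to match the row-by-column formula
      for components of a product.\<close>
    have "a = hcomp G A \<A> (g \<otimes>\<^bsub>G\<^esub> inv\<^bsub>G\<^esub> \<one>\<^bsub>G\<^esub>) (a \<otimes>\<^bsub>A\<^esub> \<one>\<^bsub>A\<^esub>)"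
      using g a ac sp.hcomp_homog[OF a g g] by simp
    also have "\<dots> = (\<Oplus>\<^bsub>A\<^esub>h\<in>carrier G. hcomp G A \<A> (g \<otimes>\<^bsub>G\<^esub> inv\<^bsub>G\<^esub> h) a \<otimes>\<^bsub>A\<^esub>
        hcomp G A \<A> (h \<otimes>\<^bsub>G\<^esub> inv\<^bsub>G\<^esub> \<one>\<^bsub>G\<^esub>) \<one>\<^bsub>A\<^esub>)"
      using g ac by (intro pr.hcomp_pairing) auto
    also have "\<dots> = a \<otimes>\<^bsub>A\<^esub> ?e"
    \<comment> \<open>Homogeneity of a leaves only the index h with g h\<inverse> = g, that is h =
      1.\<close>
    proof (subst rg.finsum_only[of _ "\<one>\<^bsub>G\<^esub>"])
      fix h assume h: "h \<in> carrier G" "h \<noteq> \<one>\<^bsub>G\<^esub>"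
      then have "g \<otimes>\<^bsub>G\<^esub> inv\<^bsub>G\<^esub> h \<noteq> g"
        using g sp.grp.inv_eq_1_iff by auto
      with g a h have "hcomp G A \<A> (g \<otimes>\<^bsub>G\<^esub> inv\<^bsub>G\<^esub> h) a = \<zero>\<^bsub>A\<^esub>"
        by (subst sp.hcomp_homog[OF a _ g]) auto
      with h show "hcomp G A \<A> (g \<otimes>\<^bsub>G\<^esub> inv\<^bsub>G\<^esub> h) a \<otimes>\<^bsub>A\<^esub> hcomp G A \<A> (h \<otimes>\<^bsub>G\<^esub> inv\<^bsub>G\<^esub> \<one>\<^bsub>G\<^esub>) \<one>\<^bsub>A\<^esub> = \<zero>\<^bsub>A\<^esub>"
        by (simp add: sp.hcomp_carrier)
    qed (use g ac a e in \<open>auto simp: sp.hcomp_homog[OF a g g] fin sp.hcomp_carrier\<close>)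
    finally show ?thesis by simp
  qed
  have "\<one>\<^bsub>A\<^esub> = \<one>\<^bsub>A\<^esub> \<otimes>\<^bsub>A\<^esub> ?e"
  proof -
    have "\<one>\<^bsub>A\<^esub> \<otimes>\<^bsub>A\<^esub> ?e = (\<Oplus>\<^bsub>A\<^esub>x\<in>carrier G. hcomp G A \<A> x \<one>\<^bsub>A\<^esub>) \<otimes>\<^bsub>A\<^esub> ?e"
      by (simp add: sp.sum_hcomp)
    also have "\<dots> = (\<Oplus>\<^bsub>A\<^esub>x\<in>carrier G. hcomp G A \<A> x \<one>\<^bsub>A\<^esub> \<otimes>\<^bsub>A\<^esub> ?e)"
      using e by (intro pr.finsum_left) (auto simp: sp.hcomp_carrier)
    also have "\<dots> = (\<Oplus>\<^bsub>A\<^esub>x\<in>carrier G. hcomp G A \<A> x \<one>\<^bsub>A\<^esub>)"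
      by (intro rg.finsum_eqI) (auto simp: * sp.hcomp_in sp.hcomp_carrier)
    finally show ?thesis by (simp add: sp.sum_hcomp)
  qed
  with e have "\<one>\<^bsub>A\<^esub> = ?e" by simp
  also have "?e \<in> \<A> \<one>\<^bsub>G\<^esub>" by (simp add: sp.hcomp_in)
  finally show ?thesis .
qed

lemma hcomp_one: "x \<in> carrier G \<Longrightarrow>
    hcomp G A \<A> x \<one>\<^bsub>A\<^esub> = (if x = \<one>\<^bsub>G\<^esub> then \<one>\<^bsub>A\<^esub> else \<zero>\<^bsub>A\<^esub>)"
  by (simp add: sp.hcomp_homog[OF one_homog])

end

lemma Beilinson_Green_simps [simp]:
  "carrier (Beilinson_Green G A \<A>) = matrices G \<A>"
  "monoid.mult (Beilinson_Green G A \<A>) = mmul G A (monoid.mult A)"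
  "one (Beilinson_Green G A \<A>) =
    (\<lambda>(g, h)\<in>carrier G \<times> carrier G. if g = h then \<one>\<^bsub>A\<^esub> else \<zero>\<^bsub>A\<^esub>)"
  "zero (Beilinson_Green G A \<A>) = (\<lambda>p\<in>carrier G \<times> carrier G. \<zero>\<^bsub>A\<^esub>)"
  "add (Beilinson_Green G A \<A>) = (\<lambda>a b. \<lambda>p\<in>carrier G \<times> carrier G. a p \<oplus>\<^bsub>A\<^esub> b p)"
  "smult (Beilinson_Green G A \<A>) = (\<lambda>k a. \<lambda>p\<in>carrier G \<times> carrier G. k \<odot>\<^bsub>A\<^esub> a p)"
  by (simp_all add: Beilinson_Green_def matrices_def mmul_def[abs_def] Let_def)

lemma (in graded_alg) one_matrix:
  "(\<lambda>(g, h)\<in>carrier G \<times> carrier G. if g = h then \<one>\<^bsub>A\<^esub> else \<zero>\<^bsub>A\<^esub>) \<in> matrices G \<A>"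
  by (intro matricesI) (auto simp: one_homog subspace_zero[OF sp.homog_subspace])

lemma (in graded_alg) k_algebra_Beilinson_Green: "k_algebra K (Beilinson_Green G A \<A>)"
proof (rule k_algebra.intro)
  show vs: "vectorspace K (Beilinson_Green G A \<A>)"
    by (rule sp.matrix_vectorspace) simp_all
  show "ring (Beilinson_Green G A \<A>)"
  proof (intro ringI vectorspace_abelian_group[OF vs] monoidI)
    fix a assume "a \<in> carrier (Beilinson_Green G A \<A>)"
    then have a: "a \<in> matrices G \<A>" by simp
    show "\<one>\<^bsub>Beilinson_Green G A \<A>\<^esub> \<otimes>\<^bsub>Beilinson_Green G A \<A>\<^esub> a = a"
      by (rule matrix_ext[of _ G]) (use a in \<open>simp_all add: mmul_extensional matrices_extensional
          pr.mmul_unit_left sp.matrices_carrier del: mmul_entry\<close>)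
    show "a \<otimes>\<^bsub>Beilinson_Green G A \<A>\<^esub> \<one>\<^bsub>Beilinson_Green G A \<A>\<^esub> = a"
      by (rule matrix_ext[of _ G]) (use a in \<open>simp_all add: mmul_extensional matrices_extensional
          pr.mmul_unit_right sp.matrices_carrier del: mmul_entry\<close>)
  next
    fix a b c
    assume "a \<in> carrier (Beilinson_Green G A \<A>)" "b \<in> carrier (Beilinson_Green G A \<A>)"
      "c \<in> carrier (Beilinson_Green G A \<A>)"
    then show "a \<otimes>\<^bsub>Beilinson_Green G A \<A>\<^esub> b \<otimes>\<^bsub>Beilinson_Green G A \<A>\<^esub> c =
        a \<otimes>\<^bsub>Beilinson_Green G A \<A>\<^esub> (b \<otimes>\<^bsub>Beilinson_Green G A \<A>\<^esub> c)"
      using mmul_assoc[OF pr.graded_pairing_axioms pr.graded_pairing_axioms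
          pr.graded_pairing_axioms pr.graded_pairing_axioms]
      by (simp add: rg.m_assoc)
  qed (simp_all add: one_matrix pr.mmul_matrices pr.mmul_add_left pr.mmul_add_right)
qed (simp_all add: pr.mmul_smult_left pr.mmul_smult_right al.smult_mult_left al.smult_mult_right)

section \<open>One-sided, regular and matrix bimodules\<close>

lemma as_left_module_simps [simp]:
  "carrier (as_left_module U) = carrier U" "zero (as_left_module U) = zero U"
  "add (as_left_module U) = add U" "smult (as_left_module U) = smult U"
  "lact (as_left_module U) = lact U" "ract (as_left_module U) = (\<lambda>u k. k \<odot>\<^bsub>U\<^esub> u)"
  by (simp_all add: as_left_module_def module.defs bimodule.defs)

lemma as_right_module_simps [simp]:
  "carrier (as_right_module U) = carrier U" "zero (as_right_module U) = zero U"
  "add (as_right_module U) = add U" "smult (as_right_module U) = smult U"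
  "lact (as_right_module U) = (\<lambda>k u. k \<odot>\<^bsub>U\<^esub> u)" "ract (as_right_module U) = ract U"
  by (simp_all add: as_right_module_def module.defs bimodule.defs)

lemma regular_bimodule_simps [simp]:
  "carrier (regular_bimodule A) = carrier A" "zero (regular_bimodule A) = zero A"
  "add (regular_bimodule A) = add A" "smult (regular_bimodule A) = smult A"
  "lact (regular_bimodule A) = monoid.mult A" "ract (regular_bimodule A) = monoid.mult A"
  by (simp_all add: regular_bimodule_def module.defs bimodule.defs)

lemma bimodule_sum_simps [simp]:
  "carrier (bimodule_sum U V) = carrier U \<times> carrier V" "zero (bimodule_sum U V) = (zero U, zero V)"
  "add (bimodule_sum U V) = (\<lambda>v w. (fst v \<oplus>\<^bsub>U\<^esub> fst w, snd v \<oplus>\<^bsub>V\<^esub> snd w))"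
  "smult (bimodule_sum U V) = (\<lambda>k v. (k \<odot>\<^bsub>U\<^esub> fst v, k \<odot>\<^bsub>V\<^esub> snd v))"
  "lact (bimodule_sum U V) = (\<lambda>c (u, v). (lact U c u, lact V c v))"
  "ract (bimodule_sum U V) = (\<lambda>(u, v) d. (ract U u d, ract V v d))"
  by (simp_all add: bimodule_sum_def direct_sum_def module.defs bimodule.defs)

lemma self_algebra_simps [simp]:
  "carrier (self_algebra K) = carrier K" "zero (self_algebra K) = zero K"
  "one (self_algebra K) = one K" "monoid.mult (self_algebra K) = monoid.mult K"
  "add (self_algebra K) = add K" "smult (self_algebra K) = monoid.mult K"
  by (simp_all add: self_algebra_def)

lemma vectorspace_eq_structure:
  assumes "vectorspace K U" "carrier V = carrier U" "zero V = zero U" "add V = add U" "smult V = smult U"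
  shows "vectorspace K V"
proof -
  interpret vectorspace K U by fact
  have "abelian_group V"
    by (rule abelian_groupI) (use assms(2-) in \<open>auto simp: M.a_ac intro: M.l_neg M.a_inv_closed\<close>)
  then have "module K V"
    by (intro moduleI R.cring_axioms)
      (use assms(2-) in \<open>auto simp: smult_l_distr smult_r_distr smult_assoc1\<close>)
  then show ?thesis by (simp add: vectorspace_def field.field_axioms)
qed

lemma k_algebra_self: "field K \<Longrightarrow> k_algebra K (self_algebra K)"
proof -
  assume "field K"
  then interpret field K .
  have ab: "abelian_group (self_algebra K)"
    by (rule abelian_groupI) (auto simp: a_ac intro: l_neg a_inv_closed)
  have "module K (self_algebra K)"
    by (intro moduleI ab is_cring) (auto simp: m_assoc l_distr r_distr)
  then have "vectorspace K (self_algebra K)" by (simp add: vectorspace_def field_axioms)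
  moreover have "ring (self_algebra K)"
    by (intro ringI ab monoidI) (auto simp: m_assoc l_distr r_distr)
  ultimately show ?thesis
    by (intro k_algebra.intro) (auto simp: m_ac)
qed

lemma graded_alg_self:
  assumes G: "group G" and fin: "finite (carrier G)" and K: "field K"
  shows "graded_alg G K (self_algebra K) (trivial_grading G (self_algebra K))"
proof (rule graded_alg.intro)
  interpret grp: group G by fact
  interpret K: field K by fact
  interpret al: k_algebra K "self_algebra K" by (rule k_algebra_self[OF K])
  interpret ab: abelian_group "self_algebra K" by (rule vectorspace_abelian_group[OF al.vs])
  have "grading G K (self_algebra K) (trivial_grading G (self_algebra K))"
  proof (rule gradingI[where \<pi> = "\<lambda>x m. if x = \<one>\<^bsub>G\<^esub> then m else \<zero>\<^bsub>K\<^esub>"])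
    show "(\<Oplus>\<^bsub>self_algebra K\<^esub>x\<in>carrier G. if x = \<one>\<^bsub>G\<^esub> then m else \<zero>\<^bsub>K\<^esub>) = m"
      if "m \<in> carrier (self_algebra K)" for m
      using that fin by (subst ab.finsum_only[of _ "\<one>\<^bsub>G\<^esub>"]) auto
  qed (auto simp: fin al.vs trivial_grading_def intro!: subspaceI additive_mapI)
  then show "graded_algebra G K (self_algebra K) (trivial_grading G (self_algebra K))"
    by (auto simp: graded_algebra_def al.k_algebra_axioms trivial_grading_def)
qed (fact assms)+

lemma bimodule_as_left:
  assumes "bimodule K C D U"
  shows "bimodule K C (self_algebra K) (as_left_module U)"
proof -
  interpret bimodule K C D U by fact
  interpret v: vectorspace K U by (rule vs)
  show ?thesis
  proof (rule bimodule.intro)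
    show "vectorspace K (as_left_module U)" by (rule vectorspace_eq_structure[OF vs]) simp_all
  qed (auto simp: left_algebra k_algebra_self[OF vectorspace_field[OF vs]] lact_closed
      lact_add_left lact_add_right lact_smult_left lact_smult_right lact_mult lact_one
      v.smult_l_distr v.smult_r_distr v.smult_assoc1[symmetric] v.R.m_comm)
qed

lemma bimodule_as_right:
  assumes "bimodule K C D U"
  shows "bimodule K (self_algebra K) D (as_right_module U)"
proof -
  interpret bimodule K C D U by fact
  interpret v: vectorspace K U by (rule vs)
  show ?thesis
  proof (rule bimodule.intro)
    show "vectorspace K (as_right_module U)" by (rule vectorspace_eq_structure[OF vs]) simp_all
  qed (auto simp: right_algebra k_algebra_self[OF vectorspace_field[OF vs]] ract_closed
      ract_add_left ract_add_right ract_smult_left ract_smult_right ract_mult ract_one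
      v.smult_l_distr v.smult_r_distr v.smult_assoc1[symmetric] v.R.m_comm)
qed

lemma bimodule_regular:
  assumes "k_algebra K A"
  shows "bimodule K A A (regular_bimodule A)"
proof -
  interpret k_algebra K A by fact
  interpret ring A by (rule ring)
  show ?thesis
  proof (rule bimodule.intro)
    show "vectorspace K (regular_bimodule A)" by (rule vectorspace_eq_structure[OF vs]) simp_all
  qed (auto simp: assms smult_mult_left smult_mult_right l_distr r_distr m_assoc)
qed

definition bar :: "('g, 'p) monoid_scheme \<Rightarrow> ('k, 'c, 'd, 'm) bimodule \<Rightarrow> ('g \<Rightarrow> 'm set) \<Rightarrow>
    ('k, 'g \<times> 'g \<Rightarrow> 'c, 'g \<times> 'g \<Rightarrow> 'd, 'g \<times> 'g \<Rightarrow> 'm) bimodule"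
  where "bar G U \<U> =
    \<lparr>carrier = matrices G \<U>,
     monoid.mult = (\<lambda>_ _. \<lambda>p\<in>carrier G \<times> carrier G. \<zero>\<^bsub>U\<^esub>),
     one = (\<lambda>p\<in>carrier G \<times> carrier G. \<zero>\<^bsub>U\<^esub>),
     zero = (\<lambda>p\<in>carrier G \<times> carrier G. \<zero>\<^bsub>U\<^esub>),
     add = (\<lambda>a b. \<lambda>p\<in>carrier G \<times> carrier G. a p \<oplus>\<^bsub>U\<^esub> b p),
     smult = (\<lambda>k a. \<lambda>p\<in>carrier G \<times> carrier G. k \<odot>\<^bsub>U\<^esub> a p),
     lact = mmul G U (lact U),
     ract = mmul G U (ract U)\<rparr>"

lemma bar_simps [simp]:
  "carrier (bar G U \<U>) = matrices G \<U>"
  "zero (bar G U \<U>) = (\<lambda>p\<in>carrier G \<times> carrier G. \<zero>\<^bsub>U\<^esub>)"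
  "add (bar G U \<U>) = (\<lambda>a b. \<lambda>p\<in>carrier G \<times> carrier G. a p \<oplus>\<^bsub>U\<^esub> b p)"
  "smult (bar G U \<U>) = (\<lambda>k a. \<lambda>p\<in>carrier G \<times> carrier G. k \<odot>\<^bsub>U\<^esub> a p)"
  "lact (bar G U \<U>) = mmul G U (lact U)"
  "ract (bar G U \<U>) = mmul G U (ract U)"
  by (simp_all add: bar_def)

locale graded_bimod =
  C: graded_alg G K C \<C> + D: graded_alg G K D \<D> + bimodule K C D U
  for G :: "('g, 'p) monoid_scheme" and K :: "('k, 'q) ring_scheme"
    and C :: "('k, 'c) module" and \<C>
    and D :: "('k, 'd) module" and \<D>
    and U :: "('k, 'c, 'd, 'm) bimodule" +
  fixes \<U> :: "'g \<Rightarrow> 'm set"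
  assumes gr: "grading G K U \<U>"
    and lact_homog: "\<lbrakk>g \<in> carrier G; h \<in> carrier G; c \<in> \<C> g; u \<in> \<U> h\<rbrakk> \<Longrightarrow> lact U c u \<in> \<U> (g \<otimes>\<^bsub>G\<^esub> h)"
    and ract_homog: "\<lbrakk>g \<in> carrier G; h \<in> carrier G; u \<in> \<U> g; d \<in> \<D> h\<rbrakk> \<Longrightarrow> ract U u d \<in> \<U> (g \<otimes>\<^bsub>G\<^esub> h)"
begin

sublocale sp: graded_space G K U \<U>
  by (intro graded_space.intro C.G C.fin vs gr)

sublocale L: graded_pairing G K C \<C> U \<U> U \<U> "lact U"
  by (intro graded_pairing.intro graded_pairing_axioms.intro C.sp.graded_space_axioms sp.graded_space_axioms)
    (auto simp: lact_closed lact_add_left lact_add_right lact_homog)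

sublocale R: graded_pairing G K U \<U> D \<D> U \<U> "ract U"
  by (intro graded_pairing.intro graded_pairing_axioms.intro D.sp.graded_space_axioms sp.graded_space_axioms)
    (auto simp: ract_closed ract_add_left ract_add_right ract_homog)

text \<open>Closure is the degree count g h\<inverse> h l\<inverse> = g l\<inverse>; the three
  associativity axioms are the interchange of sums for three choices of pairings.\<close>

lemma bimodule_bar: "bimodule K (Beilinson_Green G C \<C>) (Beilinson_Green G D \<D>) (bar G U \<U>)"
proof (rule bimodule.intro)
  show "vectorspace K (bar G U \<U>)"
    by (rule sp.matrix_vectorspace) simp_all
next
  fix u assume "u \<in> carrier (bar G U \<U>)"
  then have u: "u \<in> matrices G \<U>" by simp
  show "lact (bar G U \<U>) \<one>\<^bsub>Beilinson_Green G C \<C>\<^esub> u = u"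
    by (rule matrix_ext[of _ G]) (use u in \<open>simp_all add: mmul_extensional matrices_extensional
        L.mmul_unit_left sp.matrices_carrier lact_one del: mmul_entry\<close>)
  show "ract (bar G U \<U>) u \<one>\<^bsub>Beilinson_Green G D \<D>\<^esub> = u"
    by (rule matrix_ext[of _ G]) (use u in \<open>simp_all add: mmul_extensional matrices_extensional
        R.mmul_unit_right sp.matrices_carrier ract_one del: mmul_entry\<close>)
next
  fix c c' u
  assume "c \<in> carrier (Beilinson_Green G C \<C>)" "c' \<in> carrier (Beilinson_Green G C \<C>)"
    "u \<in> carrier (bar G U \<U>)"
  then show "lact (bar G U \<U>) (c \<otimes>\<^bsub>Beilinson_Green G C \<C>\<^esub> c') u =
      lact (bar G U \<U>) c (lact (bar G U \<U>) c' u)"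
    using mmul_assoc[OF C.pr.graded_pairing_axioms L.graded_pairing_axioms
        L.graded_pairing_axioms L.graded_pairing_axioms]
    by (simp add: lact_mult)
next
  fix u d d'
  assume "u \<in> carrier (bar G U \<U>)" "d \<in> carrier (Beilinson_Green G D \<D>)"
    "d' \<in> carrier (Beilinson_Green G D \<D>)"
  then show "ract (bar G U \<U>) u (d \<otimes>\<^bsub>Beilinson_Green G D \<D>\<^esub> d') =
      ract (bar G U \<U>) (ract (bar G U \<U>) u d) d'"
    using mmul_assoc[OF R.graded_pairing_axioms R.graded_pairing_axioms
        D.pr.graded_pairing_axioms R.graded_pairing_axioms]
    by (simp add: ract_mult)
next
  fix c u d
  assume "c \<in> carrier (Beilinson_Green G C \<C>)" "u \<in> carrier (bar G U \<U>)"
    "d \<in> carrier (Beilinson_Green G D \<D>)"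
  then show "ract (bar G U \<U>) (lact (bar G U \<U>) c u) d = lact (bar G U \<U>) c (ract (bar G U \<U>) u d)"
    using mmul_assoc[OF L.graded_pairing_axioms R.graded_pairing_axioms
        R.graded_pairing_axioms L.graded_pairing_axioms]
    by (simp add: lact_ract)
qed (simp_all add: C.k_algebra_Beilinson_Green D.k_algebra_Beilinson_Green
    L.mmul_matrices R.mmul_matrices L.mmul_add_left L.mmul_add_right R.mmul_add_left R.mmul_add_right
    L.mmul_smult_left L.mmul_smult_right R.mmul_smult_left R.mmul_smult_right
    lact_smult_left lact_smult_right ract_smult_left ract_smult_right)

end

lemma graded_bimodI:
  assumes "graded_alg G K C \<C>" "graded_alg G K D \<D>" "graded_bimodule G K C \<C> D \<D> U \<U>"
  shows "graded_bimod G K C \<C> D \<D> U \<U>"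
proof -
  interpret C: graded_alg G K C \<C> by fact
  interpret D: graded_alg G K D \<D> by fact
  show ?thesis
    using assms(3)
    by (auto simp: graded_bimod_def graded_bimod_axioms_def graded_bimodule_def fg_bimodule_def assms(1,2))
qed

lemma (in graded_alg) graded_bimod_regular: "graded_bimod G K A \<A> A \<A> (regular_bimodule A) \<A>"
proof -
  have "grading G K (regular_bimodule A) \<A>"
  proof -
    have "subspace K (\<A> g) (regular_bimodule A)" if g: "g \<in> carrier G" for g
    proof (rule subspaceI)
      note sub = sp.homog_subspace[OF g]
      show "vectorspace K (regular_bimodule A)"
        by (rule bimodule.vs[OF bimodule_regular[OF al.k_algebra_axioms]])
      show "\<A> g \<subseteq> carrier (regular_bimodule A)"
        using subspace_subset[OF sub] by simp
    qed (simp_all add: subspace_zero[OF sp.homog_subspace[OF g]] subspace_add[OF sp.homog_subspace[OF g]]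
        subspace_smult[OF sp.homog_subspace[OF g]])
    moreover have "finsum (regular_bimodule A) f I = finsum A f I" for f :: "'g \<Rightarrow> 'a" and I
      by (rule finsum_eq_structure) simp_all
    ultimately show ?thesis using sp.gr by (simp add: grading_def)
  qed
  then show ?thesis
    by (simp add: graded_bimod_def graded_bimod_axioms_def graded_alg_axioms bimodule_regular
        al.k_algebra_axioms pr.homog)
qed

section \<open>Transfer of projectivity\<close>

context bimodule
begin

sublocale ab: abelian_group U by (rule vectorspace_abelian_group[OF vs])
sublocale Crg: ring C by (rule k_algebra.ring[OF left_algebra])
sublocale Drg: ring D by (rule k_algebra.ring[OF right_algebra])

lemma lact_additive: "c \<in> carrier C \<Longrightarrow> additive_map U U (lact U c)"
  by (intro additive_mapI) (auto simp: lact_closed lact_add_right)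

lemma lact_additive_left: "u \<in> carrier U \<Longrightarrow> additive_map C U (\<lambda>c. lact U c u)"
  by (intro additive_mapI) (auto simp: lact_closed lact_add_left)

lemma ract_additive: "d \<in> carrier D \<Longrightarrow> additive_map U U (\<lambda>u. ract U u d)"
  by (intro additive_mapI) (auto simp: ract_closed ract_add_left)

lemma ract_additive_right: "u \<in> carrier U \<Longrightarrow> additive_map D U (ract U u)"
  by (intro additive_mapI) (auto simp: ract_closed ract_add_right)

lemmas lact_finsum = additive_map_finsum[OF ab.abelian_group_axioms ab.abelian_group_axioms lact_additive]
lemmas lact_finsum_left =
  additive_map_finsum[OF Crg.abelian_group_axioms ab.abelian_group_axioms lact_additive_left]
lemmas ract_finsum = additive_map_finsum[OF ab.abelian_group_axioms ab.abelian_group_axioms ract_additive]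
lemmas ract_finsum_right =
  additive_map_finsum[OF Drg.abelian_group_axioms ab.abelian_group_axioms ract_additive_right]
lemmas lact_zero = additive_map_zero[OF ab.abelian_group_axioms ab.abelian_group_axioms lact_additive]
lemmas lact_zero_left =
  additive_map_zero[OF Crg.abelian_group_axioms ab.abelian_group_axioms lact_additive_left]
lemmas ract_zero = additive_map_zero[OF ab.abelian_group_axioms ab.abelian_group_axioms ract_additive]
lemmas ract_zero_right =
  additive_map_zero[OF Drg.abelian_group_axioms ab.abelian_group_axioms ract_additive_right]

end

lemma bimodule_homD:
  assumes "f \<in> bimodule_hom K C D U V"
  shows bimodule_hom_closed: "\<And>u. u \<in> carrier U \<Longrightarrow> f u \<in> carrier V"
    and bimodule_hom_add: "\<And>u v. u \<in> carrier U \<Longrightarrow> v \<in> carrier U \<Longrightarrow> f (u \<oplus>\<^bsub>U\<^esub> v) = f u \<oplus>\<^bsub>V\<^esub> f v"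
    and bimodule_hom_smult: "\<And>k u. k \<in> carrier K \<Longrightarrow> u \<in> carrier U \<Longrightarrow> f (k \<odot>\<^bsub>U\<^esub> u) = k \<odot>\<^bsub>V\<^esub> f u"
    and bimodule_hom_lact: "\<And>c u. c \<in> carrier C \<Longrightarrow> u \<in> carrier U \<Longrightarrow> f (lact U c u) = lact V c (f u)"
    and bimodule_hom_ract: "\<And>u d. u \<in> carrier U \<Longrightarrow> d \<in> carrier D \<Longrightarrow> f (ract U u d) = ract V (f u) d"
  using assms by (auto simp: bimodule_hom_def module_hom_def)

lemma bimodule_homI:
  assumes "\<And>u. u \<in> carrier U \<Longrightarrow> f u \<in> carrier V"
    and "\<And>u v. u \<in> carrier U \<Longrightarrow> v \<in> carrier U \<Longrightarrow> f (u \<oplus>\<^bsub>U\<^esub> v) = f u \<oplus>\<^bsub>V\<^esub> f v"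
    and "\<And>k u. k \<in> carrier K \<Longrightarrow> u \<in> carrier U \<Longrightarrow> f (k \<odot>\<^bsub>U\<^esub> u) = k \<odot>\<^bsub>V\<^esub> f u"
    and "\<And>c u. c \<in> carrier C \<Longrightarrow> u \<in> carrier U \<Longrightarrow> f (lact U c u) = lact V c (f u)"
    and "\<And>u d. u \<in> carrier U \<Longrightarrow> d \<in> carrier D \<Longrightarrow> f (ract U u d) = ract V (f u) d"
  shows "f \<in> bimodule_hom K C D U V"
  using assms by (auto simp: bimodule_hom_def module_hom_def)

lemma bimodule_hom_additive: "f \<in> bimodule_hom K C D U V \<Longrightarrow> additive_map U V f"
  by (intro additive_mapI) (auto simp: bimodule_hom_closed bimodule_hom_add)

lemma bimodule_hom_compose:
  "f \<in> bimodule_hom K C D U V \<Longrightarrow> g \<in> bimodule_hom K C D V W \<Longrightarrow>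
    (\<lambda>u. g (f u)) \<in> bimodule_hom K C D U W"
  by (intro bimodule_homI) (simp_all add: bimodule_homD)

section \<open>Restriction of scalars and its grading by corners\<close>

definition restrict_scalars :: "('c \<Rightarrow> 'c2) \<Rightarrow> ('d \<Rightarrow> 'd2) \<Rightarrow> ('k, 'c2, 'd2, 'm) bimodule \<Rightarrow>
    ('k, 'c, 'd, 'm) bimodule"
  where "restrict_scalars \<alpha> \<beta> Y = module.extend (module.truncate Y)
    (bimodule.fields (\<lambda>c. lact Y (\<alpha> c)) (\<lambda>y d. ract Y y (\<beta> d)))"

lemma restrict_scalars_simps [simp]:
  "carrier (restrict_scalars \<alpha> \<beta> Y) = carrier Y" "zero (restrict_scalars \<alpha> \<beta> Y) = zero Y"
  "add (restrict_scalars \<alpha> \<beta> Y) = add Y" "smult (restrict_scalars \<alpha> \<beta> Y) = smult Y"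
  "lact (restrict_scalars \<alpha> \<beta> Y) = (\<lambda>c. lact Y (\<alpha> c))"
  "ract (restrict_scalars \<alpha> \<beta> Y) = (\<lambda>y d. ract Y y (\<beta> d))"
  by (simp_all add: restrict_scalars_def module.defs bimodule.defs)

text \<open>One side of a bimodule over \<open>E\<close>, treated so that the Beilinson--Green algebra \<open>E\<close> of \<open>C\<close>
  and the trivial case \<open>E = C = K\<close> are both instances. In the first case \<open>\<epsilon> g\<close> is the diagonal
  idempotent at \<open>g\<close>, \<open>\<alpha>\<close> is \<^const>\<open>spread\<close> and \<open>\<kappa> g\<close> is the whole group; in the second case
  \<open>\<epsilon> g\<close> is the unit and \<open>\<kappa> g = {g}\<close>. The idempotents with index in \<open>\<kappa> g\<close> are orthogonal and
  complete, and \<open>coef a\<close> is the matrix of \<open>a\<close> with respect to them.\<close>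

locale side = graded_alg G K C \<C> + E: k_algebra K E
  for G :: "('g, 'p) monoid_scheme" and K :: "('k, 'q) ring_scheme"
    and C :: "('k, 'c) module" and \<C> and E :: "('k, 'e) module" +
  fixes \<alpha> :: "'c \<Rightarrow> 'e" and \<epsilon> :: "'g \<Rightarrow> 'e" and \<kappa> :: "'g \<Rightarrow> 'g set"
    and coef :: "'e \<Rightarrow> 'g \<times> 'g \<Rightarrow> 'c"
  assumes \<alpha>_closed: "c \<in> carrier C \<Longrightarrow> \<alpha> c \<in> carrier E"
    and \<alpha>_add: "c \<in> carrier C \<Longrightarrow> c' \<in> carrier C \<Longrightarrow> \<alpha> (c \<oplus>\<^bsub>C\<^esub> c') = \<alpha> c \<oplus>\<^bsub>E\<^esub> \<alpha> c'"
    and \<alpha>_smult: "k \<in> carrier K \<Longrightarrow> c \<in> carrier C \<Longrightarrow> \<alpha> (k \<odot>\<^bsub>C\<^esub> c) = k \<odot>\<^bsub>E\<^esub> \<alpha> c"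
    and \<alpha>_mult: "c \<in> carrier C \<Longrightarrow> c' \<in> carrier C \<Longrightarrow> \<alpha> (c \<otimes>\<^bsub>C\<^esub> c') = \<alpha> c \<otimes>\<^bsub>E\<^esub> \<alpha> c'"
    and \<alpha>_one: "\<alpha> \<one>\<^bsub>C\<^esub> = \<one>\<^bsub>E\<^esub>"
    and \<epsilon>_closed: "g \<in> carrier G \<Longrightarrow> \<epsilon> g \<in> carrier E"
    and \<kappa>_subset: "g \<in> carrier G \<Longrightarrow> \<kappa> g \<subseteq> carrier G"
    and \<kappa>_refl: "g \<in> carrier G \<Longrightarrow> g \<in> \<kappa> g"
    and \<kappa>_eq: "g \<in> carrier G \<Longrightarrow> h \<in> \<kappa> g \<Longrightarrow> \<kappa> h = \<kappa> g"
    and \<epsilon>_orth: "g \<in> carrier G \<Longrightarrow> h \<in> \<kappa> g \<Longrightarrow>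
      \<epsilon> g \<otimes>\<^bsub>E\<^esub> \<epsilon> h = (if g = h then \<epsilon> g else \<zero>\<^bsub>E\<^esub>)"
    and \<epsilon>_sum: "g \<in> carrier G \<Longrightarrow> finsum E \<epsilon> (\<kappa> g) = \<one>\<^bsub>E\<^esub>"
    and \<epsilon>_shift: "x \<in> carrier G \<Longrightarrow> h \<in> carrier G \<Longrightarrow> c \<in> \<C> x \<Longrightarrow>
      \<epsilon> (x \<otimes>\<^bsub>G\<^esub> h) \<otimes>\<^bsub>E\<^esub> \<alpha> c = \<alpha> c \<otimes>\<^bsub>E\<^esub> \<epsilon> h"
    and coef_matrices: "a \<in> carrier E \<Longrightarrow> coef a \<in> matrices G \<C>"
    and coef_zero: "a \<in> carrier E \<Longrightarrow> g \<in> carrier G \<Longrightarrow> h \<in> carrier G \<Longrightarrow> h \<notin> \<kappa> g \<Longrightarrow>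
      coef a (g, h) = \<zero>\<^bsub>C\<^esub>"
    and coef_left: "a \<in> carrier E \<Longrightarrow> g \<in> carrier G \<Longrightarrow>
      \<epsilon> g \<otimes>\<^bsub>E\<^esub> a = (\<Oplus>\<^bsub>E\<^esub>h\<in>carrier G. \<alpha> (coef a (g, h)) \<otimes>\<^bsub>E\<^esub> \<epsilon> h)"
    and coef_right: "a \<in> carrier E \<Longrightarrow> h \<in> carrier G \<Longrightarrow>
      a \<otimes>\<^bsub>E\<^esub> \<epsilon> h = (\<Oplus>\<^bsub>E\<^esub>g\<in>carrier G. \<epsilon> g \<otimes>\<^bsub>E\<^esub> \<alpha> (coef a (g, h)))"
    and coef_\<alpha>: "c \<in> carrier C \<Longrightarrow> g \<in> carrier G \<Longrightarrow> h \<in> carrier G \<Longrightarrow>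
      coef (\<alpha> c) (g, h) = hcomp G C \<C> (g \<otimes>\<^bsub>G\<^esub> inv\<^bsub>G\<^esub> h) c"
    and coef_\<epsilon>: "g \<in> carrier G \<Longrightarrow> h \<in> carrier G \<Longrightarrow> l \<in> carrier G \<Longrightarrow> h \<in> \<kappa> g \<or> l \<in> \<kappa> g \<Longrightarrow>
      coef (\<epsilon> g) (h, l) = (if h = g \<and> l = g then \<one>\<^bsub>C\<^esub> else \<zero>\<^bsub>C\<^esub>)"
begin

sublocale Erg: ring E by (rule E.ring)

lemma coef_homog: "a \<in> carrier E \<Longrightarrow> g \<in> carrier G \<Longrightarrow> h \<in> carrier G \<Longrightarrow>
    coef a (g, h) \<in> \<C> (g \<otimes>\<^bsub>G\<^esub> inv\<^bsub>G\<^esub> h)"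
  by (rule matrices_entry[OF coef_matrices])

lemma coef_carrier: "a \<in> carrier E \<Longrightarrow> g \<in> carrier G \<Longrightarrow> h \<in> carrier G \<Longrightarrow> coef a (g, h) \<in> carrier C"
  by (rule sp.matrices_carrier[OF coef_matrices])

text \<open>The coefficient at (g, h) has degree g h\<inverse>, hence carries the idempotent at h to
  the one at g.\<close>

lemma coef_shift: "a \<in> carrier E \<Longrightarrow> g \<in> carrier G \<Longrightarrow> h \<in> carrier G \<Longrightarrow>
    \<epsilon> g \<otimes>\<^bsub>E\<^esub> \<alpha> (coef a (g, h)) = \<alpha> (coef a (g, h)) \<otimes>\<^bsub>E\<^esub> \<epsilon> h"
  using \<epsilon>_shift[where h = h, OF _ _ coef_homog, of g h a] by (simp add: sp.grp.mult_inv_cancel)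

lemma coef_left': "a \<in> carrier E \<Longrightarrow> g \<in> carrier G \<Longrightarrow>
    \<epsilon> g \<otimes>\<^bsub>E\<^esub> a = (\<Oplus>\<^bsub>E\<^esub>h\<in>carrier G. \<epsilon> g \<otimes>\<^bsub>E\<^esub> \<alpha> (coef a (g, h)))"
  by (simp add: coef_left) (auto intro!: Erg.finsum_eqI simp: coef_shift \<alpha>_closed \<epsilon>_closed coef_carrier)

lemma coef_right': "a \<in> carrier E \<Longrightarrow> h \<in> carrier G \<Longrightarrow>
    a \<otimes>\<^bsub>E\<^esub> \<epsilon> h = (\<Oplus>\<^bsub>E\<^esub>g\<in>carrier G. \<alpha> (coef a (g, h)) \<otimes>\<^bsub>E\<^esub> \<epsilon> h)"
  by (simp add: coef_right) (auto intro!: Erg.finsum_eqI simp: coef_shift \<alpha>_closed \<epsilon>_closed coef_carrier)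

text \<open>An element of degree x occupies the positions (x h, h) of its coefficient matrix, and
  coefficients between different classes vanish. When classes are the whole group the last
  assumption is contradictory; when they are singletons this says that nothing lives outside degree
  1.\<close>

lemma homog_zero:
  assumes "x \<in> carrier G" "h \<in> carrier G" "c \<in> \<C> x" "h \<notin> \<kappa> (x \<otimes>\<^bsub>G\<^esub> h)"
  shows "c = \<zero>\<^bsub>C\<^esub>"
proof -
  have c: "c \<in> carrier C" using sp.homog_carrier assms by blast
  have "c = coef (\<alpha> c) (x \<otimes>\<^bsub>G\<^esub> h, h)"
    using assms c sp.hcomp_homog[OF assms(3,1,1)] by (simp add: coef_\<alpha> sp.grp.m_assoc)
  also have "\<dots> = \<zero>\<^bsub>C\<^esub>"
    using assms c by (intro coef_zero) (auto simp: \<alpha>_closed)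
  finally show ?thesis .
qed

lemma \<kappa>_finite: "g \<in> carrier G \<Longrightarrow> finite (\<kappa> g)"
  using \<kappa>_subset fin finite_subset by blast

end

locale two_sides = L: side G K C \<C> E \<alpha> \<epsilon> \<kappa> coef + R: side G K D \<D> F \<beta> \<eta> \<mu> coef'
  for G :: "('g, 'p) monoid_scheme" and K :: "('k, 'q) ring_scheme"
    and C :: "('k, 'c) module" and \<C> and E :: "('k, 'e) module" and \<alpha> \<epsilon> \<kappa> coef
    and D :: "('k, 'd) module" and \<D> and F :: "('k, 'f) module" and \<beta> \<eta> \<mu> coef'
begin

text \<open>Projection onto a component of the two-sided Peirce decomposition of Y.\<close>

definition corner :: "('k, 'e, 'f, 'm) bimodule \<Rightarrow> 'g \<Rightarrow> 'g \<Rightarrow> 'm \<Rightarrow> 'm"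
  where "corner Y g h y = lact Y (\<epsilon> g) (ract Y y (\<eta> h))"

text \<open>The elements of \<open>corner Y g h\<close> get degree \<open>g h\<inverse>\<close>. Stating homogeneity as the vanishing of all
  other corners avoids a sum over the corners of the given degree.\<close>

definition corner_grading :: "('k, 'e, 'f, 'm) bimodule \<Rightarrow> 'g set \<Rightarrow> 'g set \<Rightarrow> 'g \<Rightarrow> 'm set"
  where "corner_grading Y S T x = {y \<in> carrier Y. \<forall>g\<in>S. \<forall>h\<in>T.
    g \<otimes>\<^bsub>G\<^esub> inv\<^bsub>G\<^esub> h \<noteq> x \<longrightarrow> corner Y g h y = \<zero>\<^bsub>Y\<^esub>}"

abbreviation restr :: "('k, 'e, 'f, 'm) bimodule \<Rightarrow> ('k, 'c, 'd, 'm) bimodule"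
  where "restr \<equiv> restrict_scalars \<alpha> \<beta>"

end

locale restricted = two_sides G K C \<C> E \<alpha> \<epsilon> \<kappa> coef D \<D> F \<beta> \<eta> \<mu> coef' + Y: bimodule K E F Y
  for G :: "('g, 'p) monoid_scheme" and K :: "('k, 'q) ring_scheme"
    and C :: "('k, 'c) module" and \<C> and E :: "('k, 'e) module" and \<alpha> \<epsilon> \<kappa> coef
    and D :: "('k, 'd) module" and \<D> and F :: "('k, 'f) module" and \<beta> \<eta> \<mu> coef'
    and Y :: "('k, 'e, 'f, 'm) bimodule"
begin

lemma bimodule_restr: "bimodule K C D (restr Y)"
proof (rule bimodule.intro)
  show "vectorspace K (restr Y)" by (rule vectorspace_eq_structure[OF Y.vs]) simp_all
qed (simp_all add: L.al.k_algebra_axioms R.al.k_algebra_axioms L.\<alpha>_closed L.\<alpha>_add L.\<alpha>_smult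
    L.\<alpha>_mult L.\<alpha>_one R.\<alpha>_closed R.\<alpha>_add R.\<alpha>_smult R.\<alpha>_mult R.\<alpha>_one Y.lact_closed Y.lact_add_left
    Y.lact_add_right Y.lact_smult_left Y.lact_smult_right Y.lact_mult Y.lact_one Y.ract_closed
    Y.ract_add_left Y.ract_add_right Y.ract_smult_left Y.ract_smult_right Y.ract_mult Y.ract_one
    Y.lact_ract)

lemma corner_closed: "g \<in> carrier G \<Longrightarrow> h \<in> carrier G \<Longrightarrow> y \<in> carrier Y \<Longrightarrow> corner Y g h y \<in> carrier Y"
  by (simp add: corner_def Y.lact_closed Y.ract_closed L.\<epsilon>_closed R.\<epsilon>_closed)

lemma corner_additive: "g \<in> carrier G \<Longrightarrow> h \<in> carrier G \<Longrightarrow> additive_map Y Y (corner Y g h)"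
  by (intro additive_mapI)
    (simp_all add: corner_def Y.lact_closed Y.ract_closed L.\<epsilon>_closed R.\<epsilon>_closed Y.ract_add_left Y.lact_add_right)

lemma corner_smult: "g \<in> carrier G \<Longrightarrow> h \<in> carrier G \<Longrightarrow> k \<in> carrier K \<Longrightarrow> y \<in> carrier Y \<Longrightarrow>
    corner Y g h (k \<odot>\<^bsub>Y\<^esub> y) = k \<odot>\<^bsub>Y\<^esub> corner Y g h y"
  by (simp add: corner_def Y.lact_closed Y.ract_closed L.\<epsilon>_closed R.\<epsilon>_closed Y.ract_smult_left Y.lact_smult_right)

lemmas corner_finsum = additive_map_finsum[OF Y.ab.abelian_group_axioms Y.ab.abelian_group_axioms corner_additive]
lemmas corner_zero = additive_map_zero[OF Y.ab.abelian_group_axioms Y.ab.abelian_group_axioms corner_additive]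

text \<open>The primed indices are kept within the classes of g and h, because idempotents of
  different classes need not be orthogonal: for K they are all equal to 1.\<close>

lemma corner_corner:
  assumes "g \<in> carrier G" "h \<in> carrier G" "g' \<in> \<kappa> g" "h' \<in> \<mu> h" "y \<in> carrier Y"
  shows "corner Y g h (corner Y g' h' y) = (if g = g' \<and> h = h' then corner Y g h y else \<zero>\<^bsub>Y\<^esub>)"
proof -
  have g': "g' \<in> carrier G" and h': "h' \<in> carrier G"
    using assms L.\<kappa>_subset R.\<kappa>_subset by auto
  \<comment> \<open>The right idempotents will be multiplied in the order \<open>\<eta> h'\<close>,
    \<open>\<eta> h\<close>, so orthogonality is needed at h'.\<close>
  have h: "h \<in> \<mu> h'" using R.\<kappa>_refl[of h] R.\<kappa>_eq[of h h'] assms by blast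
  have "corner Y g h (corner Y g' h' y) = lact Y (\<epsilon> g \<otimes>\<^bsub>E\<^esub> \<epsilon> g') (ract Y y (\<eta> h' \<otimes>\<^bsub>F\<^esub> \<eta> h))"
    using assms g' h' by (simp add: corner_def Y.lact_closed Y.ract_closed L.\<epsilon>_closed R.\<epsilon>_closed
        Y.lact_mult Y.ract_mult Y.lact_ract)
  also have "\<dots> = (if g = g' \<and> h = h' then corner Y g h y else \<zero>\<^bsub>Y\<^esub>)"
    using assms g' h' h L.\<epsilon>_orth[of g g'] R.\<epsilon>_orth[of h' h]
    by (auto simp: corner_def Y.lact_zero_left Y.ract_zero_right Y.lact_zero L.\<epsilon>_closed R.\<epsilon>_closed Y.ract_closed)
  finally show ?thesis .
qed

lemma corner_sum:
  assumes "g0 \<in> carrier G" "h0 \<in> carrier G" "y \<in> carrier Y"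
  shows "(\<Oplus>\<^bsub>Y\<^esub>g\<in>\<kappa> g0. \<Oplus>\<^bsub>Y\<^esub>h\<in>\<mu> h0. corner Y g h y) = y"
proof -
  have sub: "\<And>g. g \<in> \<kappa> g0 \<Longrightarrow> g \<in> carrier G" "\<And>h. h \<in> \<mu> h0 \<Longrightarrow> h \<in> carrier G"
    using assms L.\<kappa>_subset R.\<kappa>_subset by auto
  have "(\<Oplus>\<^bsub>Y\<^esub>g\<in>\<kappa> g0. \<Oplus>\<^bsub>Y\<^esub>h\<in>\<mu> h0. corner Y g h y) = (\<Oplus>\<^bsub>Y\<^esub>g\<in>\<kappa> g0. lact Y (\<epsilon> g) y)"
  proof (rule Y.ab.finsum_eqI)
    fix g assume g: "g \<in> \<kappa> g0"
    have "(\<Oplus>\<^bsub>Y\<^esub>h\<in>\<mu> h0. corner Y g h y) = lact Y (\<epsilon> g) (\<Oplus>\<^bsub>Y\<^esub>h\<in>\<mu> h0. ract Y y (\<eta> h))"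
      unfolding corner_def using g assms sub
      by (subst Y.lact_finsum) (auto simp: Y.ract_closed L.\<epsilon>_closed R.\<epsilon>_closed)
    also have "(\<Oplus>\<^bsub>Y\<^esub>h\<in>\<mu> h0. ract Y y (\<eta> h)) = ract Y y (finsum F \<eta> (\<mu> h0))"
      using assms sub by (subst Y.ract_finsum_right) (auto simp: R.\<epsilon>_closed)
    finally show "(\<Oplus>\<^bsub>Y\<^esub>h\<in>\<mu> h0. corner Y g h y) = lact Y (\<epsilon> g) y"
      using assms by (simp add: R.\<epsilon>_sum Y.ract_one)
  qed (use assms sub in \<open>auto simp: Y.lact_closed L.\<epsilon>_closed\<close>)
  also have "\<dots> = lact Y (finsum E \<epsilon> (\<kappa> g0)) y"
    using assms sub by (subst Y.lact_finsum_left) (auto simp: L.\<epsilon>_closed)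
  finally show ?thesis using assms by (simp add: L.\<epsilon>_sum Y.lact_one)
qed

text \<open>An element of degree x moves the corner at (g, h) to the one at (x g, h), whose degree x
  g h\<inverse> is x times the old one. This is what makes g h\<inverse> the right degree for a
  corner.\<close>

lemma corner_lact_homog:
  assumes "x \<in> carrier G" "g \<in> carrier G" "h \<in> carrier G" "c \<in> \<C> x" "y \<in> carrier Y"
  shows "corner Y (x \<otimes>\<^bsub>G\<^esub> g) h (lact Y (\<alpha> c) y) = lact Y (\<alpha> c) (corner Y g h y)"
proof -
  have c: "c \<in> carrier C" using L.sp.homog_carrier assms by blast
  have "corner Y (x \<otimes>\<^bsub>G\<^esub> g) h (lact Y (\<alpha> c) y) = lact Y (\<epsilon> (x \<otimes>\<^bsub>G\<^esub> g) \<otimes>\<^bsub>E\<^esub> \<alpha> c) (ract Y y (\<eta> h))"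
    using assms c by (simp add: corner_def Y.lact_ract Y.lact_mult L.\<epsilon>_closed R.\<epsilon>_closed L.\<alpha>_closed Y.ract_closed)
  also have "\<dots> = lact Y (\<alpha> c) (corner Y g h y)"
    using assms c by (simp add: L.\<epsilon>_shift corner_def Y.lact_mult L.\<epsilon>_closed R.\<epsilon>_closed L.\<alpha>_closed Y.ract_closed)
  finally show ?thesis .
qed

text \<open>On the right, degree x leads from the corner at (g, x h), of degree g h\<inverse>
  x\<inverse>, to the one at (g, h).\<close>

lemma corner_ract_homog:
  assumes "x \<in> carrier G" "g \<in> carrier G" "h \<in> carrier G" "d \<in> \<D> x" "y \<in> carrier Y"
  shows "corner Y g h (ract Y y (\<beta> d)) = ract Y (corner Y g (x \<otimes>\<^bsub>G\<^esub> h) y) (\<beta> d)"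
proof -
  have d: "d \<in> carrier D" using R.sp.homog_carrier assms by blast
  have "corner Y g h (ract Y y (\<beta> d)) = lact Y (\<epsilon> g) (ract Y y (\<beta> d \<otimes>\<^bsub>F\<^esub> \<eta> h))"
    using assms d by (simp add: corner_def Y.ract_mult L.\<epsilon>_closed R.\<epsilon>_closed R.\<alpha>_closed Y.ract_closed)
  also have "\<dots> = ract Y (corner Y g (x \<otimes>\<^bsub>G\<^esub> h) y) (\<beta> d)"
    using assms d by (simp add: R.\<epsilon>_shift[symmetric] corner_def Y.ract_mult Y.lact_ract
        L.\<epsilon>_closed R.\<epsilon>_closed R.\<alpha>_closed Y.ract_closed)
  finally show ?thesis .
qed

text \<open>The corners of a y are sums of elements of C acting on corners of y. A C-D-subbimodule
  containing all corners of y therefore contains those of a y, which is the key to finite generation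
  after restriction.\<close>

lemma corner_lact:
  assumes "a \<in> carrier E" "g \<in> carrier G" "l \<in> carrier G" "y \<in> carrier Y"
  shows "corner Y g l (lact Y a y) = (\<Oplus>\<^bsub>Y\<^esub>h\<in>carrier G. lact Y (\<alpha> (coef a (g, h))) (corner Y h l y))"
proof -
  note cl = L.\<epsilon>_closed R.\<epsilon>_closed L.\<alpha>_closed L.coef_carrier Y.ract_closed Y.lact_closed
  have "corner Y g l (lact Y a y) = lact Y (\<epsilon> g \<otimes>\<^bsub>E\<^esub> a) (ract Y y (\<eta> l))"
    using assms by (simp add: corner_def Y.lact_ract Y.lact_mult cl)
  also have "\<dots> = (\<Oplus>\<^bsub>Y\<^esub>h\<in>carrier G. lact Y (\<alpha> (coef a (g, h)) \<otimes>\<^bsub>E\<^esub> \<epsilon> h) (ract Y y (\<eta> l)))"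
    using assms by (subst L.coef_left, simp, simp, subst Y.lact_finsum_left) (auto simp: cl)
  also have "\<dots> = (\<Oplus>\<^bsub>Y\<^esub>h\<in>carrier G. lact Y (\<alpha> (coef a (g, h))) (corner Y h l y))"
    using assms by (intro Y.ab.finsum_eqI) (auto simp: cl corner_def Y.lact_mult)
  finally show ?thesis .
qed

lemma corner_ract:
  assumes "b \<in> carrier F" "g \<in> carrier G" "l \<in> carrier G" "y \<in> carrier Y"
  shows "corner Y g l (ract Y y b) = (\<Oplus>\<^bsub>Y\<^esub>h\<in>carrier G. ract Y (corner Y g h y) (\<beta> (coef' b (h, l))))"
proof -
  note cl = L.\<epsilon>_closed R.\<epsilon>_closed R.\<alpha>_closed R.coef_carrier Y.ract_closed Y.lact_closed
  have "corner Y g l (ract Y y b) = ract Y (lact Y (\<epsilon> g) y) (b \<otimes>\<^bsub>F\<^esub> \<eta> l)"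
    using assms by (simp add: corner_def Y.lact_ract Y.ract_mult cl)
  also have "\<dots> = (\<Oplus>\<^bsub>Y\<^esub>h\<in>carrier G. ract Y (lact Y (\<epsilon> g) y) (\<eta> h \<otimes>\<^bsub>F\<^esub> \<beta> (coef' b (h, l))))"
    using assms by (subst R.coef_right, simp, simp, subst Y.ract_finsum_right) (auto simp: cl)
  also have "\<dots> = (\<Oplus>\<^bsub>Y\<^esub>h\<in>carrier G. ract Y (corner Y g h y) (\<beta> (coef' b (h, l))))"
    using assms by (intro Y.ab.finsum_eqI) (auto simp: cl corner_def Y.ract_mult Y.lact_ract)
  finally show ?thesis .
qed

text \<open>The action of E on a single corner is recovered from the action of C. A map assembled
  from C-linear lifts is shown to be E-linear by means of this.\<close>

lemma lact_corner:
  assumes "a \<in> carrier E" "h \<in> carrier G" "l \<in> carrier G" "y \<in> carrier Y"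
  shows "lact Y a (corner Y h l y) = (\<Oplus>\<^bsub>Y\<^esub>g\<in>carrier G. lact Y (\<alpha> (coef a (g, h))) (corner Y h l y))"
proof -
  note cl = L.\<epsilon>_closed R.\<epsilon>_closed L.\<alpha>_closed L.coef_carrier Y.ract_closed Y.lact_closed
  have "lact Y a (corner Y h l y) = lact Y (a \<otimes>\<^bsub>E\<^esub> \<epsilon> h) (ract Y y (\<eta> l))"
    using assms by (simp add: corner_def Y.lact_mult cl)
  also have "\<dots> = (\<Oplus>\<^bsub>Y\<^esub>g\<in>carrier G. lact Y (\<alpha> (coef a (g, h)) \<otimes>\<^bsub>E\<^esub> \<epsilon> h) (ract Y y (\<eta> l)))"
    using assms by (subst L.coef_right', simp, simp, subst Y.lact_finsum_left) (auto simp: cl)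
  also have "\<dots> = (\<Oplus>\<^bsub>Y\<^esub>g\<in>carrier G. lact Y (\<alpha> (coef a (g, h))) (corner Y h l y))"
    using assms by (intro Y.ab.finsum_eqI) (auto simp: cl corner_def Y.lact_mult)
  finally show ?thesis .
qed

lemma ract_corner:
  assumes "b \<in> carrier F" "g \<in> carrier G" "h \<in> carrier G" "y \<in> carrier Y"
  shows "ract Y (corner Y g h y) b = (\<Oplus>\<^bsub>Y\<^esub>l\<in>carrier G. ract Y (corner Y g h y) (\<beta> (coef' b (h, l))))"
proof -
  note cl = L.\<epsilon>_closed R.\<epsilon>_closed R.\<alpha>_closed R.coef_carrier Y.ract_closed Y.lact_closed
  have "ract Y (corner Y g h y) b = ract Y (lact Y (\<epsilon> g) y) (\<eta> h \<otimes>\<^bsub>F\<^esub> b)"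
    using assms by (simp add: corner_def Y.lact_ract[symmetric] Y.ract_mult cl)
  also have "\<dots> = (\<Oplus>\<^bsub>Y\<^esub>l\<in>carrier G. ract Y (lact Y (\<epsilon> g) y) (\<eta> h \<otimes>\<^bsub>F\<^esub> \<beta> (coef' b (h, l))))"
    using assms by (subst R.coef_left', simp, simp, subst Y.ract_finsum_right) (auto simp: cl)
  also have "\<dots> = (\<Oplus>\<^bsub>Y\<^esub>l\<in>carrier G. ract Y (corner Y g h y) (\<beta> (coef' b (h, l))))"
    using assms by (intro Y.ab.finsum_eqI) (auto simp: cl corner_def Y.ract_mult Y.lact_ract)
  finally show ?thesis .
qed

text \<open>The window of corners with indices in \<open>\<kappa> g0\<close> and
  \<open>\<mu> h0\<close> already decomposes Y, by orthogonality and completeness within a class.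
  For matrix algebras on both sides it consists of all corners; on a side where K acts a single
  index is kept, since the idempotent there is 1.\<close>

lemma grading_restr:
  assumes g0: "g0 \<in> carrier G" and h0: "h0 \<in> carrier G"
  shows "grading G K (restr Y) (corner_grading Y (\<kappa> g0) (\<mu> h0))"
proof -
  have gS: "g \<in> carrier G" "\<kappa> g = \<kappa> g0" if "g \<in> \<kappa> g0" for g
    using L.\<kappa>_subset[OF g0] L.\<kappa>_eq[OF g0] that by auto
  have hT: "h \<in> carrier G" "\<mu> h = \<mu> h0" if "h \<in> \<mu> h0" for h
    using R.\<kappa>_subset[OF h0] R.\<kappa>_eq[OF h0] that by auto
  have finS: "finite (\<kappa> g0)" and finT: "finite (\<mu> h0)"
    using L.\<kappa>_finite R.\<kappa>_finite g0 h0 by auto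
  interpret rY: bimodule K C D "restr Y" by (rule bimodule_restr)
  interpret v: vectorspace K Y by (rule Y.vs)
  \<comment> \<open>The projection to degree x is the sum of those corners in the window whose
    degree is x.\<close>
  let ?t = "\<lambda>x g h y. if g \<otimes>\<^bsub>G\<^esub> inv\<^bsub>G\<^esub> h = x then corner Y g h y else \<zero>\<^bsub>Y\<^esub>"
  let ?\<pi> = "\<lambda>x y. \<Oplus>\<^bsub>Y\<^esub>g\<in>\<kappa> g0. \<Oplus>\<^bsub>Y\<^esub>h\<in>\<mu> h0. ?t x g h y"
  have t_add: "additive_map Y Y (?t x g h)" if "g \<in> \<kappa> g0" "h \<in> \<mu> h0" for x g h
    using that by (cases "g \<otimes>\<^bsub>G\<^esub> inv\<^bsub>G\<^esub> h = x")
      (auto simp: corner_additive gS hT intro!: additive_map_const_zero Y.ab.abelian_group_axioms)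
  note t_cl = additive_map_closed[OF t_add]
  have sum_eq: "finsum (restr Y) f I = finsum Y f I" for f :: "'g \<Rightarrow> 'm" and I
    by (rule finsum_eq_structure) simp_all
  show ?thesis
  proof (rule gradingI[where \<pi> = ?\<pi>, OF rY.vs L.fin])
    fix x
    show "subspace K (corner_grading Y (\<kappa> g0) (\<mu> h0) x) (restr Y)"
    proof (rule subspaceI[OF rY.vs])
    qed (auto simp: corner_grading_def gS hT corner_zero corner_smult
        additive_map_add[OF corner_additive])
    show "additive_map (restr Y) (restr Y) (?\<pi> x)"
    proof -
      have "additive_map Y Y (?\<pi> x)"
        by (intro additive_map_sum Y.ab.abelian_group_axioms t_add)
      then show ?thesis by (simp add: additive_map_def cong: if_cong)
    qed
    fix y assume "y \<in> carrier (restr Y)"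
    then have y: "y \<in> carrier Y" by simp
    show "?\<pi> x y \<in> corner_grading Y (\<kappa> g0) (\<mu> h0) x"
      unfolding corner_grading_def
    proof (intro CollectI conjI ballI impI)
      show "?\<pi> x y \<in> carrier Y"
        using y t_cl by (auto intro!: Y.ab.finsum_closed)
      fix g h assume gh: "g \<in> \<kappa> g0" "h \<in> \<mu> h0" "g \<otimes>\<^bsub>G\<^esub> inv\<^bsub>G\<^esub> h \<noteq> x"
      have "corner Y g h (?\<pi> x y) = (\<Oplus>\<^bsub>Y\<^esub>g'\<in>\<kappa> g0. \<Oplus>\<^bsub>Y\<^esub>h'\<in>\<mu> h0. corner Y g h (?t x g' h' y))"
        using gh y t_cl gS hT
        by (subst corner_finsum) (auto simp: corner_finsum intro!: Y.ab.finsum_closed Y.ab.finsum_eqI corner_closed)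
      also have "\<dots> = \<zero>\<^bsub>Y\<^esub>"
        using gh y gS hT
        by (intro Y.ab.finsum_all_zero) (auto simp: corner_corner corner_zero)
      finally show "corner Y g h (?\<pi> x y) = \<zero>\<^bsub>Y\<^esub>" .
    qed
  next
    fix y assume "y \<in> carrier (restr Y)"
    then have y: "y \<in> carrier Y" by simp
    \<comment> \<open>With the sum over degrees innermost, each corner is met once, at its own
      degree.\<close>
    have "(\<Oplus>\<^bsub>Y\<^esub>x\<in>carrier G. ?\<pi> x y) = (\<Oplus>\<^bsub>Y\<^esub>g\<in>\<kappa> g0. \<Oplus>\<^bsub>Y\<^esub>x\<in>carrier G. \<Oplus>\<^bsub>Y\<^esub>h\<in>\<mu> h0. ?t x g h y)"
      using y t_cl L.fin finS by (intro Y.ab.finsum_swap) (auto intro!: Y.ab.finsum_closed)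
    also have "\<dots> = (\<Oplus>\<^bsub>Y\<^esub>g\<in>\<kappa> g0. \<Oplus>\<^bsub>Y\<^esub>h\<in>\<mu> h0. \<Oplus>\<^bsub>Y\<^esub>x\<in>carrier G. ?t x g h y)"
      using y t_cl L.fin finT
      by (intro Y.ab.finsum_eqI Y.ab.finsum_swap) (auto intro!: Y.ab.finsum_closed)
    also have "\<dots> = (\<Oplus>\<^bsub>Y\<^esub>g\<in>\<kappa> g0. \<Oplus>\<^bsub>Y\<^esub>h\<in>\<mu> h0. corner Y g h y)"
    proof (intro Y.ab.finsum_eqI)
      fix g h assume "g \<in> \<kappa> g0" "h \<in> \<mu> h0"
      with y gS hT L.fin show "(\<Oplus>\<^bsub>Y\<^esub>x\<in>carrier G. ?t x g h y) = corner Y g h y"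
        by (subst Y.ab.finsum_only[of _ "g \<otimes>\<^bsub>G\<^esub> inv\<^bsub>G\<^esub> h"]) (auto simp: corner_closed)
    qed (use y gS hT in \<open>auto intro!: Y.ab.finsum_closed corner_closed\<close>)
    finally show "(\<Oplus>\<^bsub>restr Y\<^esub>x\<in>carrier G. ?\<pi> x y) = y"
      using corner_sum[OF g0 h0 y] by (simp add: sum_eq)
  next
    fix x z y assume "y \<in> corner_grading Y (\<kappa> g0) (\<mu> h0) z"
    then have y: "y \<in> carrier Y" and
      y0: "\<And>g h. g \<in> \<kappa> g0 \<Longrightarrow> h \<in> \<mu> h0 \<Longrightarrow> g \<otimes>\<^bsub>G\<^esub> inv\<^bsub>G\<^esub> h \<noteq> z \<Longrightarrow> corner Y g h y = \<zero>\<^bsub>Y\<^esub>"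
      by (auto simp: corner_grading_def)
    show "?\<pi> x y = (if x = z then y else \<zero>\<^bsub>restr Y\<^esub>)"
    proof (cases "x = z")
      case True
      have "?\<pi> x y = (\<Oplus>\<^bsub>Y\<^esub>g\<in>\<kappa> g0. \<Oplus>\<^bsub>Y\<^esub>h\<in>\<mu> h0. corner Y g h y)"
        using True y y0 gS hT
        by (intro Y.ab.finsum_eqI) (auto intro!: Y.ab.finsum_closed corner_closed)
      with True show ?thesis using corner_sum[OF g0 h0 y] by simp
    next
      case False
      have "?\<pi> x y = \<zero>\<^bsub>Y\<^esub>"
        using False y0 by (intro Y.ab.finsum_all_zero) auto
      with False show ?thesis by simp
    qed
  qed
qed

text \<open>Compatibility of degrees is the shift of corners under homogeneous elements; an index
  shifted out of the window belongs to a homogeneous element that is zero. Finite generation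
  survives because the finitely many corners of a generating set generate over C and D.\<close>

lemma graded_bimodule_restr:
  assumes fg: "fg_bimodule K E F Y" and g0: "g0 \<in> carrier G" and h0: "h0 \<in> carrier G"
  shows "graded_bimodule G K C \<C> D \<D> (restr Y) (corner_grading Y (\<kappa> g0) (\<mu> h0))"
proof -
  have gS: "g \<in> carrier G" "\<kappa> g = \<kappa> g0" if "g \<in> \<kappa> g0" for g
    using L.\<kappa>_subset[OF g0] L.\<kappa>_eq[OF g0] that by auto
  have hT: "h \<in> carrier G" "\<mu> h = \<mu> h0" if "h \<in> \<mu> h0" for h
    using R.\<kappa>_subset[OF h0] R.\<kappa>_eq[OF h0] that by auto
  note cl = L.\<epsilon>_closed R.\<epsilon>_closed L.\<alpha>_closed L.coef_carrier R.\<alpha>_closed R.coef_carrier Y.ract_closed Y.lact_closed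
  have fg': "fg_bimodule K C D (restr Y)"
  proof -
    from fg obtain S where S: "finite S" "S \<subseteq> carrier Y"
      and gen: "\<And>W. subbimodule K E F W Y \<Longrightarrow> S \<subseteq> W \<Longrightarrow> W = carrier Y"
      by (auto simp: fg_bimodule_def)
    let ?S = "(\<lambda>(g, h, s). corner Y g h s) ` (carrier G \<times> carrier G \<times> S)"
    have "W = carrier Y" if W: "subbimodule K C D W (restr Y)" and SW: "?S \<subseteq> W" for W
    proof -
      have sub: "subspace K W (restr Y)" using W by (simp add: subbimodule_def)
      have W_sub: "W \<subseteq> carrier Y" and W_zero: "\<zero>\<^bsub>Y\<^esub> \<in> W"
        and W_add: "\<And>v w. v \<in> W \<Longrightarrow> w \<in> W \<Longrightarrow> v \<oplus>\<^bsub>Y\<^esub> w \<in> W"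
        and W_smult: "\<And>k w. k \<in> carrier K \<Longrightarrow> w \<in> W \<Longrightarrow> k \<odot>\<^bsub>Y\<^esub> w \<in> W"
        using subspace_subset[OF sub] subspace_zero[OF sub] subspace_add[OF sub] subspace_smult[OF sub] by auto
      have W_sum: "\<And>f I. (\<And>i :: 'g. i \<in> I \<Longrightarrow> f i \<in> W) \<Longrightarrow> finsum Y f I \<in> W"
        by (intro Y.ab.finsum_mem W_zero W_add W_sub)
      have W_lact: "\<And>c w. c \<in> carrier C \<Longrightarrow> w \<in> W \<Longrightarrow> lact Y (\<alpha> c) w \<in> W"
        and W_ract: "\<And>w d. w \<in> W \<Longrightarrow> d \<in> carrier D \<Longrightarrow> ract Y w (\<beta> d) \<in> W"
        using W by (auto simp: subbimodule_def)
      \<comment> \<open>The elements all of whose corners lie in W. They are stable under E and F,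
        whose effect on corners is given by elements of C and D, and they include the old
        generators, so they are everything.\<close>
      define W' where "W' = {y \<in> carrier Y. \<forall>g\<in>carrier G. \<forall>h\<in>carrier G. corner Y g h y \<in> W}"
      have "subbimodule K E F W' Y"
        unfolding subbimodule_def
      proof (intro conjI ballI subspaceI[OF Y.vs])
        show "a \<in> carrier E \<Longrightarrow> w \<in> W' \<Longrightarrow> lact Y a w \<in> W'" for a w
          by (auto simp: W'_def cl corner_lact intro!: W_sum W_lact)
        show "b \<in> carrier F \<Longrightarrow> w \<in> W' \<Longrightarrow> ract Y w b \<in> W'" for b w
          by (auto simp: W'_def cl corner_ract intro!: W_sum W_ract)
      next
        interpret v: vectorspace K Y by (rule Y.vs)
        show "k \<in> carrier K \<Longrightarrow> w \<in> W' \<Longrightarrow> k \<odot>\<^bsub>Y\<^esub> w \<in> W'" for k w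
          by (auto simp: W'_def corner_smult W_smult)
      qed (auto simp: W'_def corner_zero W_zero additive_map_add[OF corner_additive] W_add)
      moreover have "S \<subseteq> W'"
        using S SW by (auto simp: W'_def image_subset_iff)
      ultimately have "W' = carrier Y" by (rule gen)
      then have all: "corner Y g h y \<in> W" if "y \<in> carrier Y" "g \<in> carrier G" "h \<in> carrier G" for y g h
        using that by (auto simp: W'_def)
      have "y \<in> W" if y: "y \<in> carrier Y" for y
        using gS hT y by (subst corner_sum[OF g0 h0 y, symmetric]) (auto intro!: W_sum all)
      with W_sub show ?thesis by blast
    qed
    moreover have "finite ?S" "?S \<subseteq> carrier Y"
      using S L.fin by (auto intro!: corner_closed)
    ultimately show ?thesis
      by (auto simp: fg_bimodule_def bimodule_restr intro!: exI[of _ ?S])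
  qed
  show ?thesis
    unfolding graded_bimodule_def
  proof (intro conjI ballI fg' grading_restr g0 h0)
    fix x z c y assume x: "x \<in> carrier G" and z: "z \<in> carrier G" and c: "c \<in> \<C> x"
      and y: "y \<in> corner_grading Y (\<kappa> g0) (\<mu> h0) z"
    then have cc: "c \<in> carrier C" and yc: "y \<in> carrier Y"
      using L.sp.homog_carrier by (auto simp: corner_grading_def)
    have "corner Y g h (lact Y (\<alpha> c) y) = \<zero>\<^bsub>Y\<^esub>"
      if g: "g \<in> \<kappa> g0" and h: "h \<in> \<mu> h0" and ne: "g \<otimes>\<^bsub>G\<^esub> inv\<^bsub>G\<^esub> h \<noteq> x \<otimes>\<^bsub>G\<^esub> z" for g h
    proof -
      \<comment> \<open>The corner of c y at g comes from the corner of y at x\<inverse> g.\<close>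
      define k where "k = inv\<^bsub>G\<^esub> x \<otimes>\<^bsub>G\<^esub> g"
      have k: "k \<in> carrier G" and gk: "g = x \<otimes>\<^bsub>G\<^esub> k"
        using x gS[OF g] by (auto simp: k_def L.sp.grp.mult_cancel_inv)
      have eq: "corner Y g h (lact Y (\<alpha> c) y) = lact Y (\<alpha> c) (corner Y k h y)"
        unfolding gk by (rule corner_lact_homog) (use x k c yc hT[OF h] in auto)
      show ?thesis
      proof (cases "k \<in> \<kappa> g0")
        case True
        have "k \<otimes>\<^bsub>G\<^esub> inv\<^bsub>G\<^esub> h \<noteq> z"
          using ne gk x k z hT[OF h] by (auto simp: L.sp.grp.m_assoc)
        with y True h have "corner Y k h y = \<zero>\<^bsub>Y\<^esub>" by (auto simp: corner_grading_def)
        with eq show ?thesis using cc by (simp add: Y.lact_zero cl)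
      next
        case False
        \<comment> \<open>Here k and x k lie in different classes, which forces c = 0.\<close>
        with gS[OF g] gk have "k \<notin> \<kappa> (x \<otimes>\<^bsub>G\<^esub> k)" by auto
        from L.homog_zero[OF x k c this] have "\<alpha> c = \<zero>\<^bsub>E\<^esub>"
          using additive_map_zero[OF L.rg.abelian_group_axioms L.Erg.abelian_group_axioms, of \<alpha>]
          by (auto simp: additive_map_def L.\<alpha>_closed L.\<alpha>_add)
        with eq show ?thesis using k yc hT[OF h] by (simp add: Y.lact_zero_left corner_closed)
      qed
    qed
    then show "lact (restr Y) c y \<in> corner_grading Y (\<kappa> g0) (\<mu> h0) (x \<otimes>\<^bsub>G\<^esub> z)"
      using cc yc by (auto simp: corner_grading_def cl)
  next
    fix z x y d assume x: "x \<in> carrier G" and z: "z \<in> carrier G" and d: "d \<in> \<D> x"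
      and y: "y \<in> corner_grading Y (\<kappa> g0) (\<mu> h0) z"
    then have dc: "d \<in> carrier D" and yc: "y \<in> carrier Y"
      using R.sp.homog_carrier by (auto simp: corner_grading_def)
    have "corner Y g h (ract Y y (\<beta> d)) = \<zero>\<^bsub>Y\<^esub>"
      if g: "g \<in> \<kappa> g0" and h: "h \<in> \<mu> h0" and ne: "g \<otimes>\<^bsub>G\<^esub> inv\<^bsub>G\<^esub> h \<noteq> z \<otimes>\<^bsub>G\<^esub> x" for g h
    proof -
      have eq: "corner Y g h (ract Y y (\<beta> d)) = ract Y (corner Y g (x \<otimes>\<^bsub>G\<^esub> h) y) (\<beta> d)"
        by (rule corner_ract_homog) (use x d yc gS[OF g] hT[OF h] in auto)
      show ?thesis
      proof (cases "x \<otimes>\<^bsub>G\<^esub> h \<in> \<mu> h0")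
        case True
        have "g \<otimes>\<^bsub>G\<^esub> inv\<^bsub>G\<^esub> (x \<otimes>\<^bsub>G\<^esub> h) \<noteq> z"
        proof
          assume "g \<otimes>\<^bsub>G\<^esub> inv\<^bsub>G\<^esub> (x \<otimes>\<^bsub>G\<^esub> h) = z"
          then have "z \<otimes>\<^bsub>G\<^esub> x = g \<otimes>\<^bsub>G\<^esub> inv\<^bsub>G\<^esub> h"
            using x gS[OF g] hT[OF h] by (auto simp: L.sp.grp.inv_mult_group L.sp.grp.m_assoc)
          with ne show False by simp
        qed
        with y True g have "corner Y g (x \<otimes>\<^bsub>G\<^esub> h) y = \<zero>\<^bsub>Y\<^esub>" by (auto simp: corner_grading_def)
        with eq show ?thesis using dc by (simp add: Y.ract_zero cl)
      next
        case False
        have "h \<notin> \<mu> (x \<otimes>\<^bsub>G\<^esub> h)"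
        proof
          assume "h \<in> \<mu> (x \<otimes>\<^bsub>G\<^esub> h)"
          then have "\<mu> h = \<mu> (x \<otimes>\<^bsub>G\<^esub> h)" using x hT[OF h] by (intro R.\<kappa>_eq) auto
          then show False using False R.\<kappa>_refl[of "x \<otimes>\<^bsub>G\<^esub> h"] x hT[OF h] by auto
        qed
        from R.homog_zero[OF x _ d this] hT[OF h] have "\<beta> d = \<zero>\<^bsub>F\<^esub>"
          using additive_map_zero[OF R.rg.abelian_group_axioms R.Erg.abelian_group_axioms, of \<beta>]
          by (auto simp: additive_map_def R.\<alpha>_closed R.\<alpha>_add)
        with eq show ?thesis using x yc gS[OF g] hT[OF h] by (simp add: Y.ract_zero_right corner_closed)
      qed
    qed
    then show "ract (restr Y) y d \<in> corner_grading Y (\<kappa> g0) (\<mu> h0) (z \<otimes>\<^bsub>G\<^esub> x)"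
      using dc yc by (auto simp: corner_grading_def cl)
  qed
qed

end

section \<open>Lifting problems under restriction of scalars\<close>

context two_sides
begin

lemma hom_corner:
  assumes "e \<in> bimodule_hom K E F X Y" "bimodule K E F X" "g \<in> carrier G" "h \<in> carrier G" "x \<in> carrier X"
  shows "e (corner X g h x) = corner Y g h (e x)"
proof -
  interpret X: bimodule K E F X by fact
  show ?thesis
    using assms by (simp add: corner_def bimodule_homD X.ract_closed L.\<epsilon>_closed R.\<epsilon>_closed)
qed

text \<open>Homomorphisms commute with the idempotents, hence preserve the vanishing of corners by
  which degrees are defined.\<close>

lemma graded_hom_restr:
  assumes e: "e \<in> bimodule_hom K E F X Y" and X: "bimodule K E F X" and Y: "bimodule K E F Y"
    and S: "S \<subseteq> carrier G" and T: "T \<subseteq> carrier G"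
  shows "e \<in> graded_hom G K C D (restr X) (corner_grading X S T) (restr Y) (corner_grading Y S T)"
proof -
  have "e \<zero>\<^bsub>X\<^esub> = \<zero>\<^bsub>Y\<^esub>"
    by (intro additive_map_zero bimodule_hom_additive[OF e] vectorspace_abelian_group[OF bimodule.vs]) (fact X Y)+
  then have "e x \<in> corner_grading Y S T z" if "x \<in> corner_grading X S T z" for x z
    using that S T bimodule_hom_closed[OF e]
    by (auto simp: corner_grading_def hom_corner[OF e X, symmetric] subset_iff)
  moreover have "e \<in> bimodule_hom K C D (restr X) (restr Y)"
    by (rule bimodule_homI) (auto simp: bimodule_homD[OF e] L.\<alpha>_closed R.\<alpha>_closed)
  ultimately show ?thesis by (auto simp: graded_hom_def)
qed

end

lemma (in graded_space) matrix_finsum_entry: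
  fixes N :: "('k, 'g \<times> 'g \<Rightarrow> 'm, 's) module_scheme"
  assumes N: "carrier N = matrices G \<G>"
      "zero N = (\<lambda>p\<in>carrier G \<times> carrier G. \<zero>\<^bsub>M\<^esub>)"
      "add N = (\<lambda>a b. \<lambda>p\<in>carrier G \<times> carrier G. a p \<oplus>\<^bsub>M\<^esub> b p)"
      "smult N = (\<lambda>k a. \<lambda>p\<in>carrier G \<times> carrier G. k \<odot>\<^bsub>M\<^esub> a p)"
    and f: "\<And>i. i \<in> I \<Longrightarrow> f i \<in> matrices G \<G>" and gh: "g \<in> carrier G" "h \<in> carrier G"
  shows "finsum N f I (g, h) = finsum M (\<lambda>i. f i (g, h)) I"
proof -
  have "abelian_group N" by (rule vectorspace_abelian_group[OF matrix_vectorspace[OF N]])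
  moreover have "additive_map N M (\<lambda>a. a (g, h))"
    using gh by (intro additive_mapI) (auto simp: N matrices_carrier)
  ultimately have "(\<lambda>a. a (g, h)) (finsum N f I) = finsum M (\<lambda>i. (\<lambda>a. a (g, h)) (f i)) I"
    by (rule additive_map_finsum[OF _ ab.abelian_group_axioms]) (simp add: N f)
  then show ?thesis .
qed

text \<open>P' may be \<open>bar P\<close>, or the left or right module underlying a matrix
  bimodule. Common to these cases is that E and F act on matrices through their coefficient
  matrices; for K these are the scalar matrices.\<close>

locale transfer =
  two_sides G K C \<C> E \<alpha> \<epsilon> \<kappa> coef D \<D> F \<beta> \<eta> \<mu> coef' +
  P: graded_bimod G K C \<C> D \<D> P \<P> + P': bimodule K E F P'
  for G :: "('g, 'p) monoid_scheme" and K :: "('k, 'q) ring_scheme"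
    and C :: "('k, 'c) module" and \<C> and E :: "('k, 'e) module" and \<alpha> \<epsilon> \<kappa> coef
    and D :: "('k, 'd) module" and \<D> and F :: "('k, 'f) module" and \<beta> \<eta> \<mu> coef'
    and P :: "('k, 'c, 'd, 'm) bimodule" and \<P>
    and P' :: "('k, 'e, 'f, 'g \<times> 'g \<Rightarrow> 'm) bimodule" +
  assumes P'_structure: "carrier P' = matrices G \<P>"
      "zero P' = (\<lambda>p\<in>carrier G \<times> carrier G. \<zero>\<^bsub>P\<^esub>)"
      "add P' = (\<lambda>a b. \<lambda>p\<in>carrier G \<times> carrier G. a p \<oplus>\<^bsub>P\<^esub> b p)"
      "smult P' = (\<lambda>k a. \<lambda>p\<in>carrier G \<times> carrier G. k \<odot>\<^bsub>P\<^esub> a p)"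
    and P'_lact: "a \<in> carrier E \<Longrightarrow> p \<in> matrices G \<P> \<Longrightarrow> lact P' a p = mmul G P (lact P) (coef a) p"
    and P'_ract: "p \<in> matrices G \<P> \<Longrightarrow> b \<in> carrier F \<Longrightarrow> ract P' p b = mmul G P (ract P) p (coef' b)"
begin

sublocale rP': restricted G K C \<C> E \<alpha> \<epsilon> \<kappa> coef D \<D> F \<beta> \<eta> \<mu> coef' P'
  by (intro restricted.intro two_sides_axioms P'.bimodule_axioms)

text \<open>With \<open>S = \<kappa> g\<close> and \<open>T = \<mu> h\<close>, composition with \<open>block S T\<close> turns homomorphisms out of \<open>P'\<close> into
  homomorphisms out of \<open>P\<close>: it is the unit of the adjunction.\<close>

definition block :: "'g set \<Rightarrow> 'g set \<Rightarrow> 'm \<Rightarrow> 'g \<times> 'g \<Rightarrow> 'm"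
  where "block S T m = (\<lambda>(g, h)\<in>carrier G \<times> carrier G.
    if g \<in> S \<and> h \<in> T then hcomp G P \<P> (g \<otimes>\<^bsub>G\<^esub> inv\<^bsub>G\<^esub> h) m else \<zero>\<^bsub>P\<^esub>)"

lemma block_entry: "g \<in> carrier G \<Longrightarrow> h \<in> carrier G \<Longrightarrow> block S T m (g, h) =
    (if g \<in> S \<and> h \<in> T then hcomp G P \<P> (g \<otimes>\<^bsub>G\<^esub> inv\<^bsub>G\<^esub> h) m else \<zero>\<^bsub>P\<^esub>)"
  by (simp add: block_def)

lemma block_extensional: "block S T m \<in> extensional (carrier G \<times> carrier G)"
  by (simp add: block_def)

lemma block_closed: "m \<in> carrier P \<Longrightarrow> block S T m \<in> matrices G \<P>"
  by (intro matricesI block_extensional)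
    (auto simp: block_entry P.sp.hcomp_in subspace_zero[OF P.sp.homog_subspace])

lemma block_add: "m \<in> carrier P \<Longrightarrow> n \<in> carrier P \<Longrightarrow>
    block S T (m \<oplus>\<^bsub>P\<^esub> n) = block S T m \<oplus>\<^bsub>P'\<^esub> block S T n"
  unfolding P'_structure
  by (rule matrix_ext[OF block_extensional]) (auto simp: block_entry P.sp.hcomp_add)

lemma block_smult: "k \<in> carrier K \<Longrightarrow> m \<in> carrier P \<Longrightarrow>
    block S T (k \<odot>\<^bsub>P\<^esub> m) = k \<odot>\<^bsub>P'\<^esub> block S T m"
  unfolding P'_structure
  by (rule matrix_ext[OF block_extensional]) (auto simp: block_entry P.sp.hcomp_smult P.sp.md.smult_r_null)

text \<open>Coefficients of \<open>\<alpha> c\<close> between an index in \<open>\<kappa> g0\<close>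
  and one outside it are zero, so cutting a matrix down to the rows in \<open>\<kappa> g0\<close>
  commutes with the action. Inside the block it is the row-by-column formula for the components of c
  m.\<close>

lemma block_lact:
  assumes g0: "g0 \<in> carrier G" and c: "c \<in> carrier C" and m: "m \<in> carrier P"
  shows "block (\<kappa> g0) T (lact P c m) = lact P' (\<alpha> c) (block (\<kappa> g0) T m)"
proof -
  note cl = L.\<alpha>_closed P.sp.hcomp_carrier L.sp.hcomp_carrier P.lact_closed P.lact_zero L.coef_carrier
  have gS: "g \<in> \<kappa> g0 \<Longrightarrow> \<kappa> g = \<kappa> g0" for g
    using L.\<kappa>_eq[OF g0] by auto
  have outside: "coef (\<alpha> c) (g, h) = \<zero>\<^bsub>C\<^esub>"
    if "g \<in> carrier G" "h \<in> carrier G" "g \<in> \<kappa> g0 \<longleftrightarrow> h \<notin> \<kappa> g0" for g h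
  proof (rule L.coef_zero[OF L.\<alpha>_closed[OF c] that(1,2)])
    show "h \<notin> \<kappa> g"
      using that gS L.\<kappa>_refl L.\<kappa>_eq by metis
  qed
  have "block (\<kappa> g0) T (lact P c m) = mmul G P (lact P) (coef (\<alpha> c)) (block (\<kappa> g0) T m)"
  proof (rule matrix_ext[OF block_extensional mmul_extensional])
    fix g l assume gl: "g \<in> carrier G" "l \<in> carrier G"
    show "block (\<kappa> g0) T (lact P c m) (g, l) = mmul G P (lact P) (coef (\<alpha> c)) (block (\<kappa> g0) T m) (g, l)"
    proof (cases "g \<in> \<kappa> g0 \<and> l \<in> T")
      case True
      have eq: "lact P (coef (\<alpha> c) (g, h)) (block (\<kappa> g0) T m (h, l)) =
          lact P (hcomp G C \<C> (g \<otimes>\<^bsub>G\<^esub> inv\<^bsub>G\<^esub> h) c) (hcomp G P \<P> (h \<otimes>\<^bsub>G\<^esub> inv\<^bsub>G\<^esub> l) m)"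
        if h: "h \<in> carrier G" for h
      proof (cases "h \<in> \<kappa> g0")
        case inT: True
        with True h gl c show ?thesis by (simp add: block_entry L.coef_\<alpha>)
      next
        case False
        \<comment> \<open>For h outside the class the block entry has been cut away, but the
          component of c at this position is zero as well.\<close>
        with outside[of g h] True gl h c have "hcomp G C \<C> (g \<otimes>\<^bsub>G\<^esub> inv\<^bsub>G\<^esub> h) c = \<zero>\<^bsub>C\<^esub>"
          using L.coef_\<alpha>[OF c gl(1) h] by simp
        with gl h c m show ?thesis
          by (simp add: L.coef_\<alpha> P.lact_zero_left cl block_entry)
      qed
      have "block (\<kappa> g0) T (lact P c m) (g, l) = hcomp G P \<P> (g \<otimes>\<^bsub>G\<^esub> inv\<^bsub>G\<^esub> l) (lact P c m)"
        using True gl by (simp add: block_entry)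
      also have "\<dots> = (\<Oplus>\<^bsub>P\<^esub>h\<in>carrier G. lact P (hcomp G C \<C> (g \<otimes>\<^bsub>G\<^esub> inv\<^bsub>G\<^esub> h) c) (hcomp G P \<P> (h \<otimes>\<^bsub>G\<^esub> inv\<^bsub>G\<^esub> l) m))"
        by (rule P.L.hcomp_pairing[OF c m gl])
      also have "\<dots> = mmul G P (lact P) (coef (\<alpha> c)) (block (\<kappa> g0) T m) (g, l)"
        using gl c m by simp (auto intro!: P.ab.finsum_eqI simp: eq[symmetric] cl block_entry)
      finally show ?thesis .
    next
      case False
      have "lact P (coef (\<alpha> c) (g, h)) (block (\<kappa> g0) T m (h, l)) = \<zero>\<^bsub>P\<^esub>" if h: "h \<in> carrier G" for h
      proof (cases "h \<in> \<kappa> g0 \<and> l \<in> T")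
        case True
        with False outside[of g h] gl h have "coef (\<alpha> c) (g, h) = \<zero>\<^bsub>C\<^esub>" by auto
        with True gl h m show ?thesis by (simp add: block_entry P.lact_zero_left cl)
      next
        case False
        then have "block (\<kappa> g0) T m (h, l) = \<zero>\<^bsub>P\<^esub>" using gl h by (auto simp: block_entry)
        with gl h c show ?thesis by (simp add: cl)
      qed
      then show ?thesis
        using False gl by (auto simp: block_entry P.ab.finsum_all_zero)
    qed
  qed
  then show ?thesis
    using c m by (simp add: P'_lact L.\<alpha>_closed block_closed)
qed

lemma block_ract:
  assumes h0: "h0 \<in> carrier G" and d: "d \<in> carrier D" and m: "m \<in> carrier P"
  shows "block S (\<mu> h0) (ract P m d) = ract P' (block S (\<mu> h0) m) (\<beta> d)"
proof -
  note cl = R.\<alpha>_closed P.sp.hcomp_carrier R.sp.hcomp_carrier P.ract_closed P.ract_zero R.coef_carrier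
  have hT: "h \<in> \<mu> h0 \<Longrightarrow> \<mu> h = \<mu> h0" for h
    using R.\<kappa>_eq[OF h0] by auto
  have outside: "coef' (\<beta> d) (h, l) = \<zero>\<^bsub>D\<^esub>"
    if "h \<in> carrier G" "l \<in> carrier G" "h \<in> \<mu> h0 \<longleftrightarrow> l \<notin> \<mu> h0" for h l
  proof (rule R.coef_zero[OF R.\<alpha>_closed[OF d] that(1,2)])
    show "l \<notin> \<mu> h"
      using that hT R.\<kappa>_refl R.\<kappa>_eq by metis
  qed
  have "block S (\<mu> h0) (ract P m d) = mmul G P (ract P) (block S (\<mu> h0) m) (coef' (\<beta> d))"
  proof (rule matrix_ext[OF block_extensional mmul_extensional])
    fix g l assume gl: "g \<in> carrier G" "l \<in> carrier G"
    show "block S (\<mu> h0) (ract P m d) (g, l) = mmul G P (ract P) (block S (\<mu> h0) m) (coef' (\<beta> d)) (g, l)"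
    proof (cases "g \<in> S \<and> l \<in> \<mu> h0")
      case True
      have eq: "ract P (block S (\<mu> h0) m (g, h)) (coef' (\<beta> d) (h, l)) =
          ract P (hcomp G P \<P> (g \<otimes>\<^bsub>G\<^esub> inv\<^bsub>G\<^esub> h) m) (hcomp G D \<D> (h \<otimes>\<^bsub>G\<^esub> inv\<^bsub>G\<^esub> l) d)"
        if h: "h \<in> carrier G" for h
      proof (cases "h \<in> \<mu> h0")
        case inT: True
        with True h gl d show ?thesis by (simp add: block_entry R.coef_\<alpha>)
      next
        case False
        with outside[of h l] True gl h d have "hcomp G D \<D> (h \<otimes>\<^bsub>G\<^esub> inv\<^bsub>G\<^esub> l) d = \<zero>\<^bsub>D\<^esub>"
          using R.coef_\<alpha>[OF d h gl(2)] by simp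
        with gl h d m show ?thesis
          by (simp add: R.coef_\<alpha> P.ract_zero_right cl block_entry)
      qed
      have "block S (\<mu> h0) (ract P m d) (g, l) = hcomp G P \<P> (g \<otimes>\<^bsub>G\<^esub> inv\<^bsub>G\<^esub> l) (ract P m d)"
        using True gl by (simp add: block_entry)
      also have "\<dots> = (\<Oplus>\<^bsub>P\<^esub>h\<in>carrier G. ract P (hcomp G P \<P> (g \<otimes>\<^bsub>G\<^esub> inv\<^bsub>G\<^esub> h) m) (hcomp G D \<D> (h \<otimes>\<^bsub>G\<^esub> inv\<^bsub>G\<^esub> l) d))"
        by (rule P.R.hcomp_pairing[OF m d gl])
      also have "\<dots> = mmul G P (ract P) (block S (\<mu> h0) m) (coef' (\<beta> d)) (g, l)"
        using gl d m by simp (auto intro!: P.ab.finsum_eqI simp: eq[symmetric] cl block_entry)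
      finally show ?thesis .
    next
      case False
      have "ract P (block S (\<mu> h0) m (g, h)) (coef' (\<beta> d) (h, l)) = \<zero>\<^bsub>P\<^esub>" if h: "h \<in> carrier G" for h
      proof (cases "g \<in> S \<and> h \<in> \<mu> h0")
        case True
        with False outside[of h l] gl h have "coef' (\<beta> d) (h, l) = \<zero>\<^bsub>D\<^esub>" by auto
        with True gl h m show ?thesis by (simp add: block_entry P.ract_zero_right cl)
      next
        case False
        then have "block S (\<mu> h0) m (g, h) = \<zero>\<^bsub>P\<^esub>" using gl h by (auto simp: block_entry)
        with gl h d show ?thesis by (simp add: cl)
      qed
      then show ?thesis
        using False gl by (auto simp: block_entry P.ab.finsum_all_zero)
    qed
  qed
  then show ?thesis
    using d m by (simp add: P'_ract R.\<alpha>_closed block_closed)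
qed

text \<open>A corner of a block is a single entry. The idempotents are applied one after the other:
  the right one leaves column h, the left one only row g of that column.\<close>

lemma corner_block:
  assumes gh: "g \<in> carrier G" "h \<in> carrier G" and m: "m \<in> carrier P"
  shows "corner P' g h (block (\<kappa> g) (\<mu> h) m) = (\<lambda>(g', h')\<in>carrier G \<times> carrier G.
    if g' = g \<and> h' = h then hcomp G P \<P> (g \<otimes>\<^bsub>G\<^esub> inv\<^bsub>G\<^esub> h) m else \<zero>\<^bsub>P\<^esub>)"
proof -
  note cl = P.sp.hcomp_carrier P.ract_closed P.lact_closed L.\<epsilon>_closed R.\<epsilon>_closed R.coef_carrier
    L.coef_carrier
  define v where "v = ract P' (block (\<kappa> g) (\<mu> h) m) (\<eta> h)"
  have v_cl: "v \<in> matrices G \<P>"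
    using P'.ract_closed[of "block (\<kappa> g) (\<mu> h) m" "\<eta> h"] gh m
    by (simp add: v_def P'_structure block_closed R.\<epsilon>_closed)
  have v: "v (s, l) = (if l = h \<and> s \<in> \<kappa> g then hcomp G P \<P> (s \<otimes>\<^bsub>G\<^esub> inv\<^bsub>G\<^esub> h) m else \<zero>\<^bsub>P\<^esub>)"
    if sl: "s \<in> carrier G" "l \<in> carrier G" for s l
  proof -
    have "v (s, l) = (\<Oplus>\<^bsub>P\<^esub>t\<in>carrier G. ract P (block (\<kappa> g) (\<mu> h) m (s, t)) (coef' (\<eta> h) (t, l)))"
      using sl gh m by (simp add: v_def P'_ract block_closed R.\<epsilon>_closed)
    also have "\<dots> = ract P (block (\<kappa> g) (\<mu> h) m (s, h)) (coef' (\<eta> h) (h, l))"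
    proof (rule P.ab.finsum_only[OF L.fin gh(2)])
      \<comment> \<open>The coefficients of an idempotent are prescribed only at positions meeting
        its class; for t outside the class the block entry is zero instead.\<close>
      show "ract P (block (\<kappa> g) (\<mu> h) m (s, t)) (coef' (\<eta> h) (t, l)) = \<zero>\<^bsub>P\<^esub>"
        if t: "t \<in> carrier G" "t \<noteq> h" for t
      proof (cases "t \<in> \<mu> h")
        case True
        with t sl gh m show ?thesis by (simp add: R.coef_\<epsilon> P.ract_zero_right block_entry cl)
      next
        case False
        with t sl gh m show ?thesis by (simp add: block_entry P.ract_zero cl)
      qed
    qed (use sl gh m in \<open>auto simp: block_entry cl\<close>)
    also have "\<dots> = (if l = h \<and> s \<in> \<kappa> g then hcomp G P \<P> (s \<otimes>\<^bsub>G\<^esub> inv\<^bsub>G\<^esub> h) m else \<zero>\<^bsub>P\<^esub>)"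
      using sl gh m by (simp add: block_entry R.coef_\<epsilon> R.\<kappa>_refl P.ract_zero_right P.ract_one cl)
    finally show ?thesis .
  qed
  have "corner P' g h (block (\<kappa> g) (\<mu> h) m) = mmul G P (lact P) (coef (\<epsilon> g)) v"
    using gh by (simp add: corner_def v_def[symmetric] P'_lact v_cl L.\<epsilon>_closed)
  also have "\<dots> = (\<lambda>(g', h')\<in>carrier G \<times> carrier G.
    if g' = g \<and> h' = h then hcomp G P \<P> (g \<otimes>\<^bsub>G\<^esub> inv\<^bsub>G\<^esub> h) m else \<zero>\<^bsub>P\<^esub>)"
  proof (rule matrix_ext[OF mmul_extensional])
    fix g' l assume gl: "g' \<in> carrier G" "l \<in> carrier G"
    have "mmul G P (lact P) (coef (\<epsilon> g)) v (g', l) = lact P (coef (\<epsilon> g) (g', g)) (v (g, l))"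
      unfolding mmul_entry[OF gl]
    proof (rule P.ab.finsum_only[OF L.fin gh(1)])
      show "lact P (coef (\<epsilon> g) (g', s)) (v (s, l)) = \<zero>\<^bsub>P\<^esub>"
        if s: "s \<in> carrier G" "s \<noteq> g" for s
      proof (cases "s \<in> \<kappa> g")
        case True
        with s gl gh m show ?thesis by (simp add: L.coef_\<epsilon> P.lact_zero_left v cl)
      next
        case False
        with s gl gh m show ?thesis by (simp add: v P.lact_zero cl)
      qed
    qed (use gl gh m in \<open>auto simp: v cl\<close>)
    then show "mmul G P (lact P) (coef (\<epsilon> g)) v (g', l) = (\<lambda>(g', h')\<in>carrier G \<times> carrier G.
        if g' = g \<and> h' = h then hcomp G P \<P> (g \<otimes>\<^bsub>G\<^esub> inv\<^bsub>G\<^esub> h) m else \<zero>\<^bsub>P\<^esub>) (g', l)"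
      using gl gh m by (simp add: v L.coef_\<epsilon> L.\<kappa>_refl P.lact_zero_left P.lact_one cl)
  qed simp
  finally show ?thesis .
qed

text \<open>A matrix is the sum of its single entries, and each of these is a corner of a block. So
  blocks generate P' over E and F, and a homomorphism out of P' is determined by its composites with
  the maps \<open>block\<close>.\<close>

lemma corner_expansion:
  assumes p: "p \<in> matrices G \<P>"
  shows "p = (\<Oplus>\<^bsub>P'\<^esub>g\<in>carrier G. \<Oplus>\<^bsub>P'\<^esub>l\<in>carrier G. corner P' g l (block (\<kappa> g) (\<mu> l) (p (g, l))))"
    (is "p = ?s")
proof -
  have pc: "p (g, l) \<in> carrier P" if "g \<in> carrier G" "l \<in> carrier G" for g l
    using P.sp.matrices_carrier[OF p] that .
  have c: "corner P' g l (block (\<kappa> g) (\<mu> l) (p (g, l))) \<in> matrices G \<P>"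
    if "g \<in> carrier G" "l \<in> carrier G" for g l
    using rP'.corner_closed[of g l] that pc block_closed by (simp add: P'_structure)
  have i: "(\<Oplus>\<^bsub>P'\<^esub>l\<in>carrier G. corner P' g l (block (\<kappa> g) (\<mu> l) (p (g, l)))) \<in> matrices G \<P>"
    if "g \<in> carrier G" for g
    using that c P'.ab.finsum_closed[of _ "carrier G"] by (simp add: P'_structure)
  have s: "?s \<in> matrices G \<P>"
    using i P'.ab.finsum_closed[of _ "carrier G"] by (simp add: P'_structure)
  show ?thesis
  proof (rule matrix_ext[OF matrices_extensional[OF p] matrices_extensional[OF s]])
    fix g' h' assume g'h': "g' \<in> carrier G" "h' \<in> carrier G"
    have "?s (g', h') = (\<Oplus>\<^bsub>P\<^esub>g\<in>carrier G. \<Oplus>\<^bsub>P\<^esub>l\<in>carrier G.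
        corner P' g l (block (\<kappa> g) (\<mu> l) (p (g, l))) (g', h'))"
      using g'h' c i
      by (subst P.sp.matrix_finsum_entry[OF P'_structure])
        (auto simp: P.sp.matrix_finsum_entry[OF P'_structure] P.sp.matrices_carrier
          intro!: P.ab.finsum_eqI P.ab.finsum_closed)
    also have "\<dots> = (\<Oplus>\<^bsub>P\<^esub>g\<in>carrier G. \<Oplus>\<^bsub>P\<^esub>l\<in>carrier G. if g' = g \<and> h' = l then p (g, l) else \<zero>\<^bsub>P\<^esub>)"
      using g'h' pc
      by (intro P.ab.finsum_eqI) (auto simp: corner_block P.sp.hcomp_entry[OF p] intro!: P.ab.finsum_closed)
    also have "\<dots> = (\<Oplus>\<^bsub>P\<^esub>l\<in>carrier G. if h' = l then p (g', l) else \<zero>\<^bsub>P\<^esub>)"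
      using g'h' pc L.fin
      by (subst P.ab.finsum_only[of _ g']) (auto intro!: P.ab.finsum_closed P.ab.finsum_all_zero)
    also have "\<dots> = p (g', h')"
      using g'h' pc L.fin by (subst P.ab.finsum_only[of _ h']) auto
    finally show "p (g', h') = ?s (g', h')" by simp
  qed
qed

text \<open>If a subbimodule W contains the blocks of a generating set, the elements of P with block
  in W form a subbimodule, because \<open>block\<close> is compatible with the actions of C and D.
  Hence all blocks lie in W, and with their corners all of P'.\<close>

lemma fg_transfer:
  assumes "fg_bimodule K C D P"
  shows "fg_bimodule K E F P'"
proof -
  obtain S where S: "finite S" "S \<subseteq> carrier P"
    and gen: "\<And>W. subbimodule K C D W P \<Longrightarrow> S \<subseteq> W \<Longrightarrow> W = carrier P"
    using assms by (auto simp: fg_bimodule_def)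
  let ?S = "(\<lambda>(g, h, s). block (\<kappa> g) (\<mu> h) s) ` (carrier G \<times> carrier G \<times> S)"
  have "W = carrier P'" if W: "subbimodule K E F W P'" and SW: "?S \<subseteq> W" for W
  proof -
    have sub: "subspace K W P'" using W by (simp add: subbimodule_def)
    have W_sum: "\<And>f I. (\<And>i :: 'g. i \<in> I \<Longrightarrow> f i \<in> W) \<Longrightarrow> finsum P' f I \<in> W"
      by (rule subspace_finsum[OF sub])
    have W_lact: "\<And>c w. c \<in> carrier E \<Longrightarrow> w \<in> W \<Longrightarrow> lact P' c w \<in> W"
      and W_ract: "\<And>w d. w \<in> W \<Longrightarrow> d \<in> carrier F \<Longrightarrow> ract P' w d \<in> W"
      using W by (auto simp: subbimodule_def)
    have all: "block (\<kappa> g) (\<mu> h) m \<in> W" if m: "m \<in> carrier P" and gh: "g \<in> carrier G" "h \<in> carrier G" for m g h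
    proof -
      define W' where "W' = {m \<in> carrier P. block (\<kappa> g) (\<mu> h) m \<in> W}"
      have "block (\<kappa> g) (\<mu> h) \<zero>\<^bsub>P\<^esub> = \<zero>\<^bsub>P'\<^esub>"
        by (rule additive_map_zero[OF P.ab.abelian_group_axioms P'.ab.abelian_group_axioms])
          (auto intro!: additive_mapI block_add simp: P'_structure block_closed)
      then have "subbimodule K C D W' P"
        unfolding subbimodule_def
        by (intro conjI ballI subspaceI[OF P.vs])
          (auto simp: W'_def block_lact block_ract gh block_add block_smult subspace_add[OF sub]
            subspace_smult[OF sub] subspace_zero[OF sub] P.lact_closed P.ract_closed W_lact W_ract
            L.\<alpha>_closed R.\<alpha>_closed)
      moreover have "S \<subseteq> W'"
        using S SW gh by (auto simp: W'_def image_subset_iff)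
      ultimately have "W' = carrier P" by (rule gen)
      with m show ?thesis by (auto simp: W'_def)
    qed
    have "p \<in> W" if "p \<in> carrier P'" for p
    proof -
      have p: "p \<in> matrices G \<P>" using that by (simp add: P'_structure)
      show ?thesis
        by (subst corner_expansion[OF p], unfold corner_def)
          (auto intro!: W_sum W_lact W_ract all L.\<epsilon>_closed R.\<epsilon>_closed P.sp.matrices_carrier[OF p])
    qed
    with subspace_subset[OF sub] show ?thesis by blast
  qed
  moreover have "finite ?S" "?S \<subseteq> carrier P'"
    using S L.fin by (auto simp: P'_structure intro!: block_closed)
  ultimately show ?thesis
    by (auto simp: fg_bimodule_def P'.bimodule_axioms intro!: exI[of _ ?S])
qed

text \<open>A lifting problem for P' becomes one for P by composing with \<open>block\<close> and
  restricting X and Y; e stays surjective. The solutions H are carried back by summing the corners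
  of H at \<open>p (g, l)\<close> over all positions. What remains is that the result commutes with
  all of E and F, while each H is known to commute with C and D.\<close>

lemma projective_transfer:
  assumes proj: "graded_projective G K C \<C> D \<D> P \<P>"
  shows "projective_bimodule K E F P'"
  unfolding projective_bimodule_def
proof (intro conjI allI impI)
  show "fg_bimodule K E F P'"
    using proj by (intro fg_transfer) (simp add: graded_projective_def graded_bimodule_def)
next
  fix X Y :: "('k, 'e, 'f, nat \<Rightarrow> 'k) bimodule" and e f
  assume asm: "fg_bimodule K E F X \<and> fg_bimodule K E F Y \<and> e \<in> bimodule_hom K E F X Y \<and>
    e ` carrier X = carrier Y \<and> f \<in> bimodule_hom K E F P' Y"
  then have X: "bimodule K E F X" and Y: "bimodule K E F Y"
    and fgX: "fg_bimodule K E F X" and fgY: "fg_bimodule K E F Y" and e: "e \<in> bimodule_hom K E F X Y"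
    and surj: "e ` carrier X = carrier Y" and f: "f \<in> bimodule_hom K E F P' Y"
    by (auto simp: fg_bimodule_def)
  interpret X: restricted G K C \<C> E \<alpha> \<epsilon> \<kappa> coef D \<D> F \<beta> \<eta> \<mu> coef' X
    by (intro restricted.intro two_sides_axioms X)
  interpret Y: restricted G K C \<C> E \<alpha> \<epsilon> \<kappa> coef D \<D> F \<beta> \<eta> \<mu> coef' Y
    by (intro restricted.intro two_sides_axioms Y)
  define good where "good S T h \<longleftrightarrow>
    h \<in> graded_hom G K C D P \<P> (restr X) (corner_grading X S T) \<and>
    (\<forall>p\<in>carrier P. e (h p) = f (block S T p))" for S T h
  \<comment> \<open>The choice depends on the classes and not on g and h themselves: indices of one
    class share one lift, and linearity below relies on it. A side with K contributes one choice for
    every index, a matrix algebra a single one.\<close>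
  define H where "H S T = (SOME h. good S T h)" for S T
  have good: "good (\<kappa> g) (\<mu> h) (H (\<kappa> g) (\<mu> h))" if gh: "g \<in> carrier G" "h \<in> carrier G" for g h
  proof -
    let ?S = "\<kappa> g" and ?T = "\<mu> h"
    have "(\<lambda>m. f (block ?S ?T m)) \<in> graded_hom G K C D P \<P> (restr Y) (corner_grading Y ?S ?T)"
      unfolding graded_hom_def
    proof (intro CollectI conjI ballI image_subsetI)
      show "(\<lambda>m. f (block ?S ?T m)) \<in> bimodule_hom K C D P (restr Y)"
        by (rule bimodule_homI)
          (simp_all add: block_add block_smult block_lact block_ract gh block_closed P'_structure(1)
            bimodule_homD[OF f] L.\<alpha>_closed R.\<alpha>_closed)
    next
      fix x m assume x: "x \<in> carrier G" and m: "m \<in> \<P> x"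
      have mc: "m \<in> carrier P" using P.sp.homog_carrier[OF x m] .
      show "f (block ?S ?T m) \<in> corner_grading Y ?S ?T x"
        unfolding corner_grading_def
      proof (intro CollectI conjI ballI impI)
        show "f (block ?S ?T m) \<in> carrier Y"
          using mc by (intro bimodule_hom_closed[OF f]) (simp add: P'_structure block_closed)
        fix g' h' assume g': "g' \<in> \<kappa> g" and h': "h' \<in> \<mu> h" and ne: "g' \<otimes>\<^bsub>G\<^esub> inv\<^bsub>G\<^esub> h' \<noteq> x"
        have G': "g' \<in> carrier G" "h' \<in> carrier G" "\<kappa> g = \<kappa> g'" "\<mu> h = \<mu> h'"
          using g' h' gh L.\<kappa>_subset R.\<kappa>_subset L.\<kappa>_eq[of g g'] R.\<kappa>_eq[of h h'] by auto
        have "corner Y g' h' (f (block ?S ?T m)) = f (corner P' g' h' (block ?S ?T m))"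
          using hom_corner[OF f P'.bimodule_axioms G'(1,2)] mc by (simp add: P'_structure block_closed)
        \<comment> \<open>The corner retains only the component of m in degree g' h'\<inverse>,
          while m has degree x.\<close>
        also have "corner P' g' h' (block ?S ?T m) = \<zero>\<^bsub>P'\<^esub>"
          unfolding G'(3,4) corner_block[OF G'(1,2) mc]
          using P.sp.hcomp_homog[OF m _ x] ne G' by (auto simp: P'_structure fun_eq_iff)
        also have "f \<zero>\<^bsub>P'\<^esub> = \<zero>\<^bsub>Y\<^esub>"
          by (rule additive_map_zero[OF P'.ab.abelian_group_axioms Y.Y.ab.abelian_group_axioms
              bimodule_hom_additive[OF f]])
        finally show "corner Y g' h' (f (block ?S ?T m)) = \<zero>\<^bsub>Y\<^esub>" .
      qed
    qed
    moreover have "e \<in> graded_hom G K C D (restr X) (corner_grading X ?S ?T) (restr Y) (corner_grading Y ?S ?T)"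
      by (intro graded_hom_restr e X Y L.\<kappa>_subset R.\<kappa>_subset gh)
    moreover have "e ` carrier (restr X) = carrier (restr Y)"
      using surj by simp
    ultimately have "\<exists>h. good ?S ?T h"
      using proj X.graded_bimodule_restr[OF fgX gh] Y.graded_bimodule_restr[OF fgY gh]
      unfolding graded_projective_def good_def Bex_def by blast
    then show ?thesis unfolding H_def by (rule someI_ex)
  qed
  have H: "H (\<kappa> g) (\<mu> h) \<in> bimodule_hom K C D P (restr X)"
    and eH: "\<And>p. p \<in> carrier P \<Longrightarrow> e (H (\<kappa> g) (\<mu> h) p) = f (block (\<kappa> g) (\<mu> h) p)"
    if "g \<in> carrier G" "h \<in> carrier G" for g h
    using good[OF that] by (auto simp: good_def graded_hom_def)
  have H_cl: "H (\<kappa> g) (\<mu> h) p \<in> carrier X" if "g \<in> carrier G" "h \<in> carrier G" "p \<in> carrier P" for g h p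
    using bimodule_hom_closed[OF H[OF that(1,2)] that(3)] by simp
  \<comment> \<open>The contribution of the entry at (g, l): it is lifted by the map for the classes
    of g and l and then projected to its own corner.\<close>
  define t where "t g l p = corner X g l (H (\<kappa> g) (\<mu> l) (p (g, l)))" for g l and p :: "'g \<times> 'g \<Rightarrow> 'm"
  define hh where "hh p = (\<Oplus>\<^bsub>X\<^esub>g\<in>carrier G. \<Oplus>\<^bsub>X\<^esub>l\<in>carrier G. t g l p)" for p
  have pc: "p (g, l) \<in> carrier P" if "p \<in> carrier P'" "g \<in> carrier G" "l \<in> carrier G" for p g l
    using that P.sp.matrices_carrier by (simp add: P'_structure)
  have t_cl: "t g l p \<in> carrier X" if "p \<in> carrier P'" "g \<in> carrier G" "l \<in> carrier G" for g l p
    using that by (simp add: t_def X.corner_closed H_cl pc)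
  have hh_cl: "hh p \<in> carrier X" if "p \<in> carrier P'" for p
    using that by (auto simp: hh_def t_cl intro!: X.Y.ab.finsum_closed)
  have t_add: "additive_map P' X (t g l)" if "g \<in> carrier G" "l \<in> carrier G" for g l
  proof (rule additive_mapI)
    fix p p' assume p: "p \<in> carrier P'" "p' \<in> carrier P'"
    then have "t g l (p \<oplus>\<^bsub>P'\<^esub> p') = corner X g l (H (\<kappa> g) (\<mu> l) (p (g, l) \<oplus>\<^bsub>P\<^esub> p' (g, l)))"
      using that by (simp add: t_def P'_structure)
    also have "\<dots> = t g l p \<oplus>\<^bsub>X\<^esub> t g l p'"
      using that p bimodule_hom_add[OF H[OF that]]
      by (simp add: t_def additive_map_add[OF X.corner_additive] H_cl pc)
    finally show "t g l (p \<oplus>\<^bsub>P'\<^esub> p') = t g l p \<oplus>\<^bsub>X\<^esub> t g l p'" .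
  qed (rule t_cl[OF _ that])
  have hh_add: "additive_map P' X hh"
    unfolding hh_def by (intro additive_map_sum X.Y.ab.abelian_group_axioms t_add)
  have smult_additive: "additive_map X X (\<lambda>x. k \<odot>\<^bsub>X\<^esub> x)" if "k \<in> carrier K" for k
  proof -
    interpret v: vectorspace K X by (rule X.Y.vs)
    show ?thesis using that by (intro additive_mapI) (auto simp: v.smult_r_distr)
  qed
  have hh_smult: "hh (k \<odot>\<^bsub>P'\<^esub> p) = k \<odot>\<^bsub>X\<^esub> hh p" if k: "k \<in> carrier K" and p: "p \<in> carrier P'" for k p
  proof -
    note sm = additive_map_finsum[OF X.Y.ab.abelian_group_axioms X.Y.ab.abelian_group_axioms smult_additive[OF k]]
    have t: "t g l (k \<odot>\<^bsub>P'\<^esub> p) = k \<odot>\<^bsub>X\<^esub> t g l p" if "g \<in> carrier G" "l \<in> carrier G" for g l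
      using that p k bimodule_hom_smult[OF H[OF that] k pc[OF p that]]
      by (simp add: t_def P'_structure(4) X.corner_smult H_cl pc)
    have "k \<odot>\<^bsub>X\<^esub> hh p = (\<Oplus>\<^bsub>X\<^esub>g\<in>carrier G. \<Oplus>\<^bsub>X\<^esub>l\<in>carrier G. k \<odot>\<^bsub>X\<^esub> t g l p)"
      unfolding hh_def using p additive_map_closed[OF smult_additive[OF k]]
      by (subst sm) (auto simp: t_cl sm intro!: X.Y.ab.finsum_eqI X.Y.ab.finsum_closed)
    also have "\<dots> = hh (k \<odot>\<^bsub>P'\<^esub> p)"
      unfolding hh_def using p additive_map_closed[OF smult_additive[OF k]]
      by (intro X.Y.ab.finsum_eqI) (auto simp: t t_cl intro!: X.Y.ab.finsum_closed)
    finally show ?thesis by simp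
  qed
  have hh_lact: "hh (lact P' a p) = lact X a (hh p)" if a: "a \<in> carrier E" and p: "p \<in> carrier P'" for a p
  proof -
    note cl = L.\<alpha>_closed L.coef_carrier[OF a] X.Y.lact_closed X.corner_closed H_cl pc[OF p] P.lact_closed t_cl[OF p]
    have t_lact: "t g l (lact P' a p) = (\<Oplus>\<^bsub>X\<^esub>h\<in>carrier G. lact X (\<alpha> (coef a (g, h))) (t h l p))"
      if gl: "g \<in> carrier G" "l \<in> carrier G" for g l
    proof -
      have "t g l (lact P' a p) = corner X g l (H (\<kappa> g) (\<mu> l)
          (\<Oplus>\<^bsub>P\<^esub>h\<in>carrier G. lact P (coef a (g, h)) (p (h, l))))"
        using gl a p by (simp add: t_def P'_lact P'_structure(1))
      also have "\<dots> = (\<Oplus>\<^bsub>X\<^esub>h\<in>carrier G. corner X g l (H (\<kappa> g) (\<mu> l) (lact P (coef a (g, h)) (p (h, l)))))"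
      proof -
        have "additive_map P X (\<lambda>m. corner X g l (H (\<kappa> g) (\<mu> l) m))"
          by (rule additive_map_compose[OF _ X.corner_additive[OF gl]])
            (use bimodule_hom_additive[OF H[OF gl]] in \<open>simp add: additive_map_def\<close>)
        note sum = additive_map_finsum[OF P.ab.abelian_group_axioms X.Y.ab.abelian_group_axioms this]
        show ?thesis by (rule sum) (use gl in \<open>simp add: cl\<close>)
      qed
      also have "\<dots> = (\<Oplus>\<^bsub>X\<^esub>h\<in>carrier G. lact X (\<alpha> (coef a (g, h))) (t h l p))"
      proof (rule X.Y.ab.finsum_eqI)
        fix h assume h: "h \<in> carrier G"
        have "H (\<kappa> g) (\<mu> l) (lact P (coef a (g, h)) (p (h, l))) =
            lact X (\<alpha> (coef a (g, h))) (H (\<kappa> g) (\<mu> l) (p (h, l)))"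
          using bimodule_hom_lact[OF H[OF gl]] gl h by (simp add: cl)
        then have eq: "corner X g l (H (\<kappa> g) (\<mu> l) (lact P (coef a (g, h)) (p (h, l)))) =
            lact X (\<alpha> (coef a (g, h))) (corner X h l (H (\<kappa> g) (\<mu> l) (p (h, l))))"
          using X.corner_lact_homog[OF _ h gl(2) L.coef_homog[OF a gl(1) h], of "H (\<kappa> g) (\<mu> l) (p (h, l))"] gl h
          by (simp add: cl L.sp.grp.mult_inv_cancel)
        \<comment> \<open>The lift used here belongs to the class of g, the one in
          \<open>t h l\<close> to the class of h. They coincide if the classes do; otherwise the
          coefficient at (g, h) is zero.\<close>
        show "corner X g l (H (\<kappa> g) (\<mu> l) (lact P (coef a (g, h)) (p (h, l)))) =
            lact X (\<alpha> (coef a (g, h))) (t h l p)"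
        proof (cases "h \<in> \<kappa> g")
          case True
          then have "\<kappa> h = \<kappa> g" using L.\<kappa>_eq gl by blast
          with eq show ?thesis by (simp add: t_def)
        next
          case False
          then have "coef a (g, h) = \<zero>\<^bsub>C\<^esub>" using L.coef_zero[OF a gl(1) h] by simp
          moreover have "\<alpha> \<zero>\<^bsub>C\<^esub> = \<zero>\<^bsub>E\<^esub>"
            by (rule additive_map_zero[OF L.rg.abelian_group_axioms L.Erg.abelian_group_axioms])
              (auto intro!: additive_mapI simp: L.\<alpha>_closed L.\<alpha>_add)
          ultimately show ?thesis using eq gl h by (simp add: X.Y.lact_zero_left cl)
        qed
      qed (use gl in \<open>auto simp: cl\<close>)
      finally show ?thesis .
    qed
    have "hh (lact P' a p) = (\<Oplus>\<^bsub>X\<^esub>g\<in>carrier G. \<Oplus>\<^bsub>X\<^esub>l\<in>carrier G. \<Oplus>\<^bsub>X\<^esub>h\<in>carrier G.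
        lact X (\<alpha> (coef a (g, h))) (t h l p))"
      unfolding hh_def using t_lact
      by (intro X.Y.ab.finsum_eqI) (auto intro!: X.Y.ab.finsum_closed simp: cl)
    \<comment> \<open>The index g is moved innermost: for fixed h and l the coefficients in column h
      of a then add up to the action of a itself on a corner at (h, l).\<close>
    also have "\<dots> = (\<Oplus>\<^bsub>X\<^esub>g\<in>carrier G. \<Oplus>\<^bsub>X\<^esub>h\<in>carrier G. \<Oplus>\<^bsub>X\<^esub>l\<in>carrier G.
        lact X (\<alpha> (coef a (g, h))) (t h l p))"
      by (intro X.Y.ab.finsum_eqI X.Y.ab.finsum_swap L.fin) (auto intro!: X.Y.ab.finsum_closed simp: cl)
    also have "\<dots> = (\<Oplus>\<^bsub>X\<^esub>h\<in>carrier G. \<Oplus>\<^bsub>X\<^esub>g\<in>carrier G. \<Oplus>\<^bsub>X\<^esub>l\<in>carrier G.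
        lact X (\<alpha> (coef a (g, h))) (t h l p))"
      by (intro X.Y.ab.finsum_swap L.fin) (auto intro!: X.Y.ab.finsum_closed simp: cl)
    also have "\<dots> = (\<Oplus>\<^bsub>X\<^esub>h\<in>carrier G. \<Oplus>\<^bsub>X\<^esub>l\<in>carrier G. \<Oplus>\<^bsub>X\<^esub>g\<in>carrier G.
        lact X (\<alpha> (coef a (g, h))) (t h l p))"
      by (intro X.Y.ab.finsum_eqI X.Y.ab.finsum_swap L.fin) (auto intro!: X.Y.ab.finsum_closed simp: cl)
    also have "\<dots> = (\<Oplus>\<^bsub>X\<^esub>h\<in>carrier G. \<Oplus>\<^bsub>X\<^esub>l\<in>carrier G. lact X a (t h l p))"
      using X.lact_corner[OF a]
      by (intro X.Y.ab.finsum_eqI) (auto intro!: X.Y.ab.finsum_closed simp: cl a t_def)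
    also have "\<dots> = lact X a (hh p)"
      unfolding hh_def
      by (subst X.Y.lact_finsum[OF a])
        (auto intro!: X.Y.ab.finsum_closed X.Y.ab.finsum_eqI simp: cl X.Y.lact_finsum[OF a] a)
    finally show ?thesis .
  qed
  have hh_ract: "hh (ract P' p b) = ract X (hh p) b" if b: "b \<in> carrier F" and p: "p \<in> carrier P'" for b p
  proof -
    note cl = R.\<alpha>_closed R.coef_carrier[OF b] X.Y.ract_closed X.corner_closed H_cl pc[OF p] P.ract_closed t_cl[OF p]
    have t_ract: "t g l (ract P' p b) = (\<Oplus>\<^bsub>X\<^esub>h\<in>carrier G. ract X (t g h p) (\<beta> (coef' b (h, l))))"
      if gl: "g \<in> carrier G" "l \<in> carrier G" for g l
    proof -
      have "t g l (ract P' p b) = corner X g l (H (\<kappa> g) (\<mu> l)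
          (\<Oplus>\<^bsub>P\<^esub>h\<in>carrier G. ract P (p (g, h)) (coef' b (h, l))))"
        using gl b p by (simp add: t_def P'_ract P'_structure(1))
      also have "\<dots> = (\<Oplus>\<^bsub>X\<^esub>h\<in>carrier G. corner X g l (H (\<kappa> g) (\<mu> l) (ract P (p (g, h)) (coef' b (h, l)))))"
      proof -
        have "additive_map P X (\<lambda>m. corner X g l (H (\<kappa> g) (\<mu> l) m))"
          by (rule additive_map_compose[OF _ X.corner_additive[OF gl]])
            (use bimodule_hom_additive[OF H[OF gl]] in \<open>simp add: additive_map_def\<close>)
        note sum = additive_map_finsum[OF P.ab.abelian_group_axioms X.Y.ab.abelian_group_axioms this]
        show ?thesis by (rule sum) (use gl in \<open>simp add: cl\<close>)
      qed
      also have "\<dots> = (\<Oplus>\<^bsub>X\<^esub>h\<in>carrier G. ract X (t g h p) (\<beta> (coef' b (h, l))))"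
      proof (rule X.Y.ab.finsum_eqI)
        fix h assume h: "h \<in> carrier G"
        have "H (\<kappa> g) (\<mu> l) (ract P (p (g, h)) (coef' b (h, l))) =
            ract X (H (\<kappa> g) (\<mu> l) (p (g, h))) (\<beta> (coef' b (h, l)))"
          using bimodule_hom_ract[OF H[OF gl]] gl h by (simp add: cl)
        then have eq: "corner X g l (H (\<kappa> g) (\<mu> l) (ract P (p (g, h)) (coef' b (h, l)))) =
            ract X (corner X g h (H (\<kappa> g) (\<mu> l) (p (g, h)))) (\<beta> (coef' b (h, l)))"
          using X.corner_ract_homog[OF _ gl R.coef_homog[OF b h gl(2)], of "H (\<kappa> g) (\<mu> l) (p (g, h))"] gl h
          by (simp add: cl L.sp.grp.mult_inv_cancel)
        show "corner X g l (H (\<kappa> g) (\<mu> l) (ract P (p (g, h)) (coef' b (h, l)))) =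
            ract X (t g h p) (\<beta> (coef' b (h, l)))"
        proof (cases "l \<in> \<mu> h")
          case True
          then have "\<mu> l = \<mu> h" using R.\<kappa>_eq h by blast
          with eq show ?thesis by (simp add: t_def)
        next
          case False
          then have "coef' b (h, l) = \<zero>\<^bsub>D\<^esub>" using R.coef_zero[OF b h gl(2)] by simp
          moreover have "\<beta> \<zero>\<^bsub>D\<^esub> = \<zero>\<^bsub>F\<^esub>"
            by (rule additive_map_zero[OF R.rg.abelian_group_axioms R.Erg.abelian_group_axioms])
              (auto intro!: additive_mapI simp: R.\<alpha>_closed R.\<alpha>_add)
          ultimately show ?thesis using eq gl h by (simp add: X.Y.ract_zero_right cl)
        qed
      qed (use gl in \<open>auto simp: cl\<close>)
      finally show ?thesis .
    qed
    have "hh (ract P' p b) = (\<Oplus>\<^bsub>X\<^esub>g\<in>carrier G. \<Oplus>\<^bsub>X\<^esub>l\<in>carrier G. \<Oplus>\<^bsub>X\<^esub>h\<in>carrier G.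
        ract X (t g h p) (\<beta> (coef' b (h, l))))"
      unfolding hh_def using t_ract
      by (intro X.Y.ab.finsum_eqI) (auto intro!: X.Y.ab.finsum_closed simp: cl)
    also have "\<dots> = (\<Oplus>\<^bsub>X\<^esub>g\<in>carrier G. \<Oplus>\<^bsub>X\<^esub>h\<in>carrier G. \<Oplus>\<^bsub>X\<^esub>l\<in>carrier G.
        ract X (t g h p) (\<beta> (coef' b (h, l))))"
      by (intro X.Y.ab.finsum_eqI X.Y.ab.finsum_swap L.fin) (auto intro!: X.Y.ab.finsum_closed simp: cl)
    also have "\<dots> = (\<Oplus>\<^bsub>X\<^esub>g\<in>carrier G. \<Oplus>\<^bsub>X\<^esub>h\<in>carrier G. ract X (t g h p) b)"
      using X.ract_corner[OF b]
      by (intro X.Y.ab.finsum_eqI) (auto intro!: X.Y.ab.finsum_closed simp: cl b t_def)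
    also have "\<dots> = ract X (hh p) b"
      unfolding hh_def
      by (subst X.Y.ract_finsum[OF b])
        (auto intro!: X.Y.ab.finsum_closed X.Y.ab.finsum_eqI simp: cl X.Y.ract_finsum[OF b] b)
    finally show ?thesis .
  qed
  have e_hh: "e (hh p) = f p" if p: "p \<in> carrier P'" for p
  proof -
    note e_sum = additive_map_finsum[OF X.Y.ab.abelian_group_axioms Y.Y.ab.abelian_group_axioms
        bimodule_hom_additive[OF e]]
    note f_sum = additive_map_finsum[OF P'.ab.abelian_group_axioms Y.Y.ab.abelian_group_axioms
        bimodule_hom_additive[OF f]]
    have b_cl: "block S T (p (g, l)) \<in> carrier P'" if "g \<in> carrier G" "l \<in> carrier G" for g l S T
      using that pc[OF p] by (simp add: P'_structure block_closed)
    \<comment> \<open>Both e and f commute with corners, and e after H is f after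
      \<open>block\<close>; so the contribution of (g, l) goes to f of the matrix with only that
      entry of p.\<close>
    have et: "e (t g l p) = f (corner P' g l (block (\<kappa> g) (\<mu> l) (p (g, l))))"
      if gl: "g \<in> carrier G" "l \<in> carrier G" for g l
      using gl p
      by (simp add: t_def hom_corner[OF e X] H_cl pc eH hom_corner[OF f P'.bimodule_axioms] b_cl)
    have "e (hh p) = (\<Oplus>\<^bsub>Y\<^esub>g\<in>carrier G. \<Oplus>\<^bsub>Y\<^esub>l\<in>carrier G. e (t g l p))"
      unfolding hh_def
      by (subst e_sum) (auto intro!: X.Y.ab.finsum_closed Y.Y.ab.finsum_closed Y.Y.ab.finsum_eqI
          simp: e_sum t_cl p bimodule_hom_closed[OF e])
    also have "\<dots> = (\<Oplus>\<^bsub>Y\<^esub>g\<in>carrier G. \<Oplus>\<^bsub>Y\<^esub>l\<in>carrier G. f (corner P' g l (block (\<kappa> g) (\<mu> l) (p (g, l)))))"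
      by (intro Y.Y.ab.finsum_eqI) (auto intro!: Y.Y.ab.finsum_closed
          simp: et bimodule_hom_closed[OF f] rP'.corner_closed b_cl)
    also have "\<dots> = f (\<Oplus>\<^bsub>P'\<^esub>g\<in>carrier G. \<Oplus>\<^bsub>P'\<^esub>l\<in>carrier G. corner P' g l (block (\<kappa> g) (\<mu> l) (p (g, l))))"
      by (subst f_sum) (auto intro!: P'.ab.finsum_closed Y.Y.ab.finsum_closed Y.Y.ab.finsum_eqI
          simp: f_sum rP'.corner_closed b_cl bimodule_hom_closed[OF f])
    also have "\<dots> = f p"
      using corner_expansion[of p] p by (simp add: P'_structure(1))
    finally show ?thesis .
  qed
  have "hh \<in> bimodule_hom K E F P' X"
    by (rule bimodule_homI)
      (auto simp: hh_cl hh_smult hh_lact hh_ract additive_map_add[OF hh_add])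
  then show "\<exists>h\<in>bimodule_hom K E F P' X. \<forall>p\<in>carrier P'. e (h p) = f p"
    using e_hh by blast
qed

end

section \<open>Projectivity of Beilinson--Green bimodules\<close>

definition matrix_unit :: "('g, 'p) monoid_scheme \<Rightarrow> ('m, 'r) ring_scheme \<Rightarrow> 'g \<Rightarrow> 'g \<Rightarrow> 'm \<Rightarrow>
    'g \<times> 'g \<Rightarrow> 'm"
  where "matrix_unit G U g l m =
    (\<lambda>(g', l')\<in>carrier G \<times> carrier G. if g' = g \<and> l' = l then m else \<zero>\<^bsub>U\<^esub>)"

lemma matrix_unit_entry [simp]: "g' \<in> carrier G \<Longrightarrow> l' \<in> carrier G \<Longrightarrow>
    matrix_unit G U g l m (g', l') = (if g' = g \<and> l' = l then m else \<zero>\<^bsub>U\<^esub>)"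
  by (simp add: matrix_unit_def)

lemma matrix_unit_extensional: "matrix_unit G U g l m \<in> extensional (carrier G \<times> carrier G)"
  by (simp add: matrix_unit_def)

lemma (in graded_pairing) mmul_matrix_unit_left:
  assumes "u \<in> carrier U" "b \<in> matrices G \<V>" "g \<in> carrier G" "s \<in> carrier G" "l \<in> carrier G"
  shows "mmul G S \<mu> (matrix_unit G U g' s u) b (g, l) = (if g = g' then \<mu> u (b (s, l)) else \<zero>\<^bsub>S\<^esub>)"
proof (cases "g = g'")
  case True
  with assms U.fin V.matrices_carrier[OF assms(2)] show ?thesis
    by simp (subst S.ab.finsum_only[of _ s], auto simp: zero_left intro!: closed)
next
  case False
  with assms V.matrices_carrier[OF assms(2)] show ?thesis
    by (simp add: S.ab.finsum_all_zero zero_left)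
qed

lemma (in graded_pairing) mmul_matrix_unit_right:
  assumes "v \<in> carrier V" "a \<in> matrices G \<U>" "g \<in> carrier G" "s \<in> carrier G" "l \<in> carrier G"
  shows "mmul G S \<mu> a (matrix_unit G V s l' v) (g, l) = (if l = l' then \<mu> (a (g, s)) v else \<zero>\<^bsub>S\<^esub>)"
proof (cases "l = l'")
  case True
  with assms U.fin U.matrices_carrier[OF assms(2)] show ?thesis
    by simp (subst S.ab.finsum_only[of _ s], auto simp: zero_right intro!: closed)
next
  case False
  with assms U.matrices_carrier[OF assms(2)] show ?thesis
    by (simp add: S.ab.finsum_all_zero zero_right)
qed

lemma (in group) mult_inv_eq_iff:
  assumes "g \<in> carrier G" "g' \<in> carrier G" "h \<in> carrier G"
  shows "g' \<otimes> inv h = g \<otimes> inv h \<longleftrightarrow> g' = g" and "inv g' = inv g \<longleftrightarrow> g' = g"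
  using assms by (auto simp: right_cancel)

context graded_space
begin

lemma hcomp_entry_row:
  assumes "a \<in> matrices G \<G>" "g \<in> carrier G" "h \<in> carrier G" "l \<in> carrier G"
  shows "hcomp G M \<G> (g \<otimes>\<^bsub>G\<^esub> inv\<^bsub>G\<^esub> l) (a (g, h)) = (if l = h then a (g, h) else \<zero>\<^bsub>M\<^esub>)"
  using assms hcomp_homog[OF matrices_entry[OF assms(1-3)], of "g \<otimes>\<^bsub>G\<^esub> inv\<^bsub>G\<^esub> l"]
  by (simp add: grp.mult_inv_eq_iff)

lemma hcomp_entry_col:
  assumes "a \<in> matrices G \<G>" "g \<in> carrier G" "h \<in> carrier G" "l \<in> carrier G"
  shows "hcomp G M \<G> (l \<otimes>\<^bsub>G\<^esub> inv\<^bsub>G\<^esub> h) (a (g, h)) = (if l = g then a (g, h) else \<zero>\<^bsub>M\<^esub>)"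
  using assms hcomp_homog[OF matrices_entry[OF assms(1-3)], of "l \<otimes>\<^bsub>G\<^esub> inv\<^bsub>G\<^esub> h"]
  by (simp add: grp.mult_inv_eq_iff)

end

context graded_alg
begin

abbreviation diag :: "'g \<Rightarrow> 'g \<times> 'g \<Rightarrow> 'a"
  where "diag g \<equiv> matrix_unit G A g g \<one>\<^bsub>A\<^esub>"

lemma diag_closed: "g \<in> carrier G \<Longrightarrow> diag g \<in> matrices G \<A>"
  by (intro matricesI matrix_unit_extensional)
    (auto simp: one_homog subspace_zero[OF sp.homog_subspace])

lemmas mmul_diag_left = pr.mmul_matrix_unit_left[OF rg.one_closed]
lemmas mmul_diag_right = pr.mmul_matrix_unit_right[OF rg.one_closed]
lemmas BG_finsum_entry = sp.matrix_finsum_entry[of "Beilinson_Green G A \<A>", simplified]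

text \<open>The coefficients of a matrix are its entries. Behind the two expansions: since a (g, h)
  is homogeneous of degree g h\<inverse>, column h of its \<open>spread\<close> can be nonzero only
  in row g, and row g only in column h.\<close>

lemma side_Beilinson_Green:
  "side G K A \<A> (Beilinson_Green G A \<A>) (spread G A \<A>) diag (\<lambda>_. carrier G) (\<lambda>a. a)"
proof (intro side.intro side_axioms.intro graded_alg_axioms k_algebra_Beilinson_Green)
  note ext = mmul_extensional spread_extensional matrix_unit_extensional matrices_extensional
  note cl = sp.matrices_carrier sp.hcomp_carrier
  show "spread G A \<A> (c \<oplus>\<^bsub>A\<^esub> c') =
      spread G A \<A> c \<oplus>\<^bsub>Beilinson_Green G A \<A>\<^esub> spread G A \<A> c'"
    if "c \<in> carrier A" "c' \<in> carrier A" for c c'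
    by (rule matrix_ext[of _ G]) (use that in \<open>auto simp: ext sp.hcomp_add\<close>)
  show "spread G A \<A> (k \<odot>\<^bsub>A\<^esub> c) = k \<odot>\<^bsub>Beilinson_Green G A \<A>\<^esub> spread G A \<A> c"
    if "k \<in> carrier K" "c \<in> carrier A" for k c
    by (rule matrix_ext[of _ G]) (use that in \<open>auto simp: ext sp.hcomp_smult\<close>)
  show "spread G A \<A> \<one>\<^bsub>A\<^esub> = \<one>\<^bsub>Beilinson_Green G A \<A>\<^esub>"
    by (rule matrix_ext[of _ G]) (auto simp: ext hcomp_one sp.grp.mult_inv_eq_one_iff)
  show "diag g \<otimes>\<^bsub>Beilinson_Green G A \<A>\<^esub> diag h = (if g = h then diag g else \<zero>\<^bsub>Beilinson_Green G A \<A>\<^esub>)"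
    if "g \<in> carrier G" "h \<in> carrier G" for g h
    by (rule matrix_ext[of _ G]) (use that in \<open>auto simp: ext mmul_diag_left diag_closed simp del: mmul_entry\<close>)
  show "finsum (Beilinson_Green G A \<A>) diag (carrier G) = \<one>\<^bsub>Beilinson_Green G A \<A>\<^esub>"
  proof (rule matrix_ext[of _ G])
    have "finsum (Beilinson_Green G A \<A>) diag (carrier G) \<in> carrier (Beilinson_Green G A \<A>)"
      by (intro abelian_monoid.finsum_closed)
        (use diag_closed k_algebra.ring[OF k_algebra_Beilinson_Green] in \<open>auto simp: ring_def abelian_group_def\<close>)
    then show "finsum (Beilinson_Green G A \<A>) diag (carrier G) \<in> extensional (carrier G \<times> carrier G)"
      by (simp add: ext)
    fix g h assume gh: "g \<in> carrier G" "h \<in> carrier G"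
    have "finsum (Beilinson_Green G A \<A>) diag (carrier G) (g, h) = (\<Oplus>\<^bsub>A\<^esub>x\<in>carrier G. diag x (g, h))"
      using gh diag_closed by (intro BG_finsum_entry) auto
    also have "\<dots> = diag g (g, h)"
      using gh fin by (intro rg.finsum_only) auto
    finally show "finsum (Beilinson_Green G A \<A>) diag (carrier G) (g, h) = \<one>\<^bsub>Beilinson_Green G A \<A>\<^esub> (g, h)"
      using gh by auto
  qed (simp add: ext)
  \<comment> \<open>Both products have c at (x h, h) and zeros elsewhere.\<close>
  show "diag (x \<otimes>\<^bsub>G\<^esub> h) \<otimes>\<^bsub>Beilinson_Green G A \<A>\<^esub> spread G A \<A> c =
      spread G A \<A> c \<otimes>\<^bsub>Beilinson_Green G A \<A>\<^esub> diag h"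
    if xh: "x \<in> carrier G" "h \<in> carrier G" and c: "c \<in> \<A> x" for x h c
  proof (rule matrix_ext[of _ G])
    fix g l assume gl: "g \<in> carrier G" "l \<in> carrier G"
    have cc: "c \<in> carrier A" using sp.homog_carrier[OF xh(1) c] .
    have 1: "hcomp G A \<A> (x \<otimes>\<^bsub>G\<^esub> h \<otimes>\<^bsub>G\<^esub> inv\<^bsub>G\<^esub> l) c = (if l = h then c else \<zero>\<^bsub>A\<^esub>)"
      using xh gl sp.hcomp_homog[OF c _ xh(1), of "x \<otimes>\<^bsub>G\<^esub> h \<otimes>\<^bsub>G\<^esub> inv\<^bsub>G\<^esub> l"]
        sp.grp.mult_inv_eq_one_iff[of h l] sp.grp.r_cancel_one[of x "h \<otimes>\<^bsub>G\<^esub> inv\<^bsub>G\<^esub> l"]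
      by (auto simp: sp.grp.m_assoc)
    have 2: "hcomp G A \<A> (g \<otimes>\<^bsub>G\<^esub> inv\<^bsub>G\<^esub> h) c = (if g = x \<otimes>\<^bsub>G\<^esub> h then c else \<zero>\<^bsub>A\<^esub>)"
    proof -
      have "g \<otimes>\<^bsub>G\<^esub> inv\<^bsub>G\<^esub> h = x \<longleftrightarrow> g = x \<otimes>\<^bsub>G\<^esub> h"
        using xh gl by (auto simp: sp.grp.m_assoc)
      then show ?thesis using xh gl sp.hcomp_homog[OF c _ xh(1), of "g \<otimes>\<^bsub>G\<^esub> inv\<^bsub>G\<^esub> h"] by auto
    qed
    show "(diag (x \<otimes>\<^bsub>G\<^esub> h) \<otimes>\<^bsub>Beilinson_Green G A \<A>\<^esub> spread G A \<A> c) (g, l) =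
      (spread G A \<A> c \<otimes>\<^bsub>Beilinson_Green G A \<A>\<^esub> diag h) (g, l)"
      using xh gl cc 1 2
      by (cases "l = h") (auto simp: mmul_diag_left mmul_diag_right sp.spread_matrices simp del: mmul_entry)
  qed (simp_all add: ext)
  show "diag g \<otimes>\<^bsub>Beilinson_Green G A \<A>\<^esub> a = (\<Oplus>\<^bsub>Beilinson_Green G A \<A>\<^esub>h\<in>carrier G.
      spread G A \<A> (a (g, h)) \<otimes>\<^bsub>Beilinson_Green G A \<A>\<^esub> diag h)"
    if "a \<in> carrier (Beilinson_Green G A \<A>)" and g: "g \<in> carrier G" for a g
  proof (rule matrix_ext[of _ G])
    from that have a: "a \<in> matrices G \<A>" by simp
    have t: "mmul G A (monoid.mult A) (spread G A \<A> (a (g, h))) (diag h) \<in> matrices G \<A>" if "h \<in> carrier G" for h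
      using that a g by (intro pr.mmul_matrices sp.spread_matrices diag_closed sp.matrices_carrier)
    then show "(\<Oplus>\<^bsub>Beilinson_Green G A \<A>\<^esub>h\<in>carrier G.
      spread G A \<A> (a (g, h)) \<otimes>\<^bsub>Beilinson_Green G A \<A>\<^esub> diag h) \<in> extensional (carrier G \<times> carrier G)"
      using abelian_monoid.finsum_closed[of "Beilinson_Green G A \<A>" _ "carrier G"]
        k_algebra.ring[OF k_algebra_Beilinson_Green]
      by (auto simp: ring_def abelian_group_def intro!: matrices_extensional[of _ G \<A>])
    fix g' l assume gl: "g' \<in> carrier G" "l \<in> carrier G"
    have "(\<Oplus>\<^bsub>Beilinson_Green G A \<A>\<^esub>h\<in>carrier G.
        spread G A \<A> (a (g, h)) \<otimes>\<^bsub>Beilinson_Green G A \<A>\<^esub> diag h) (g', l) =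
      (\<Oplus>\<^bsub>A\<^esub>h\<in>carrier G. mmul G A (monoid.mult A) (spread G A \<A> (a (g, h))) (diag h) (g', l))"
      using gl t by (subst BG_finsum_entry) auto
    also have "\<dots> = (\<Oplus>\<^bsub>A\<^esub>h\<in>carrier G. if l = h then hcomp G A \<A> (g' \<otimes>\<^bsub>G\<^esub> inv\<^bsub>G\<^esub> l) (a (g, l)) else \<zero>\<^bsub>A\<^esub>)"
      using gl g by (intro rg.finsum_eqI)
        (auto simp: mmul_diag_right sp.spread_matrices sp.matrices_carrier[OF a] sp.hcomp_carrier simp del: mmul_entry)
    also have "\<dots> = hcomp G A \<A> (g' \<otimes>\<^bsub>G\<^esub> inv\<^bsub>G\<^esub> l) (a (g, l))"
      using gl g fin by (subst rg.finsum_only[of _ l]) (auto simp: sp.hcomp_carrier sp.matrices_carrier[OF a])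
    also have "\<dots> = (diag g \<otimes>\<^bsub>Beilinson_Green G A \<A>\<^esub> a) (g', l)"
      using gl g a by (simp add: mmul_diag_left sp.hcomp_entry_col sp.matrices_carrier del: mmul_entry)
    finally show "(diag g \<otimes>\<^bsub>Beilinson_Green G A \<A>\<^esub> a) (g', l) = (\<Oplus>\<^bsub>Beilinson_Green G A \<A>\<^esub>h\<in>carrier G.
        spread G A \<A> (a (g, h)) \<otimes>\<^bsub>Beilinson_Green G A \<A>\<^esub> diag h) (g', l)" by simp
  qed (simp add: ext)
  show "a \<otimes>\<^bsub>Beilinson_Green G A \<A>\<^esub> diag h = (\<Oplus>\<^bsub>Beilinson_Green G A \<A>\<^esub>g\<in>carrier G.
      diag g \<otimes>\<^bsub>Beilinson_Green G A \<A>\<^esub> spread G A \<A> (a (g, h)))"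
    if "a \<in> carrier (Beilinson_Green G A \<A>)" and h: "h \<in> carrier G" for a h
  proof (rule matrix_ext[of _ G])
    from that have a: "a \<in> matrices G \<A>" by simp
    have t: "mmul G A (monoid.mult A) (diag g) (spread G A \<A> (a (g, h))) \<in> matrices G \<A>" if "g \<in> carrier G" for g
      using that a h by (intro pr.mmul_matrices sp.spread_matrices diag_closed sp.matrices_carrier)
    then show "(\<Oplus>\<^bsub>Beilinson_Green G A \<A>\<^esub>g\<in>carrier G.
      diag g \<otimes>\<^bsub>Beilinson_Green G A \<A>\<^esub> spread G A \<A> (a (g, h))) \<in> extensional (carrier G \<times> carrier G)"
      using abelian_monoid.finsum_closed[of "Beilinson_Green G A \<A>" _ "carrier G"]
        k_algebra.ring[OF k_algebra_Beilinson_Green]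
      by (auto simp: ring_def abelian_group_def intro!: matrices_extensional[of _ G \<A>])
    fix g' l assume gl: "g' \<in> carrier G" "l \<in> carrier G"
    have "(\<Oplus>\<^bsub>Beilinson_Green G A \<A>\<^esub>g\<in>carrier G.
        diag g \<otimes>\<^bsub>Beilinson_Green G A \<A>\<^esub> spread G A \<A> (a (g, h))) (g', l) =
      (\<Oplus>\<^bsub>A\<^esub>g\<in>carrier G. mmul G A (monoid.mult A) (diag g) (spread G A \<A> (a (g, h))) (g', l))"
      using gl t by (subst BG_finsum_entry) auto
    also have "\<dots> = (\<Oplus>\<^bsub>A\<^esub>g\<in>carrier G. if g' = g then hcomp G A \<A> (g' \<otimes>\<^bsub>G\<^esub> inv\<^bsub>G\<^esub> l) (a (g', h)) else \<zero>\<^bsub>A\<^esub>)"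
      using gl h by (intro rg.finsum_eqI)
        (auto simp: mmul_diag_left sp.spread_matrices sp.matrices_carrier[OF a] sp.hcomp_carrier simp del: mmul_entry)
    also have "\<dots> = hcomp G A \<A> (g' \<otimes>\<^bsub>G\<^esub> inv\<^bsub>G\<^esub> l) (a (g', h))"
      using gl h fin by (subst rg.finsum_only[of _ g']) (auto simp: sp.hcomp_carrier sp.matrices_carrier[OF a])
    also have "\<dots> = (a \<otimes>\<^bsub>Beilinson_Green G A \<A>\<^esub> diag h) (g', l)"
      using gl h a by (simp add: mmul_diag_right sp.hcomp_entry_row sp.matrices_carrier del: mmul_entry)
    finally show "(a \<otimes>\<^bsub>Beilinson_Green G A \<A>\<^esub> diag h) (g', l) = (\<Oplus>\<^bsub>Beilinson_Green G A \<A>\<^esub>g\<in>carrier G.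
        diag g \<otimes>\<^bsub>Beilinson_Green G A \<A>\<^esub> spread G A \<A> (a (g, h))) (g', l)" by simp
  qed (simp add: ext)
qed (simp_all add: sp.spread_matrices pr.spread_pairing diag_closed)

end

text \<open>With every idempotent equal to 1 and every class a single index, completeness is
  immediate and orthogonality concerns g = h only. The coefficient matrix of k is the scalar matrix,
  whose diagonal sits in degree 1.\<close>

lemma side_self:
  assumes G: "group G" and fin: "finite (carrier G)" and K: "field K"
  shows "side G K (self_algebra K) (trivial_grading G (self_algebra K)) (self_algebra K)
    (\<lambda>k. k) (\<lambda>_. \<one>\<^bsub>K\<^esub>) (\<lambda>g. {g})
    (\<lambda>k. \<lambda>(g, h)\<in>carrier G \<times> carrier G. if g = h then k else \<zero>\<^bsub>K\<^esub>)"
proof (intro side.intro side_axioms.intro graded_alg_self[OF assms] k_algebra_self[OF K])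
  interpret S: graded_alg G K "self_algebra K" "trivial_grading G (self_algebra K)"
    by (rule graded_alg_self[OF assms])
  interpret K: field K by fact
  show "finsum (self_algebra K) (\<lambda>_. \<one>\<^bsub>K\<^esub>) {g} = \<one>\<^bsub>self_algebra K\<^esub>" for g :: 'a
    by (subst S.rg.finsum_only[of _ g]) auto
  show "\<one>\<^bsub>K\<^esub> \<otimes>\<^bsub>self_algebra K\<^esub> c = c \<otimes>\<^bsub>self_algebra K\<^esub> \<one>\<^bsub>K\<^esub>"
    if "x \<in> carrier G" "c \<in> trivial_grading G (self_algebra K) x" for x c
    using S.sp.homog_carrier[OF that] by simp
  show "(\<lambda>(g, h)\<in>carrier G \<times> carrier G. if g = h then k else \<zero>\<^bsub>K\<^esub>) \<in>
      matrices G (trivial_grading G (self_algebra K))" if "k \<in> carrier (self_algebra K)" for k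
    using that by (intro matricesI) (auto simp: trivial_grading_def S.sp.grp.mult_inv_eq_one_iff)
  show "\<one>\<^bsub>K\<^esub> \<otimes>\<^bsub>self_algebra K\<^esub> k = (\<Oplus>\<^bsub>self_algebra K\<^esub>h\<in>carrier G.
      (\<lambda>(g, h)\<in>carrier G \<times> carrier G. if g = h then k else \<zero>\<^bsub>K\<^esub>) (g, h) \<otimes>\<^bsub>self_algebra K\<^esub> \<one>\<^bsub>K\<^esub>)"
    if "k \<in> carrier (self_algebra K)" "g \<in> carrier G" for k g
    using that fin by (subst S.rg.finsum_only[of _ g]) auto
  show "k \<otimes>\<^bsub>self_algebra K\<^esub> \<one>\<^bsub>K\<^esub> = (\<Oplus>\<^bsub>self_algebra K\<^esub>g\<in>carrier G.
      \<one>\<^bsub>K\<^esub> \<otimes>\<^bsub>self_algebra K\<^esub> (\<lambda>(g, h)\<in>carrier G \<times> carrier G. if g = h then k else \<zero>\<^bsub>K\<^esub>) (g, h))"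
    if "k \<in> carrier (self_algebra K)" "h \<in> carrier G" for k h
    using that fin by (subst S.rg.finsum_only[of _ h]) auto
  show "(\<lambda>(g, h)\<in>carrier G \<times> carrier G. if g = h then c else \<zero>\<^bsub>K\<^esub>) (g, h) =
      hcomp G (self_algebra K) (trivial_grading G (self_algebra K)) (g \<otimes>\<^bsub>G\<^esub> inv\<^bsub>G\<^esub> h) c"
    if "c \<in> carrier (self_algebra K)" "g \<in> carrier G" "h \<in> carrier G" for c g h
    using that S.sp.hcomp_homog[of c "\<one>\<^bsub>G\<^esub>" "g \<otimes>\<^bsub>G\<^esub> inv\<^bsub>G\<^esub> h"]
    by (auto simp: trivial_grading_def S.sp.grp.mult_inv_eq_one_iff)
qed (use K in \<open>auto simp: field_def domain_def cring_def ring.ring_simprules ring_def monoid.one_closed\<close>)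

lemma mmul_eq_structure:
  assumes "carrier M = carrier N" "add M = add N" "zero M = zero N"
  shows "mmul G M \<mu> a b = mmul G N \<mu> a b"
  by (simp add: mmul_def finsum_eq_structure[OF assms])

context graded_bimod
begin

lemma transfer_bar:
  "transfer G K C \<C> (Beilinson_Green G C \<C>) (spread G C \<C>) C.diag (\<lambda>_. carrier G) (\<lambda>a. a)
    D \<D> (Beilinson_Green G D \<D>) (spread G D \<D>) D.diag (\<lambda>_. carrier G) (\<lambda>a. a)
    U \<U> (bar G U \<U>)"
  by (intro transfer.intro two_sides.intro transfer_axioms.intro C.side_Beilinson_Green
      D.side_Beilinson_Green graded_bimod_axioms bimodule_bar) simp_all

lemma fg_bar: "fg_bimodule K C D U \<Longrightarrow>
    fg_bimodule K (Beilinson_Green G C \<C>) (Beilinson_Green G D \<D>) (bar G U \<U>)"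
  by (rule transfer.fg_transfer[OF transfer_bar])

lemma projective_bar: "graded_projective G K C \<C> D \<D> U \<U> \<Longrightarrow>
    projective_bimodule K (Beilinson_Green G C \<C>) (Beilinson_Green G D \<D>) (bar G U \<U>)"
  by (rule transfer.projective_transfer[OF transfer_bar])

text \<open>A mixed instance: the Beilinson--Green algebra acts on the left and K on the right, so
  the windows used for lifting are single columns.\<close>

lemma left_projective_bar:
  assumes proj: "left_graded_projective G K C \<C> U \<U>"
  shows "left_projective K (Beilinson_Green G C \<C>) (bar G U \<U>)"
  unfolding left_projective_def
proof (rule transfer.projective_transfer)
  let ?K = "self_algebra K" and ?\<K> = "trivial_grading G (self_algebra K)"
  have fld: "field K" by (rule vectorspace_field[OF vs])
  have gb: "graded_bimod G K C \<C> ?K ?\<K> (as_left_module U) \<U>"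
    using proj by (intro graded_bimodI C.graded_alg_axioms graded_alg_self C.G C.fin fld)
      (simp add: left_graded_projective_def graded_projective_def)
  interpret l: graded_bimod G K C \<C> ?K ?\<K> "as_left_module U" \<U> by (rule gb)
  show "transfer G K C \<C> (Beilinson_Green G C \<C>) (spread G C \<C>) C.diag (\<lambda>_. carrier G) (\<lambda>a. a)
    ?K ?\<K> ?K (\<lambda>k. k) (\<lambda>_. \<one>\<^bsub>K\<^esub>) (\<lambda>g. {g})
    (\<lambda>k. \<lambda>(g, h)\<in>carrier G \<times> carrier G. if g = h then k else \<zero>\<^bsub>K\<^esub>)
    (as_left_module U) \<U> (as_left_module (bar G U \<U>))"
  proof (intro transfer.intro two_sides.intro transfer_axioms.intro C.side_Beilinson_Green
      side_self C.G C.fin fld gb bimodule_as_left[OF bimodule_bar])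
    fix p k assume p: "p \<in> matrices G \<U>" and k: "k \<in> carrier ?K"
    \<comment> \<open>Scaling a matrix is multiplication by the scalar matrix.\<close>
    show "ract (as_left_module (bar G U \<U>)) p k = mmul G (as_left_module U) (ract (as_left_module U)) p
        (\<lambda>(g, h)\<in>carrier G \<times> carrier G. if g = h then k else \<zero>\<^bsub>K\<^esub>)"
      by (rule matrix_ext[of _ G])
        (use p k l.R.mmul_unit_right[of k p, unfolded self_algebra_simps] in \<open>simp_all add: mmul_extensional del: mmul_entry\<close>)
  qed (simp_all add: mmul_eq_structure[of "as_left_module U" U])
  show "graded_projective G K C \<C> ?K ?\<K> (as_left_module U) \<U>"
    using proj by (simp add: left_graded_projective_def)
qed

lemma right_projective_bar:
  assumes proj: "right_graded_projective G K D \<D> U \<U>"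
  shows "right_projective K (Beilinson_Green G D \<D>) (bar G U \<U>)"
  unfolding right_projective_def
proof (rule transfer.projective_transfer)
  let ?K = "self_algebra K" and ?\<K> = "trivial_grading G (self_algebra K)"
  have fld: "field K" by (rule vectorspace_field[OF vs])
  have gb: "graded_bimod G K ?K ?\<K> D \<D> (as_right_module U) \<U>"
    using proj by (intro graded_bimodI D.graded_alg_axioms graded_alg_self C.G C.fin fld)
      (simp add: right_graded_projective_def graded_projective_def)
  interpret r: graded_bimod G K ?K ?\<K> D \<D> "as_right_module U" \<U> by (rule gb)
  show "transfer G K ?K ?\<K> ?K (\<lambda>k. k) (\<lambda>_. \<one>\<^bsub>K\<^esub>) (\<lambda>g. {g})
    (\<lambda>k. \<lambda>(g, h)\<in>carrier G \<times> carrier G. if g = h then k else \<zero>\<^bsub>K\<^esub>)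
    D \<D> (Beilinson_Green G D \<D>) (spread G D \<D>) D.diag (\<lambda>_. carrier G) (\<lambda>a. a)
    (as_right_module U) \<U> (as_right_module (bar G U \<U>))"
  proof (intro transfer.intro two_sides.intro transfer_axioms.intro D.side_Beilinson_Green
      side_self C.G C.fin fld gb bimodule_as_right[OF bimodule_bar])
    fix p k assume p: "p \<in> matrices G \<U>" and k: "k \<in> carrier ?K"
    show "lact (as_right_module (bar G U \<U>)) k p = mmul G (as_right_module U) (lact (as_right_module U))
        (\<lambda>(g, h)\<in>carrier G \<times> carrier G. if g = h then k else \<zero>\<^bsub>K\<^esub>) p"
      by (rule matrix_ext[of _ G])
        (use p k r.L.mmul_unit_left[of k p, unfolded self_algebra_simps] in \<open>simp_all add: mmul_extensional del: mmul_entry\<close>)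
  qed (simp_all add: mmul_eq_structure[of "as_right_module U" U])
  show "graded_projective G K ?K ?\<K> D \<D> (as_right_module U) \<U>"
    using proj by (simp add: right_graded_projective_def)
qed

end

section \<open>Tensor products\<close>

locale bimodule_pair = U: bimodule K C D U + V: bimodule K D E V
  for K :: "('k, 'q) ring_scheme" and C :: "('k, 'c) module" and D :: "('k, 'd) module"
    and E :: "('k, 'e) module"
    and U :: "('k, 'c, 'd, 'm) bimodule" and V :: "('k, 'd, 'e, 'n) bimodule"
begin

abbreviation "Free \<equiv> tensor_free U V"
abbreviation "Rel \<equiv> tensor_relations D U V"
abbreviation "T \<equiv> tensor_product D U V"
abbreviation "pt \<equiv> pure_tensor D U V"

sublocale Fr: comm_group Free by (rule abelian_free_Abelian_group)

lemma Free_diff: "x \<in> carrier Free \<Longrightarrow> y \<in> carrier Free \<Longrightarrow> x - y \<in> carrier Free"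
  using keys_diff[of x y] by (simp, blast)

lemma
  assumes "u \<in> carrier U" "v \<in> carrier V"
  shows relator_left: "u' \<in> carrier U \<Longrightarrow>
      frag_of (u \<oplus>\<^bsub>U\<^esub> u', v) - frag_of (u, v) - frag_of (u', v) \<in> tensor_relators D U V"
    and relator_right: "v' \<in> carrier V \<Longrightarrow>
      frag_of (u, v \<oplus>\<^bsub>V\<^esub> v') - frag_of (u, v) - frag_of (u, v') \<in> tensor_relators D U V"
    and relator_balanced: "d \<in> carrier D \<Longrightarrow>
      frag_of (ract U u d, v) - frag_of (u, lact V d v) \<in> tensor_relators D U V"
  using assms unfolding tensor_relators_def by blast+

lemma relator_cases [consumes 1, case_names left right balanced]:
  assumes "r \<in> tensor_relators D U V"
  obtains u u' v where "r = frag_of (u \<oplus>\<^bsub>U\<^esub> u', v) - frag_of (u, v) - frag_of (u', v)"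
      "u \<in> carrier U" "u' \<in> carrier U" "v \<in> carrier V"
    | u v v' where "r = frag_of (u, v \<oplus>\<^bsub>V\<^esub> v') - frag_of (u, v) - frag_of (u, v')"
      "u \<in> carrier U" "v \<in> carrier V" "v' \<in> carrier V"
    | u d v where "r = frag_of (ract U u d, v) - frag_of (u, lact V d v)"
      "u \<in> carrier U" "d \<in> carrier D" "v \<in> carrier V"
  using assms unfolding tensor_relators_def by blast

lemma relators_closed: "tensor_relators D U V \<subseteq> carrier Free"
proof
  fix r assume "r \<in> tensor_relators D U V"
  then show "r \<in> carrier Free"
    by (cases rule: relator_cases)
      (auto intro!: Free_diff simp: U.ract_closed V.lact_closed simp del: carrier_free_Abelian_group_iff)
qed

lemma Rel_subgroup: "subgroup Rel Free"
  unfolding tensor_relations_def by (rule Fr.generate_is_subgroup[OF relators_closed])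

sublocale Rel: normal Rel Free
  by (rule Fr.subgroup_imp_normal[OF Rel_subgroup])

lemma Rel_relator: "r \<in> tensor_relators D U V \<Longrightarrow> r \<in> Rel"
  by (simp add: tensor_relations_def generate.incl)

lemma tensor_simps:
  "carrier T = carrier (Free Mod Rel)" "zero T = Rel" "add T = (\<lambda>X Y. X <#>\<^bsub>Free\<^esub> Y)"
  "smult T = (\<lambda>k. tensor_map D U V (\<lambda>(u, v). (k \<odot>\<^bsub>U\<^esub> u, v)))"
  "lact T = (\<lambda>c. tensor_map D U V (\<lambda>(u, v). (lact U c u, v)))"
  "ract T = (\<lambda>X e. tensor_map D U V (\<lambda>(u, v). (u, ract V v e)) X)"
  by (simp_all add: tensor_product_def Let_def)

sublocale Tab: abelian_group T
proof -
  interpret Q: comm_group "Free Mod Rel" by (rule Fr.abelian_FactGroup[OF Rel_subgroup])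
  have mult: "monoid.mult (Free Mod Rel) = (\<lambda>X Y. X <#>\<^bsub>Free\<^esub> Y)" "one (Free Mod Rel) = Rel"
    by simp_all
  show "abelian_group T"
  proof (rule abelian_groupI, unfold tensor_simps)
    show "\<exists>Y\<in>carrier (Free Mod Rel). Y <#>\<^bsub>Free\<^esub> X = Rel" if "X \<in> carrier (Free Mod Rel)" for X
      using that Q.l_inv[OF that] Q.inv_closed[OF that] unfolding mult by blast
  qed (fact Q.m_closed[unfolded mult] Q.one_closed[unfolded mult] Q.m_assoc[unfolded mult]
      Q.m_comm[unfolded mult] Q.l_one[unfolded mult])+
qed

lemma T_carrier: "carrier T = (\<lambda>x. Rel #>\<^bsub>Free\<^esub> x) ` carrier Free"
  by (simp add: tensor_simps carrier_FactGroup)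

lemma T_add: "x \<in> carrier Free \<Longrightarrow> y \<in> carrier Free \<Longrightarrow>
    (Rel #>\<^bsub>Free\<^esub> x) \<oplus>\<^bsub>T\<^esub> (Rel #>\<^bsub>Free\<^esub> y) = Rel #>\<^bsub>Free\<^esub> (x + y)"
  using Rel.rcos_sum[of x y] by (simp add: tensor_simps)

lemma coset_eqI:
  assumes "x \<in> carrier Free" "y \<in> carrier Free" "x - y \<in> Rel"
  shows "Rel #>\<^bsub>Free\<^esub> x = Rel #>\<^bsub>Free\<^esub> y"
proof -
  have "x \<in> Rel #>\<^bsub>Free\<^esub> y"
    unfolding r_coset_def using assms(3) by (intro UN_I[of "x - y"]) auto
  then show ?thesis
    using Fr.repr_independence[OF _ assms(2) Rel_subgroup] by simp
qed

lemma pt_closed: "u \<in> carrier U \<Longrightarrow> v \<in> carrier V \<Longrightarrow> pt u v \<in> carrier T"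
  by (auto simp: pure_tensor_def T_carrier)

lemma pt_balanced: "u \<in> carrier U \<Longrightarrow> d \<in> carrier D \<Longrightarrow> v \<in> carrier V \<Longrightarrow>
    pt (ract U u d) v = pt u (lact V d v)"
  unfolding pure_tensor_def
  by (intro coset_eqI Rel_relator relator_balanced) (auto simp: U.ract_closed V.lact_closed)

lemma pt_add_left:
  assumes "u \<in> carrier U" "u' \<in> carrier U" "v \<in> carrier V"
  shows "pt (u \<oplus>\<^bsub>U\<^esub> u') v = pt u v \<oplus>\<^bsub>T\<^esub> pt u' v"
proof -
  have "pt u v \<oplus>\<^bsub>T\<^esub> pt u' v = Rel #>\<^bsub>Free\<^esub> (frag_of (u, v) + frag_of (u', v))"
    unfolding pure_tensor_def using assms by (intro T_add) auto
  also have "\<dots> = pt (u \<oplus>\<^bsub>U\<^esub> u') v"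
    unfolding pure_tensor_def
  proof (rule coset_eqI[symmetric])
    have "frag_of (u \<oplus>\<^bsub>U\<^esub> u', v) - frag_of (u, v) - frag_of (u', v) \<in> Rel"
      using assms by (intro Rel_relator relator_left)
    then show "frag_of (u \<oplus>\<^bsub>U\<^esub> u', v) - (frag_of (u, v) + frag_of (u', v)) \<in> Rel"
      by (simp add: algebra_simps)
  qed (use assms Fr.m_closed[unfolded mult_free_Abelian_group] in
      \<open>auto simp del: carrier_free_Abelian_group_iff\<close>)
  finally show ?thesis by simp
qed

lemma pt_add_right:
  assumes "u \<in> carrier U" "v \<in> carrier V" "v' \<in> carrier V"
  shows "pt u (v \<oplus>\<^bsub>V\<^esub> v') = pt u v \<oplus>\<^bsub>T\<^esub> pt u v'"
proof -
  have "pt u v \<oplus>\<^bsub>T\<^esub> pt u v' = Rel #>\<^bsub>Free\<^esub> (frag_of (u, v) + frag_of (u, v'))"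
    unfolding pure_tensor_def using assms by (intro T_add) auto
  also have "\<dots> = pt u (v \<oplus>\<^bsub>V\<^esub> v')"
    unfolding pure_tensor_def
  proof (rule coset_eqI[symmetric])
    have "frag_of (u, v \<oplus>\<^bsub>V\<^esub> v') - frag_of (u, v) - frag_of (u, v') \<in> Rel"
      using assms by (intro Rel_relator relator_right)
    then show "frag_of (u, v \<oplus>\<^bsub>V\<^esub> v') - (frag_of (u, v) + frag_of (u, v')) \<in> Rel"
      by (simp add: algebra_simps)
  qed (use assms Fr.m_closed[unfolded mult_free_Abelian_group] in
      \<open>auto simp del: carrier_free_Abelian_group_iff\<close>)
  finally show ?thesis by simp
qed

lemma pt_additive_left: "v \<in> carrier V \<Longrightarrow> additive_map U T (\<lambda>u. pt u v)"
  by (intro additive_mapI) (auto simp: pt_closed pt_add_left)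

lemma pt_additive_right: "u \<in> carrier U \<Longrightarrow> additive_map V T (pt u)"
  by (intro additive_mapI) (auto simp: pt_closed pt_add_right)

lemmas pt_finsum_left = additive_map_finsum[OF U.ab.abelian_group_axioms Tab.abelian_group_axioms pt_additive_left]
lemmas pt_finsum_right = additive_map_finsum[OF V.ab.abelian_group_axioms Tab.abelian_group_axioms pt_additive_right]

text \<open>Pure tensors are the cosets of the free generators. Differences rather than sums are
  followed, because the induction on the free group builds its elements by subtraction.\<close>

lemma additive_eqI:
  assumes S: "abelian_group S" and f: "additive_map T S f" and g: "additive_map T S g"
    and eq: "\<And>u v. u \<in> carrier U \<Longrightarrow> v \<in> carrier V \<Longrightarrow> f (pt u v) = g (pt u v)"
    and X: "X \<in> carrier T"
  shows "f X = g X"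
proof -
  interpret S: abelian_group S by fact
  obtain x where x: "x \<in> carrier Free" and Xx: "X = Rel #>\<^bsub>Free\<^esub> x"
    using X by (auto simp: T_carrier)
  have cl: "Rel #>\<^bsub>Free\<^esub> y \<in> carrier T" if "y \<in> carrier Free" for y
    using that unfolding T_carrier by blast
  have h: "h (Rel #>\<^bsub>Free\<^esub> (y - z)) = h (Rel #>\<^bsub>Free\<^esub> y) \<ominus>\<^bsub>S\<^esub> h (Rel #>\<^bsub>Free\<^esub> z)"
    if h: "additive_map T S h" and y: "y \<in> carrier Free" and z: "z \<in> carrier Free" for h y z
  proof -
    note c = additive_map_closed[OF h cl]
    have "h (Rel #>\<^bsub>Free\<^esub> y) = h (Rel #>\<^bsub>Free\<^esub> (y - z)) \<oplus>\<^bsub>S\<^esub> h (Rel #>\<^bsub>Free\<^esub> z)"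
      using additive_map_add[OF h cl cl, of "y - z" z] T_add[of "y - z" z] Free_diff[OF y z] z by simp
    then show ?thesis
      using c[OF Free_diff[OF y z]] c[OF z] by (simp add: S.minus_eq S.a_assoc S.r_neg)
  qed
  have "f (Rel #>\<^bsub>Free\<^esub> x) = g (Rel #>\<^bsub>Free\<^esub> x)"
  proof (rule free_Abelian_group_induct[where P = "\<lambda>x. f (Rel #>\<^bsub>Free\<^esub> x) = g (Rel #>\<^bsub>Free\<^esub> x)",
        OF x[unfolded carrier_free_Abelian_group_iff]])
    have "Rel #>\<^bsub>Free\<^esub> 0 = \<zero>\<^bsub>T\<^esub>"
      using Fr.coset_mult_one[of Rel] Rel.subset by (simp add: tensor_simps)
    then show "f (Rel #>\<^bsub>Free\<^esub> 0) = g (Rel #>\<^bsub>Free\<^esub> 0)"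
      using additive_map_zero[OF Tab.abelian_group_axioms S f] additive_map_zero[OF Tab.abelian_group_axioms S g]
      by simp
  qed (use eq h[OF f] h[OF g] in \<open>auto simp: pure_tensor_def\<close>)
  with Xx show ?thesis by simp
qed

text \<open>The additive extension of \<open>\<beta>\<close> to the free group sends the three kinds
  of relators to zero by biadditivity and balancedness, so it factors through the quotient.\<close>

lemma universal:
  assumes S: "abelian_group S"
    and closed: "\<And>u v. u \<in> carrier U \<Longrightarrow> v \<in> carrier V \<Longrightarrow> \<beta> u v \<in> carrier S"
    and add_left: "\<And>u u' v. u \<in> carrier U \<Longrightarrow> u' \<in> carrier U \<Longrightarrow> v \<in> carrier V \<Longrightarrow>
      \<beta> (u \<oplus>\<^bsub>U\<^esub> u') v = \<beta> u v \<oplus>\<^bsub>S\<^esub> \<beta> u' v"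
    and add_right: "\<And>u v v'. u \<in> carrier U \<Longrightarrow> v \<in> carrier V \<Longrightarrow> v' \<in> carrier V \<Longrightarrow>
      \<beta> u (v \<oplus>\<^bsub>V\<^esub> v') = \<beta> u v \<oplus>\<^bsub>S\<^esub> \<beta> u v'"
    and balanced: "\<And>u d v. u \<in> carrier U \<Longrightarrow> d \<in> carrier D \<Longrightarrow> v \<in> carrier V \<Longrightarrow>
      \<beta> (ract U u d) v = \<beta> u (lact V d v)"
  obtains \<Phi> where "additive_map T S \<Phi>"
    "\<And>u v. u \<in> carrier U \<Longrightarrow> v \<in> carrier V \<Longrightarrow> \<Phi> (pt u v) = \<beta> u v"
proof -
  interpret S: abelian_group S by fact
  let ?S = "add_monoid S"
  have "(\<lambda>(u, v). \<beta> u v) ` (carrier U \<times> carrier V) \<subseteq> carrier ?S"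
    using closed by auto
  from comm_group.free_Abelian_group_universal[OF S.a_comm_group this]
  obtain h where h: "h \<in> hom Free ?S"
    and h_of: "\<And>p. p \<in> carrier U \<times> carrier V \<Longrightarrow> h (frag_of p) = (\<lambda>(u, v). \<beta> u v) p"
    by blast
  interpret h: group_hom Free ?S h
    using h by (intro group_hom.intro group_hom_axioms.intro Fr.is_group S.a_group)
  have h_add: "h (x + y) = h x \<oplus>\<^bsub>S\<^esub> h y" if "x \<in> carrier Free" "y \<in> carrier Free" for x y
    using h.hom_mult[OF that] by simp
  have h_cl: "h x \<in> carrier S" if "x \<in> carrier Free" for x
    using h.hom_closed[OF that] by simp
  have h_diff: "h (x - y) = h x \<ominus>\<^bsub>S\<^esub> h y" if xy: "x \<in> carrier Free" "y \<in> carrier Free" for x y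
  proof -
    have k: "x - y \<in> carrier Free" using xy by (rule Free_diff)
    have "h x = h (x - y) \<oplus>\<^bsub>S\<^esub> h y" using h_add[OF k xy(2)] by simp
    then show ?thesis
      using h_cl[OF k] h_cl[OF xy(2)] by (simp add: S.minus_eq S.a_assoc S.r_neg)
  qed
  have "Rel \<subseteq> kernel Free ?S h"
    unfolding tensor_relations_def
  proof (rule Fr.generate_subgroup_incl[OF _ h.subgroup_kernel])
    have "h r = \<zero>\<^bsub>S\<^esub>" if "r \<in> tensor_relators D U V" for r
      using that
    proof (cases rule: relator_cases)
      case (left u u' v)
      then show ?thesis
        using S.r_neg[of "\<beta> u v \<oplus>\<^bsub>S\<^esub> \<beta> u' v"]
        by (simp add: h_diff h_of Free_diff add_left closed S.minus_eq S.minus_add S.a_ac del: carrier_free_Abelian_group_iff)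
    next
      case (right u v v')
      then show ?thesis
        using S.r_neg[of "\<beta> u v \<oplus>\<^bsub>S\<^esub> \<beta> u v'"]
        by (simp add: h_diff h_of Free_diff add_right closed S.minus_eq S.minus_add S.a_ac del: carrier_free_Abelian_group_iff)
    next
      case (balanced u d v)
      then show ?thesis
        by (simp add: h_diff h_of U.ract_closed V.lact_closed assms(5) closed S.minus_eq S.r_neg
            del: carrier_free_Abelian_group_iff)
    qed
    then show "tensor_relators D U V \<subseteq> kernel Free ?S h"
      using relators_closed unfolding kernel_def by (auto simp del: carrier_free_Abelian_group_iff)
  qed
  from h.FactGroup_universal_kernel[OF Rel.normal_axioms this]
  obtain \<Phi> where \<Phi>: "\<Phi> \<in> hom (Free Mod Rel) ?S"
    and \<Phi>_coset: "\<And>x. x \<in> carrier Free \<Longrightarrow> \<Phi> (Rel #>\<^bsub>Free\<^esub> x) = h x" by blast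
  show thesis
  proof
    show "additive_map T S \<Phi>"
      using \<Phi> by (auto simp: additive_map_def hom_def tensor_simps)
    show "\<Phi> (pt u v) = \<beta> u v" if "u \<in> carrier U" "v \<in> carrier V" for u v
      using that by (simp add: pure_tensor_def \<Phi>_coset h_of)
  qed
qed

text \<open>\<open>tensor_map\<close> is a formula on sets, and that it sends cosets to cosets has
  to be shown. It suffices that relators are mapped into \<open>Rel\<close>, because the elements of
  the free group mapped into \<open>Rel\<close> form a subgroup.\<close>

lemma tensor_map_coset:
  assumes \<phi>: "\<And>p. p \<in> carrier U \<times> carrier V \<Longrightarrow> \<phi> p \<in> carrier U \<times> carrier V"
    and rel: "\<And>r. r \<in> tensor_relators D U V \<Longrightarrow> frag_extend (\<lambda>p. frag_of (\<phi> p)) r \<in> Rel"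
  shows "additive_map T T (tensor_map D U V \<phi>)"
    and "\<And>u v. u \<in> carrier U \<Longrightarrow> v \<in> carrier V \<Longrightarrow> tensor_map D U V \<phi> (pt u v) = pt (fst (\<phi> (u, v))) (snd (\<phi> (u, v)))"
proof -
  let ?h = "frag_extend (\<lambda>p. frag_of (\<phi> p))"
  have h_cl: "?h x \<in> carrier Free" if x: "x \<in> carrier Free" for x
  proof -
    have "Poly_Mapping.keys (?h x) \<subseteq> (\<Union>p\<in>Poly_Mapping.keys x. Poly_Mapping.keys (frag_of (\<phi> p)))"
      by (rule keys_frag_extend)
    also have "\<dots> \<subseteq> carrier U \<times> carrier V"
      using x \<phi> by (intro UN_least) (simp add: subsetD)
    finally show ?thesis by simp
  qed
  have "?h \<in> hom Free Free"
    using h_cl by (auto simp: hom_def frag_extend_add simp del: carrier_free_Abelian_group_iff)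
  then interpret h: group_hom Free Free ?h
    by (intro group_hom.intro group_hom_axioms.intro Fr.is_group)
  have "subgroup {x \<in> carrier Free. ?h x \<in> Rel} Free"
  proof (rule subgroup.intro)
    fix x y assume "x \<in> {x \<in> carrier Free. ?h x \<in> Rel}"
    then have x: "x \<in> carrier Free" "?h x \<in> Rel" by blast+
    show "inv\<^bsub>Free\<^esub> x \<in> {x \<in> carrier Free. ?h x \<in> Rel}"
      using Rel.m_inv_closed[OF x(2)] unfolding h.hom_inv[OF x(1), symmetric]
      by (intro CollectI conjI Fr.inv_closed x(1))
    assume "y \<in> {x \<in> carrier Free. ?h x \<in> Rel}"
    then have y: "y \<in> carrier Free" "?h y \<in> Rel" by blast+
    show "x \<otimes>\<^bsub>Free\<^esub> y \<in> {x \<in> carrier Free. ?h x \<in> Rel}"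
      using Rel.m_closed[OF x(2) y(2)] unfolding h.hom_mult[OF x(1) y(1), symmetric]
      by (intro CollectI conjI Fr.m_closed x(1) y(1))
  next
    show "\<one>\<^bsub>Free\<^esub> \<in> {x \<in> carrier Free. ?h x \<in> Rel}"
      using Rel.one_closed h.hom_one by (intro CollectI conjI Fr.one_closed) (simp only:)
  qed blast
  then have "Rel \<subseteq> {x \<in> carrier Free. ?h x \<in> Rel}"
    unfolding tensor_relations_def
    using rel relators_closed
    by (intro Fr.generate_subgroup_incl) (auto simp: tensor_relations_def simp del: carrier_free_Abelian_group_iff)
  then have h_Rel: "?h r \<in> Rel" if "r \<in> Rel" for r using that by blast
  have coset: "tensor_map D U V \<phi> (Rel #>\<^bsub>Free\<^esub> x) = Rel #>\<^bsub>Free\<^esub> ?h x" if x: "x \<in> carrier Free" for x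
  proof -
    have mem: "y \<in> Rel #>\<^bsub>Free\<^esub> z \<longleftrightarrow> (\<exists>r\<in>Rel. y = r + z)" for y z
      by (auto simp: r_coset_def)
    have bex: "(\<exists>z\<in>Rel #>\<^bsub>Free\<^esub> x. Q z) \<longleftrightarrow> (\<exists>s\<in>Rel. Q (s + x))" for Q
      by (auto simp: mem)
    \<comment> \<open>As \<open>Rel\<close> is mapped into itself, the summand from
      \<open>Rel\<close> chosen inside the coset is absorbed by the one outside.\<close>
    have "y \<in> tensor_map D U V \<phi> (Rel #>\<^bsub>Free\<^esub> x) \<longleftrightarrow> (\<exists>r\<in>Rel. \<exists>s\<in>Rel. y = r + ?h (s + x))" for y
      by (simp add: tensor_map_def set_mult_def bex)
    also have "(\<exists>r\<in>Rel. \<exists>s\<in>Rel. y = r + ?h (s + x)) \<longleftrightarrow> (\<exists>r\<in>Rel. y = r + ?h x)" for y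
    proof (intro iffI; elim bexE)
      fix r s assume r: "r \<in> Rel" and s: "s \<in> Rel" and y: "y = r + ?h (s + x)"
      have "r + ?h s \<in> Rel" using Rel.m_closed[OF r h_Rel[OF s]] by simp
      then show "\<exists>r\<in>Rel. y = r + ?h x" unfolding y by (intro bexI) (simp add: frag_extend_add)
    next
      fix r assume "r \<in> Rel" "y = r + ?h x"
      then show "\<exists>r\<in>Rel. \<exists>s\<in>Rel. y = r + ?h (s + x)"
        using Rel.one_closed by (intro bexI[of _ r] bexI[of _ 0]) auto
    qed
    finally show ?thesis by (simp add: set_eq_iff mem)
  qed
  show "additive_map T T (tensor_map D U V \<phi>)"
  proof (rule additive_mapI)
    show "X \<in> carrier T \<Longrightarrow> tensor_map D U V \<phi> X \<in> carrier T" for X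
      using h_cl by (auto simp: T_carrier coset simp del: carrier_free_Abelian_group_iff)
    fix X Y assume "X \<in> carrier T" "Y \<in> carrier T"
    then obtain x y where x: "x \<in> carrier Free" "X = Rel #>\<^bsub>Free\<^esub> x"
      and y: "y \<in> carrier Free" "Y = Rel #>\<^bsub>Free\<^esub> y" by (auto simp: T_carrier)
    have "x + y \<in> carrier Free" using x y Fr.m_closed[of x y] by simp
    then show "tensor_map D U V \<phi> (X \<oplus>\<^bsub>T\<^esub> Y) = tensor_map D U V \<phi> X \<oplus>\<^bsub>T\<^esub> tensor_map D U V \<phi> Y"
      using x y h_cl by (simp add: T_add coset frag_extend_add del: carrier_free_Abelian_group_iff)
  qed
  show "tensor_map D U V \<phi> (pt u v) = pt (fst (\<phi> (u, v))) (snd (\<phi> (u, v)))"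
    if "u \<in> carrier U" "v \<in> carrier V" for u v
    using that by (simp add: pure_tensor_def coset)
qed

text \<open>An additive map commuting with the action of D sends each relator to a relator of the
  same kind.\<close>

lemma tensor_map_left:
  assumes f: "additive_map U U f"
    and fr: "\<And>u d. u \<in> carrier U \<Longrightarrow> d \<in> carrier D \<Longrightarrow> f (ract U u d) = ract U (f u) d"
  shows "additive_map T T (tensor_map D U V (\<lambda>(u, v). (f u, v)))"
    and "\<And>u v. u \<in> carrier U \<Longrightarrow> v \<in> carrier V \<Longrightarrow>
      tensor_map D U V (\<lambda>(u, v). (f u, v)) (pt u v) = pt (f u) v"
proof -
  have 1: "(case p of (u, v) \<Rightarrow> (f u, v)) \<in> carrier U \<times> carrier V" if "p \<in> carrier U \<times> carrier V" for p
    using that additive_map_closed[OF f] by auto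
  have "frag_extend (\<lambda>p. frag_of (case p of (u, v) \<Rightarrow> (f u, v))) r \<in> tensor_relators D U V"
    if r: "r \<in> tensor_relators D U V" for r
    using r
    by (cases rule: relator_cases)
      (simp_all add: frag_extend_diff additive_map_add[OF f] fr additive_map_closed[OF f]
        relator_left relator_right relator_balanced)
  then have 2: "frag_extend (\<lambda>p. frag_of (case p of (u, v) \<Rightarrow> (f u, v))) r \<in> Rel"
    if r: "r \<in> tensor_relators D U V" for r
    using r by (intro Rel_relator)
  show "additive_map T T (tensor_map D U V (\<lambda>(u, v). (f u, v)))"
    by (rule tensor_map_coset(1)[OF 1 2])
  show "tensor_map D U V (\<lambda>(u, v). (f u, v)) (pt u v) = pt (f u) v"
    if "u \<in> carrier U" "v \<in> carrier V" for u v
    using tensor_map_coset(2)[OF 1 2 that] by simp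
qed

lemma tensor_map_right:
  assumes f: "additive_map V V f"
    and fl: "\<And>v d. v \<in> carrier V \<Longrightarrow> d \<in> carrier D \<Longrightarrow> f (lact V d v) = lact V d (f v)"
  shows "additive_map T T (tensor_map D U V (\<lambda>(u, v). (u, f v)))"
    and "\<And>u v. u \<in> carrier U \<Longrightarrow> v \<in> carrier V \<Longrightarrow>
      tensor_map D U V (\<lambda>(u, v). (u, f v)) (pt u v) = pt u (f v)"
proof -
  have 1: "(case p of (u, v) \<Rightarrow> (u, f v)) \<in> carrier U \<times> carrier V" if "p \<in> carrier U \<times> carrier V" for p
    using that additive_map_closed[OF f] by auto
  have "frag_extend (\<lambda>p. frag_of (case p of (u, v) \<Rightarrow> (u, f v))) r \<in> tensor_relators D U V"
    if r: "r \<in> tensor_relators D U V" for r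
    using r
    by (cases rule: relator_cases)
      (simp_all add: frag_extend_diff additive_map_add[OF f] fl additive_map_closed[OF f]
        relator_left relator_right relator_balanced)
  then have 2: "frag_extend (\<lambda>p. frag_of (case p of (u, v) \<Rightarrow> (u, f v))) r \<in> Rel"
    if r: "r \<in> tensor_relators D U V" for r
    using r by (intro Rel_relator)
  show "additive_map T T (tensor_map D U V (\<lambda>(u, v). (u, f v)))"
    by (rule tensor_map_coset(1)[OF 1 2])
  show "tensor_map D U V (\<lambda>(u, v). (u, f v)) (pt u v) = pt u (f v)"
    if "u \<in> carrier U" "v \<in> carrier V" for u v
    using tensor_map_coset(2)[OF 1 2 that] by simp
qed

lemma
  assumes c: "c \<in> carrier C"
  shows T_lact_additive: "additive_map T T (lact T c)"
    and T_lact: "\<And>u v. u \<in> carrier U \<Longrightarrow> v \<in> carrier V \<Longrightarrow> lact T c (pt u v) = pt (lact U c u) v"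
  using tensor_map_left[OF U.lact_additive[OF c]] c by (simp_all add: tensor_simps U.lact_ract)

lemma
  assumes e: "e \<in> carrier E"
  shows T_ract_additive: "additive_map T T (\<lambda>X. ract T X e)"
    and T_ract: "\<And>u v. u \<in> carrier U \<Longrightarrow> v \<in> carrier V \<Longrightarrow> ract T (pt u v) e = pt u (ract V v e)"
  using tensor_map_right[OF V.ract_additive[OF e]] e by (simp_all add: tensor_simps V.lact_ract)

lemma
  assumes k: "k \<in> carrier K"
  shows T_smult_additive: "additive_map T T (smult T k)"
    and T_smult: "\<And>u v. u \<in> carrier U \<Longrightarrow> v \<in> carrier V \<Longrightarrow> k \<odot>\<^bsub>T\<^esub> pt u v = pt (k \<odot>\<^bsub>U\<^esub> u) v"
proof -
  interpret v: vectorspace K U by (rule U.vs)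
  have "additive_map U U (\<lambda>u. k \<odot>\<^bsub>U\<^esub> u)"
    using k by (intro additive_mapI) (auto simp: v.smult_r_distr)
  from tensor_map_left[OF this] k
  show "additive_map T T (smult T k)"
    and "\<And>u v. u \<in> carrier U \<Longrightarrow> v \<in> carrier V \<Longrightarrow> k \<odot>\<^bsub>T\<^esub> pt u v = pt (k \<odot>\<^bsub>U\<^esub> u) v"
    by (simp_all add: tensor_simps U.ract_smult_left)
qed

text \<open>Linearity and equivariance are compared on pure tensors, which requires the actions on
  the target to be additive. The target is described by just these actions, so that it may itself be
  a tensor product.\<close>

lemma universal_hom:
  fixes S :: "('k, 'c, 'e, 's) bimodule"
  assumes ab: "abelian_group S"
    and S_smult: "\<And>k. k \<in> carrier K \<Longrightarrow> additive_map S S (smult S k)"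
    and S_lact: "\<And>c. c \<in> carrier C \<Longrightarrow> additive_map S S (lact S c)"
    and S_ract: "\<And>e. e \<in> carrier E \<Longrightarrow> additive_map S S (\<lambda>s. ract S s e)"
    and closed: "\<And>u v. u \<in> carrier U \<Longrightarrow> v \<in> carrier V \<Longrightarrow> \<beta> u v \<in> carrier S"
    and add_left: "\<And>u u' v. u \<in> carrier U \<Longrightarrow> u' \<in> carrier U \<Longrightarrow> v \<in> carrier V \<Longrightarrow>
      \<beta> (u \<oplus>\<^bsub>U\<^esub> u') v = \<beta> u v \<oplus>\<^bsub>S\<^esub> \<beta> u' v"
    and add_right: "\<And>u v v'. u \<in> carrier U \<Longrightarrow> v \<in> carrier V \<Longrightarrow> v' \<in> carrier V \<Longrightarrow>
      \<beta> u (v \<oplus>\<^bsub>V\<^esub> v') = \<beta> u v \<oplus>\<^bsub>S\<^esub> \<beta> u v'"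
    and balanced: "\<And>u d v. u \<in> carrier U \<Longrightarrow> d \<in> carrier D \<Longrightarrow> v \<in> carrier V \<Longrightarrow>
      \<beta> (ract U u d) v = \<beta> u (lact V d v)"
    and smult: "\<And>k u v. k \<in> carrier K \<Longrightarrow> u \<in> carrier U \<Longrightarrow> v \<in> carrier V \<Longrightarrow>
      \<beta> (k \<odot>\<^bsub>U\<^esub> u) v = k \<odot>\<^bsub>S\<^esub> \<beta> u v"
    and lact: "\<And>c u v. c \<in> carrier C \<Longrightarrow> u \<in> carrier U \<Longrightarrow> v \<in> carrier V \<Longrightarrow>
      \<beta> (lact U c u) v = lact S c (\<beta> u v)"
    and ract: "\<And>u v e. u \<in> carrier U \<Longrightarrow> v \<in> carrier V \<Longrightarrow> e \<in> carrier E \<Longrightarrow>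
      \<beta> u (ract V v e) = ract S (\<beta> u v) e"
  obtains \<Phi> where "\<Phi> \<in> bimodule_hom K C E T S"
    "\<And>u v. u \<in> carrier U \<Longrightarrow> v \<in> carrier V \<Longrightarrow> \<Phi> (pt u v) = \<beta> u v"
proof -
  interpret Uv: vectorspace K U by (rule U.vs)
  obtain \<Phi> where \<Phi>: "additive_map T S \<Phi>"
    and pt: "\<And>u v. u \<in> carrier U \<Longrightarrow> v \<in> carrier V \<Longrightarrow> \<Phi> (pt u v) = \<beta> u v"
    using universal[OF ab closed add_left add_right balanced] by blast
  have "\<Phi> \<in> bimodule_hom K C E T S"
  proof (rule bimodule_homI)
    show "\<Phi> (k \<odot>\<^bsub>T\<^esub> X) = k \<odot>\<^bsub>S\<^esub> \<Phi> X" if k: "k \<in> carrier K" and X: "X \<in> carrier T" for k X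
      by (rule additive_eqI[OF ab additive_map_compose[OF T_smult_additive[OF k] \<Phi>]
            additive_map_compose[OF \<Phi> S_smult[OF k]] _ X])
        (use k in \<open>simp add: T_smult pt smult Uv.smult_closed\<close>)
    show "\<Phi> (lact T c X) = lact S c (\<Phi> X)" if c: "c \<in> carrier C" and X: "X \<in> carrier T" for c X
      by (rule additive_eqI[OF ab additive_map_compose[OF T_lact_additive[OF c] \<Phi>]
            additive_map_compose[OF \<Phi> S_lact[OF c]] _ X])
        (use c in \<open>simp add: T_lact pt lact U.lact_closed\<close>)
    show "\<Phi> (ract T X e) = ract S (\<Phi> X) e" if e: "e \<in> carrier E" and X: "X \<in> carrier T" for e X
      by (rule additive_eqI[OF ab additive_map_compose[OF T_ract_additive[OF e] \<Phi>]
            additive_map_compose[OF \<Phi> S_ract[OF e]] _ X])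
        (use e in \<open>simp add: T_ract pt ract V.ract_closed\<close>)
  qed (simp_all add: additive_map_closed[OF \<Phi>] additive_map_add[OF \<Phi>])
  with pt show thesis by (rule that[rotated])
qed

end

section \<open>Tensor products of matrix bimodules\<close>

context graded_alg
begin

lemma diag_sum: "finsum (Beilinson_Green G A \<A>) diag (carrier G) = \<one>\<^bsub>Beilinson_Green G A \<A>\<^esub>"
  by (rule side.\<epsilon>_sum[OF side_Beilinson_Green sp.grp.one_closed])

lemma diag_idem: "g \<in> carrier G \<Longrightarrow> mmul G A (monoid.mult A) (diag g) (diag g) = diag g"
  using side.\<epsilon>_orth[OF side_Beilinson_Green, of g g] by simp

end

context graded_bimod
begin

text \<open>Both sides are the matrix whose only entry is u (g, h) in its own place: by homogeneity
  row g of the \<open>spread\<close> of u (g, h) is zero outside column h. This connects tensors of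
  entries with tensors of whole matrices.\<close>

lemma matrix_unit_row:
  assumes u: "u \<in> matrices G \<U>" and gh: "g \<in> carrier G" "h \<in> carrier G"
  shows "mmul G U (lact U) (C.diag g) (spread G U \<U> (u (g, h))) =
    mmul G U (ract U) (mmul G U (lact U) (C.diag g) u) (D.diag h)"
proof (rule matrix_ext[OF mmul_extensional mmul_extensional])
  fix g' l assume gl: "g' \<in> carrier G" "l \<in> carrier G"
  have uc: "u (g, h) \<in> carrier U" using sp.matrices_carrier u gh by blast
  have m: "mmul G U (lact U) (C.diag g) u \<in> matrices G \<U>"
    using gh u by (intro L.mmul_matrices C.diag_closed)
  show "mmul G U (lact U) (C.diag g) (spread G U \<U> (u (g, h))) (g', l) =
    mmul G U (ract U) (mmul G U (lact U) (C.diag g) u) (D.diag h) (g', l)"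
    using gl gh u m uc sp.hcomp_entry_row[OF u gh gl(2)]
    by (cases "g' = g")
      (auto simp: L.mmul_matrix_unit_left R.mmul_matrix_unit_right[where s = h] sp.spread_matrices lact_one ract_one
        ract_zero D.rg.one_closed C.rg.one_closed L.mmul_matrix_unit_left[where s = g] simp del: mmul_entry)
qed

lemma matrix_unit_col:
  assumes u: "u \<in> matrices G \<U>" and hl: "h \<in> carrier G" "l \<in> carrier G"
  shows "mmul G U (ract U) (spread G U \<U> (u (h, l))) (D.diag l) =
    mmul G U (lact U) (C.diag h) (mmul G U (ract U) u (D.diag l))"
proof (rule matrix_ext[OF mmul_extensional mmul_extensional])
  fix g l' assume gl: "g \<in> carrier G" "l' \<in> carrier G"
  have uc: "u (h, l) \<in> carrier U" using sp.matrices_carrier u hl by blast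
  have m: "mmul G U (ract U) u (D.diag l) \<in> matrices G \<U>"
    using hl u by (intro R.mmul_matrices D.diag_closed)
  show "mmul G U (ract U) (spread G U \<U> (u (h, l))) (D.diag l) (g, l') =
    mmul G U (lact U) (C.diag h) (mmul G U (ract U) u (D.diag l)) (g, l')"
    using gl hl u m uc sp.hcomp_entry_col[OF u hl gl(1)]
    by (cases "l' = l")
      (auto simp: L.mmul_matrix_unit_left[where s = h] R.mmul_matrix_unit_right[where s = l] sp.spread_matrices lact_one ract_one
        lact_zero D.rg.one_closed C.rg.one_closed simp del: mmul_entry)
qed

text \<open>The expansion of a matrix into corners of blocks; for windows equal to the whole group a
  block is \<open>spread\<close>.\<close>

lemma bar_expansion:
  assumes u: "u \<in> matrices G \<U>"
  shows "(\<Oplus>\<^bsub>bar G U \<U>\<^esub>g\<in>carrier G. \<Oplus>\<^bsub>bar G U \<U>\<^esub>l\<in>carrier G.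
    mmul G U (lact U) (C.diag g) (mmul G U (ract U) (spread G U \<U> (u (g, l))) (D.diag l))) = u"
proof -
  interpret t: transfer G K C \<C> "Beilinson_Green G C \<C>" "spread G C \<C>" C.diag "\<lambda>_. carrier G" "\<lambda>a. a"
    D \<D> "Beilinson_Green G D \<D>" "spread G D \<D>" D.diag "\<lambda>_. carrier G" "\<lambda>a. a" U \<U> "bar G U \<U>"
    by (rule transfer_bar)
  have "t.block (carrier G) (carrier G) m = spread G U \<U> m" for m
    by (rule matrix_ext[OF t.block_extensional spread_extensional]) (simp add: t.block_entry)
  with t.corner_expansion[OF u] show ?thesis
    by (simp add: t.corner_def)
qed

end

locale graded_pair =
  M: graded_bimod G K A \<A> B \<B> M \<M> + N: graded_bimod G K B \<B> C \<C> N \<N>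
  for G :: "('g, 'p) monoid_scheme" and K :: "('k, 'q) ring_scheme"
    and A :: "('k, 'a) module" and \<A> and B :: "('k, 'b) module" and \<B>
    and C :: "('k, 'c) module" and \<C>
    and M :: "('k, 'a, 'b, 'm) bimodule" and \<M>
    and N :: "('k, 'b, 'c, 'n) bimodule" and \<N>
begin

sublocale t: bimodule_pair K A B C M N
  by (intro bimodule_pair.intro M.bimodule_axioms N.bimodule_axioms)

sublocale bt: bimodule_pair K "Beilinson_Green G A \<A>" "Beilinson_Green G B \<B>" "Beilinson_Green G C \<C>"
    "bar G M \<M>" "bar G N \<N>"
  by (intro bimodule_pair.intro M.bimodule_bar N.bimodule_bar)

abbreviation "row g m \<equiv> mmul G M (lact M) (M.C.diag g) m"
abbreviation "col l n \<equiv> mmul G N (ract N) n (N.D.diag l)"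

lemma row_closed: "g \<in> carrier G \<Longrightarrow> m \<in> matrices G \<M> \<Longrightarrow> row g m \<in> matrices G \<M>"
  by (intro M.L.mmul_matrices M.C.diag_closed)

lemma col_closed: "l \<in> carrier G \<Longrightarrow> n \<in> matrices G \<N> \<Longrightarrow> col l n \<in> matrices G \<N>"
  by (intro N.R.mmul_matrices N.D.diag_closed)

lemma row_add: "g \<in> carrier G \<Longrightarrow> m \<in> matrices G \<M> \<Longrightarrow> m' \<in> matrices G \<M> \<Longrightarrow>
    row g (m \<oplus>\<^bsub>bar G M \<M>\<^esub> m') = row g m \<oplus>\<^bsub>bar G M \<M>\<^esub> row g m'"
  by (simp add: M.L.mmul_add_right M.C.diag_closed)

lemma col_add: "l \<in> carrier G \<Longrightarrow> n \<in> matrices G \<N> \<Longrightarrow> n' \<in> matrices G \<N> \<Longrightarrow>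
    col l (n \<oplus>\<^bsub>bar G N \<N>\<^esub> n') = col l n \<oplus>\<^bsub>bar G N \<N>\<^esub> col l n'"
  by (simp add: N.R.mmul_add_left N.D.diag_closed)

lemma spread_M_add: "m \<in> carrier M \<Longrightarrow> m' \<in> carrier M \<Longrightarrow>
    spread G M \<M> (m \<oplus>\<^bsub>M\<^esub> m') = spread G M \<M> m \<oplus>\<^bsub>bar G M \<M>\<^esub> spread G M \<M> m'"
  by (rule matrix_ext[OF spread_extensional]) (auto simp: M.sp.hcomp_add)

lemma spread_N_add: "n \<in> carrier N \<Longrightarrow> n' \<in> carrier N \<Longrightarrow>
    spread G N \<N> (n \<oplus>\<^bsub>N\<^esub> n') = spread G N \<N> n \<oplus>\<^bsub>bar G N \<N>\<^esub> spread G N \<N> n'"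
  by (rule matrix_ext[OF spread_extensional]) (auto simp: N.sp.hcomp_add)

text \<open>The point is balancedness: \<open>spread\<close> turns the action of b into that of
  \<open>spread b\<close>, which commutes with the outer idempotents at g and l and can be moved
  across a tensor over the Beilinson--Green algebra.\<close>

lemma entry_map_exists:
  assumes g: "g \<in> carrier G" and l: "l \<in> carrier G"
  shows "\<exists>\<Psi>. additive_map t.T bt.T \<Psi> \<and> (\<forall>m\<in>carrier M. \<forall>n\<in>carrier N.
    \<Psi> (t.pt m n) = bt.pt (row g (spread G M \<M> m)) (col l (spread G N \<N> n)))"
proof -
  note cl = row_closed[OF g M.sp.spread_matrices] col_closed[OF l N.sp.spread_matrices]
    M.sp.spread_matrices N.sp.spread_matrices M.D.sp.spread_matrices
  have bal: "bt.pt (row g (spread G M \<M> (ract M m b))) (col l (spread G N \<N> n)) =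
      bt.pt (row g (spread G M \<M> m)) (col l (spread G N \<N> (lact N b n)))"
    if "m \<in> carrier M" "b \<in> carrier B" "n \<in> carrier N" for m b n
  proof -
    have "row g (spread G M \<M> (ract M m b)) = mmul G M (ract M) (row g (spread G M \<M> m)) (spread G B \<B> b)"
      using that g mmul_assoc[OF M.L.graded_pairing_axioms M.R.graded_pairing_axioms
          M.R.graded_pairing_axioms M.L.graded_pairing_axioms]
      by (simp add: M.R.spread_pairing M.lact_ract M.C.diag_closed cl)
    moreover have "col l (spread G N \<N> (lact N b n)) = mmul G N (lact N) (spread G B \<B> b) (col l (spread G N \<N> n))"
      using that l mmul_assoc[OF N.L.graded_pairing_axioms N.R.graded_pairing_axioms
          N.R.graded_pairing_axioms N.L.graded_pairing_axioms]
      by (simp add: N.L.spread_pairing N.lact_ract N.D.diag_closed cl)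
    ultimately show ?thesis
      using bt.pt_balanced[of "row g (spread G M \<M> m)" "spread G B \<B> b" "col l (spread G N \<N> n)"] that
      by (simp add: cl)
  qed
  obtain \<Psi> where "additive_map t.T bt.T \<Psi>"
    "\<And>m n. m \<in> carrier M \<Longrightarrow> n \<in> carrier N \<Longrightarrow>
      \<Psi> (t.pt m n) = bt.pt (row g (spread G M \<M> m)) (col l (spread G N \<N> n))"
    by (rule t.universal[OF bt.Tab.abelian_group_axioms,
          where \<beta> = "\<lambda>m n. bt.pt (row g (spread G M \<M> m)) (col l (spread G N \<N> n))"])
      (use cl in \<open>simp_all add: bt.pt_closed spread_M_add spread_N_add row_add[OF g] col_add[OF l]
        bt.pt_add_left bt.pt_add_right bal del: bar_simps(3)\<close>)
  then show ?thesis by blast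
qed

definition entry_map :: "'g \<Rightarrow> 'g \<Rightarrow> ('m \<times> 'n \<Rightarrow>\<^sub>0 int) set \<Rightarrow>
    (('g \<times> 'g \<Rightarrow> 'm) \<times> ('g \<times> 'g \<Rightarrow> 'n) \<Rightarrow>\<^sub>0 int) set"
  where "entry_map g l = (SOME \<Psi>. additive_map t.T bt.T \<Psi> \<and> (\<forall>m\<in>carrier M. \<forall>n\<in>carrier N.
    \<Psi> (t.pt m n) = bt.pt (row g (spread G M \<M> m)) (col l (spread G N \<N> n))))"

lemma
  assumes "g \<in> carrier G" "l \<in> carrier G"
  shows entry_map_additive: "additive_map t.T bt.T (entry_map g l)"
    and entry_map_pt: "\<And>m n. m \<in> carrier M \<Longrightarrow> n \<in> carrier N \<Longrightarrow>
      entry_map g l (t.pt m n) = bt.pt (row g (spread G M \<M> m)) (col l (spread G N \<N> n))"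
  using someI_ex[OF entry_map_exists[OF assms]] by (simp_all add: entry_map_def)

text \<open>The sum over h uses completeness of the inner idempotents, the sums over l and g that of
  the outer ones. On pure tensors this is the statement that splitting into entries and reassembling
  gives back the tensor.\<close>

lemma pt_expansion:
  assumes m: "m \<in> matrices G \<M>" and n: "n \<in> matrices G \<N>"
  shows "(\<Oplus>\<^bsub>bt.T\<^esub>g\<in>carrier G. \<Oplus>\<^bsub>bt.T\<^esub>l\<in>carrier G. \<Oplus>\<^bsub>bt.T\<^esub>h\<in>carrier G.
    bt.pt (row g (spread G M \<M> (m (g, h)))) (col l (spread G N \<N> (n (h, l))))) = bt.pt m n"
proof -
  note diag = M.C.diag_closed M.D.diag_closed N.D.diag_closed
  have h_sum: "(\<Oplus>\<^bsub>bt.T\<^esub>h\<in>carrier G. bt.pt (row g (spread G M \<M> (m (g, h)))) (col l (spread G N \<N> (n (h, l))))) =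
      bt.pt (row g m) (col l n)" if gl: "g \<in> carrier G" "l \<in> carrier G" for g l
  proof -
    let ?x = "row g m" and ?y = "col l n"
    have x: "?x \<in> matrices G \<M>" and y: "?y \<in> matrices G \<N>"
      using gl m n by (auto intro: row_closed col_closed)
    have "bt.pt (row g (spread G M \<M> (m (g, h)))) (col l (spread G N \<N> (n (h, l)))) =
        bt.pt ?x (lact (bar G N \<N>) (M.D.diag h) ?y)" if h: "h \<in> carrier G" for h
    proof -
      have y': "mmul G N (lact N) (M.D.diag h) ?y \<in> matrices G \<N>"
        using h y by (intro N.L.mmul_matrices diag)
      \<comment> \<open>A tensor of entries is \<open>e\<^sub>g m e\<^sub>h\<close> tensored with
        \<open>e\<^sub>h n e\<^sub>l\<close>; the left copy of the inner idempotent is moved across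
        and absorbed by the right one.\<close>
      have "bt.pt (row g (spread G M \<M> (m (g, h)))) (col l (spread G N \<N> (n (h, l)))) =
        bt.pt (mmul G M (ract M) ?x (M.D.diag h)) (mmul G N (lact N) (M.D.diag h) ?y)"
        using m n gl h by (simp add: M.matrix_unit_row N.matrix_unit_col)
      also have "\<dots> = bt.pt ?x (mmul G N (lact N) (M.D.diag h) (mmul G N (lact N) (M.D.diag h) ?y))"
        using bt.pt_balanced[of ?x "M.D.diag h"] x y' h by (simp add: diag)
      also have "mmul G N (lact N) (M.D.diag h) (mmul G N (lact N) (M.D.diag h) ?y) = mmul G N (lact N) (M.D.diag h) ?y"
        using mmul_assoc[OF M.D.pr.graded_pairing_axioms N.L.graded_pairing_axioms
            N.L.graded_pairing_axioms N.L.graded_pairing_axioms N.lact_mult diag(2)[OF h] diag(2)[OF h] y]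
          M.D.diag_idem[OF h] by simp
      finally show ?thesis by simp
    qed
    then have "(\<Oplus>\<^bsub>bt.T\<^esub>h\<in>carrier G. bt.pt (row g (spread G M \<M> (m (g, h)))) (col l (spread G N \<N> (n (h, l))))) =
        (\<Oplus>\<^bsub>bt.T\<^esub>h\<in>carrier G. bt.pt ?x (lact (bar G N \<N>) (M.D.diag h) ?y))"
      using x y diag N.L.mmul_matrices[OF diag(2) y] by (intro bt.Tab.finsum_eqI) (simp_all add: bt.pt_closed)
    also have "\<dots> = bt.pt ?x (\<Oplus>\<^bsub>bar G N \<N>\<^esub>h\<in>carrier G. lact (bar G N \<N>) (M.D.diag h) ?y)"
      using x y diag N.L.mmul_matrices[OF diag(2) y]
      by (intro bt.pt_finsum_right[symmetric]) simp_all
    also have "(\<Oplus>\<^bsub>bar G N \<N>\<^esub>h\<in>carrier G. lact (bar G N \<N>) (M.D.diag h) ?y) =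
        lact (bar G N \<N>) (finsum (Beilinson_Green G B \<B>) M.D.diag (carrier G)) ?y"
      using y diag by (intro bt.V.lact_finsum_left[symmetric]) simp_all
    also have "\<dots> = ?y"
      using y bt.V.lact_one[of ?y] unfolding M.D.diag_sum by simp
    finally show ?thesis .
  qed
  have l_sum: "(\<Oplus>\<^bsub>bt.T\<^esub>l\<in>carrier G. bt.pt x (col l n)) = bt.pt x n" if x: "x \<in> matrices G \<M>" for x
  proof -
    have "(\<Oplus>\<^bsub>bt.T\<^esub>l\<in>carrier G. bt.pt x (col l n)) =
        bt.pt x (\<Oplus>\<^bsub>bar G N \<N>\<^esub>l\<in>carrier G. ract (bar G N \<N>) n (N.D.diag l))"
      using x n col_closed by (subst bt.pt_finsum_right) simp_all
    also have "(\<Oplus>\<^bsub>bar G N \<N>\<^esub>l\<in>carrier G. ract (bar G N \<N>) n (N.D.diag l)) =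
        ract (bar G N \<N>) n (finsum (Beilinson_Green G C \<C>) N.D.diag (carrier G))"
      using n diag by (intro bt.V.ract_finsum_right[symmetric]) simp_all
    also have "\<dots> = n"
      using n bt.V.ract_one[of n] unfolding N.D.diag_sum by simp
    finally show ?thesis .
  qed
  have "(\<Oplus>\<^bsub>bt.T\<^esub>g\<in>carrier G. \<Oplus>\<^bsub>bt.T\<^esub>l\<in>carrier G. \<Oplus>\<^bsub>bt.T\<^esub>h\<in>carrier G.
      bt.pt (row g (spread G M \<M> (m (g, h)))) (col l (spread G N \<N> (n (h, l))))) =
    (\<Oplus>\<^bsub>bt.T\<^esub>g\<in>carrier G. \<Oplus>\<^bsub>bt.T\<^esub>l\<in>carrier G. bt.pt (row g m) (col l n))"
    using m n row_closed col_closed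
    by (intro bt.Tab.finsum_eqI bt.Tab.finsum_closed) (simp_all add: h_sum bt.pt_closed)
  also have "\<dots> = (\<Oplus>\<^bsub>bt.T\<^esub>g\<in>carrier G. bt.pt (row g m) n)"
    using m n row_closed by (intro bt.Tab.finsum_eqI) (simp_all add: l_sum bt.pt_closed)
  also have "\<dots> = bt.pt (\<Oplus>\<^bsub>bar G M \<M>\<^esub>g\<in>carrier G. lact (bar G M \<M>) (M.C.diag g) m) n"
    using m n row_closed by (subst bt.pt_finsum_left) simp_all
  also have "(\<Oplus>\<^bsub>bar G M \<M>\<^esub>g\<in>carrier G. lact (bar G M \<M>) (M.C.diag g) m) =
      lact (bar G M \<M>) (finsum (Beilinson_Green G A \<A>) M.C.diag (carrier G)) m"
    using m diag by (intro bt.U.lact_finsum_left[symmetric]) simp_all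
  also have "\<dots> = m"
    using m bt.U.lact_one[of m] unfolding M.C.diag_sum by simp
  finally show ?thesis .
qed

end

text \<open>Meant for one component of an isomorphism with a direct sum. Treating the two components
  separately keeps the target a single graded bimodule and avoids matrices with entries in a direct
  sum.\<close>

locale graded_tensor_hom = graded_pair G K A \<A> B \<B> C \<C> M \<M> N \<N> + Q: graded_bimod G K A \<A> C \<C> Q \<Q>
  for G :: "('g, 'p) monoid_scheme" and K :: "('k, 'q) ring_scheme"
    and A :: "('k, 'a) module" and \<A> and B :: "('k, 'b) module" and \<B>
    and C :: "('k, 'c) module" and \<C>
    and M :: "('k, 'a, 'b, 'm) bimodule" and \<M>
    and N :: "('k, 'b, 'c, 'n) bimodule" and \<N>
    and Q :: "('k, 'a, 'c, 'z) bimodule" and \<Q> +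
  fixes \<pi> :: "('m \<times> 'n \<Rightarrow>\<^sub>0 int) set \<Rightarrow> 'z"
  assumes \<pi>: "\<pi> \<in> graded_hom G K A C (tensor_product B M N) (tensor_grading G B M \<M> N \<N>) Q \<Q>"
begin

abbreviation "tprod m n \<equiv> \<pi> (t.pt m n)"

lemma \<pi>_hom: "\<pi> \<in> bimodule_hom K A C t.T Q"
  using \<pi> by (simp add: graded_hom_def)

sublocale pr: graded_pairing G K M \<M> N \<N> Q \<Q> tprod
proof (intro graded_pairing.intro graded_pairing_axioms.intro M.sp.graded_space_axioms
    N.sp.graded_space_axioms Q.sp.graded_space_axioms)
  fix x y m n assume xy: "x \<in> carrier G" "y \<in> carrier G" and m: "m \<in> \<M> x" and n: "n \<in> \<N> y"
  have "t.pt m n \<in> tensor_grading G B M \<M> N \<N> (x \<otimes>\<^bsub>G\<^esub> y)"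
    unfolding tensor_grading_def using xy m n by (intro generate.incl) blast
  then show "tprod m n \<in> \<Q> (x \<otimes>\<^bsub>G\<^esub> y)"
    using \<pi> xy monoid.m_closed[OF group.is_monoid[OF M.C.G] xy] unfolding graded_hom_def by blast
qed (simp_all add: t.pt_closed t.pt_add_left t.pt_add_right bimodule_homD[OF \<pi>_hom])

lemma tprod_lact: "a \<in> carrier A \<Longrightarrow> m \<in> carrier M \<Longrightarrow> n \<in> carrier N \<Longrightarrow>
    tprod (lact M a m) n = lact Q a (tprod m n)"
  by (simp add: t.T_lact[symmetric] bimodule_homD[OF \<pi>_hom] t.pt_closed)

lemma tprod_ract: "c \<in> carrier C \<Longrightarrow> m \<in> carrier M \<Longrightarrow> n \<in> carrier N \<Longrightarrow>
    tprod m (ract N n c) = ract Q (tprod m n) c"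
  by (simp add: t.T_ract[symmetric] bimodule_homD[OF \<pi>_hom] t.pt_closed)

lemma mmul_tprod_lact:
  assumes "a \<in> matrices G \<A>" "m \<in> matrices G \<M>" "n \<in> matrices G \<N>"
  shows "mmul G Q tprod (mmul G M (lact M) a m) n = mmul G Q (lact Q) a (mmul G Q tprod m n)"
  by (rule mmul_assoc[OF M.L.graded_pairing_axioms pr.graded_pairing_axioms
        pr.graded_pairing_axioms Q.L.graded_pairing_axioms tprod_lact assms])

lemma mmul_tprod_ract:
  assumes "m \<in> matrices G \<M>" "n \<in> matrices G \<N>" "c \<in> matrices G \<C>"
  shows "mmul G Q tprod m (mmul G N (ract N) n c) = mmul G Q (ract Q) (mmul G Q tprod m n) c"
  by (rule mmul_assoc[OF pr.graded_pairing_axioms Q.R.graded_pairing_axioms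
        N.R.graded_pairing_axioms pr.graded_pairing_axioms _ assms, symmetric]) (simp add: tprod_ract)

lemma mmul_tprod_balanced:
  assumes "m \<in> matrices G \<M>" "b \<in> matrices G \<B>" "n \<in> matrices G \<N>"
  shows "mmul G Q tprod (mmul G M (ract M) m b) n = mmul G Q tprod m (mmul G N (lact N) b n)"
  by (rule mmul_assoc[OF M.R.graded_pairing_axioms pr.graded_pairing_axioms
        N.L.graded_pairing_axioms pr.graded_pairing_axioms _ assms]) (simp add: t.pt_balanced)

text \<open>Balancedness and equivariance of the matrix product follow from the same identities for
  entries by interchanging sums; the universal property then applies.\<close>

lemma bar_hom_exists:
  "\<exists>\<Phi>. \<Phi> \<in> bimodule_hom K (Beilinson_Green G A \<A>) (Beilinson_Green G C \<C>) bt.T (bar G Q \<Q>) \<and>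
    (\<forall>m\<in>matrices G \<M>. \<forall>n\<in>matrices G \<N>. \<Phi> (bt.pt m n) = mmul G Q tprod m n)"
proof -
  interpret bQ: bimodule K "Beilinson_Green G A \<A>" "Beilinson_Green G C \<C>" "bar G Q \<Q>"
    by (rule Q.bimodule_bar)
  interpret v: vectorspace K "bar G Q \<Q>" by (rule bQ.vs)
  interpret vM: vectorspace K M by (rule M.vs)
  have sm: "tprod (k \<odot>\<^bsub>M\<^esub> m) n = k \<odot>\<^bsub>Q\<^esub> tprod m n"
    if "k \<in> carrier K" "m \<in> carrier M" "n \<in> carrier N" for k m n
    using that by (simp add: t.T_smult[symmetric] bimodule_homD[OF \<pi>_hom] t.pt_closed)
  have "additive_map (bar G Q \<Q>) (bar G Q \<Q>) (smult (bar G Q \<Q>) k)" if "k \<in> carrier K" for k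
    using that v.smult_closed v.smult_r_distr by (intro additive_mapI)
  then obtain \<Phi> where "\<Phi> \<in> bimodule_hom K (Beilinson_Green G A \<A>) (Beilinson_Green G C \<C>) bt.T (bar G Q \<Q>)"
    "\<And>m n. m \<in> carrier (bar G M \<M>) \<Longrightarrow> n \<in> carrier (bar G N \<N>) \<Longrightarrow> \<Phi> (bt.pt m n) = mmul G Q tprod m n"
    by (rule bt.universal_hom[OF bQ.ab.abelian_group_axioms _ bQ.lact_additive bQ.ract_additive,
          where \<beta> = "mmul G Q tprod"])
      (simp_all add: pr.mmul_matrices pr.mmul_add_left pr.mmul_add_right pr.mmul_smult_left sm
        mmul_tprod_lact mmul_tprod_ract mmul_tprod_balanced)
  then show ?thesis by auto
qed

definition bar_hom :: "(('g \<times> 'g \<Rightarrow> 'm) \<times> ('g \<times> 'g \<Rightarrow> 'n) \<Rightarrow>\<^sub>0 int) set \<Rightarrow> 'g \<times> 'g \<Rightarrow> 'z"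
  where "bar_hom = (SOME \<Phi>. \<Phi> \<in> bimodule_hom K (Beilinson_Green G A \<A>) (Beilinson_Green G C \<C>) bt.T (bar G Q \<Q>) \<and>
    (\<forall>m\<in>matrices G \<M>. \<forall>n\<in>matrices G \<N>. \<Phi> (bt.pt m n) = mmul G Q tprod m n))"

lemma bar_hom: "bar_hom \<in> bimodule_hom K (Beilinson_Green G A \<A>) (Beilinson_Green G C \<C>) bt.T (bar G Q \<Q>)"
  and bar_hom_pt: "m \<in> matrices G \<M> \<Longrightarrow> n \<in> matrices G \<N> \<Longrightarrow> bar_hom (bt.pt m n) = mmul G Q tprod m n"
  using someI_ex[OF bar_hom_exists] by (simp_all add: bar_hom_def)

text \<open>Placing X at (g, l) and then multiplying out leaves the component of
  \<open>\<pi> X\<close> in degree g l\<inverse>, at position (g, l). Both sides are additive in X,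
  so pure tensors suffice, and there \<open>spread\<close> is compatible with the pairing.\<close>

lemma bar_hom_entry_map:
  assumes gl: "g \<in> carrier G" "l \<in> carrier G" and X: "X \<in> carrier t.T"
  shows "bar_hom (entry_map g l X) =
    mmul G Q (lact Q) (M.C.diag g) (mmul G Q (ract Q) (spread G Q \<Q> (\<pi> X)) (N.D.diag l))"
proof -
  interpret bQ: bimodule K "Beilinson_Green G A \<A>" "Beilinson_Green G C \<C>" "bar G Q \<Q>"
    by (rule Q.bimodule_bar)
  have s: "additive_map Q (bar G Q \<Q>) (spread G Q \<Q>)"
    by (intro additive_mapI matrix_ext[OF spread_extensional])
      (auto simp: Q.sp.spread_matrices Q.sp.hcomp_add)
  have r: "additive_map t.T (bar G Q \<Q>)
      (\<lambda>X. lact (bar G Q \<Q>) (M.C.diag g) (ract (bar G Q \<Q>) (spread G Q \<Q> (\<pi> X)) (N.D.diag l)))"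
    by (intro additive_map_compose[OF _ bQ.lact_additive] additive_map_compose[OF _ bQ.ract_additive]
        additive_map_compose[OF bimodule_hom_additive[OF \<pi>_hom] s])
      (use gl M.C.diag_closed N.D.diag_closed in auto)
  have "bar_hom (entry_map g l X) =
      lact (bar G Q \<Q>) (M.C.diag g) (ract (bar G Q \<Q>) (spread G Q \<Q> (\<pi> X)) (N.D.diag l))"
  proof (rule t.additive_eqI[OF bQ.ab.abelian_group_axioms
        additive_map_compose[OF entry_map_additive[OF gl] bimodule_hom_additive[OF bar_hom]] r _ X])
    fix m n assume m: "m \<in> carrier M" and n: "n \<in> carrier N"
    note cl = M.sp.spread_matrices[OF m] N.sp.spread_matrices[OF n] M.C.diag_closed[OF gl(1)] N.D.diag_closed[OF gl(2)]
    show "bar_hom (entry_map g l (t.pt m n)) = lact (bar G Q \<Q>) (M.C.diag g)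
        (ract (bar G Q \<Q>) (spread G Q \<Q> (\<pi> (t.pt m n))) (N.D.diag l))"
      using m n gl cl pr.mmul_matrices[OF cl(1,2)]
        bQ.lact_ract[of "M.C.diag g" "mmul G Q tprod (spread G M \<M> m) (spread G N \<N> n)" "N.D.diag l"]
      by (simp add: entry_map_pt bar_hom_pt row_closed col_closed mmul_tprod_lact mmul_tprod_ract
          pr.spread_pairing)
  qed
  then show ?thesis by simp
qed

end

section \<open>The isomorphism over the Beilinson--Green algebras\<close>

lemma additive_map_double_sum:
  assumes M: "abelian_group M" and N: "abelian_group N" and f: "additive_map M N f"
    and x: "\<And>i j. i \<in> I \<Longrightarrow> j \<in> J \<Longrightarrow> x i j \<in> carrier M"
  shows "f (\<Oplus>\<^bsub>M\<^esub>i\<in>I. \<Oplus>\<^bsub>M\<^esub>j\<in>J. x i j) = (\<Oplus>\<^bsub>N\<^esub>i\<in>I. \<Oplus>\<^bsub>N\<^esub>j\<in>J. f (x i j))"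
proof -
  interpret M: abelian_group M by fact
  interpret N: abelian_group N by fact
  note fs = additive_map_finsum[OF M N f]
  have "f (\<Oplus>\<^bsub>M\<^esub>i\<in>I. \<Oplus>\<^bsub>M\<^esub>j\<in>J. x i j) = (\<Oplus>\<^bsub>N\<^esub>i\<in>I. f (\<Oplus>\<^bsub>M\<^esub>j\<in>J. x i j))"
    using x by (intro fs M.finsum_closed) auto
  also have "\<dots> = (\<Oplus>\<^bsub>N\<^esub>i\<in>I. \<Oplus>\<^bsub>N\<^esub>j\<in>J. f (x i j))"
    using x additive_map_closed[OF f] by (intro N.finsum_eqI fs N.finsum_closed) auto
  finally show ?thesis .
qed

lemma additive_map_inverse:
  assumes M: "abelian_group M" and f: "additive_map M N f" and bij: "bij_betw f (carrier M) (carrier N)"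
  shows "additive_map N M (inv_into (carrier M) f)"
proof (rule additive_mapI)
  interpret M: abelian_group M by fact
  let ?i = "inv_into (carrier M) f"
  have i: "?i y \<in> carrier M" "f (?i y) = y" if "y \<in> carrier N" for y
    using that bij inv_into_into[of y f "carrier M"] f_inv_into_f[of y f "carrier M"]
    by (auto simp: bij_betw_def)
  show "y \<in> carrier N \<Longrightarrow> ?i y \<in> carrier M" for y by (rule i)
  show "?i (x \<oplus>\<^bsub>N\<^esub> y) = ?i x \<oplus>\<^bsub>M\<^esub> ?i y" if "x \<in> carrier N" "y \<in> carrier N" for x y
  proof (rule inv_into_f_eq)
    show "inj_on f (carrier M)" using bij by (simp add: bij_betw_def)
  qed (use that i in \<open>auto simp: additive_map_add[OF f]\<close>)
qed

lemma bimodule_sum_abelian_group: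
  assumes "abelian_group U" "abelian_group V"
  shows "abelian_group (bimodule_sum U V)"
proof -
  interpret U: abelian_group U by fact
  interpret V: abelian_group V by fact
  show ?thesis
  proof (rule abelian_groupI)
    show "\<exists>y\<in>carrier (bimodule_sum U V). y \<oplus>\<^bsub>bimodule_sum U V\<^esub> x = \<zero>\<^bsub>bimodule_sum U V\<^esub>"
      if "x \<in> carrier (bimodule_sum U V)" for x
      using that by (intro bexI[of _ "(\<ominus>\<^bsub>U\<^esub> fst x, \<ominus>\<^bsub>V\<^esub> snd x)"]) (auto simp: U.l_neg V.l_neg)
  qed (auto simp: U.a_ac V.a_ac)
qed

lemma
  assumes \<theta>: "\<theta> \<in> bimodule_hom K C D T (bimodule_sum U V)"
  shows fst_bimodule_hom: "(\<lambda>x. fst (\<theta> x)) \<in> bimodule_hom K C D T U"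
    and snd_bimodule_hom: "(\<lambda>x. snd (\<theta> x)) \<in> bimodule_hom K C D T V"
proof -
  have "fst (\<theta> x) \<in> carrier U" "snd (\<theta> x) \<in> carrier V" if "x \<in> carrier T" for x
    using bimodule_hom_closed[OF \<theta> that] by (simp_all add: mem_Times_iff)
  then show "(\<lambda>x. fst (\<theta> x)) \<in> bimodule_hom K C D T U" "(\<lambda>x. snd (\<theta> x)) \<in> bimodule_hom K C D T V"
    by (intro bimodule_homI; simp add: bimodule_hom_add[OF \<theta>] bimodule_hom_smult[OF \<theta>]
        bimodule_hom_lact[OF \<theta>] bimodule_hom_ract[OF \<theta>] split_beta)+
qed

lemma pair_bimodule_hom:
  assumes f: "f \<in> bimodule_hom K C D T U" and g: "g \<in> bimodule_hom K C D T V"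
  shows "(\<lambda>x. (f x, g x)) \<in> bimodule_hom K C D T (bimodule_sum U V)"
  by (rule bimodule_homI) (simp_all add: bimodule_homD[OF f] bimodule_homD[OF g])

text \<open>The matrix products with values in Q and in P together form a bimodule homomorphism. For
  its bijectivity an inverse in the additive sense is enough, so \<open>\<Psi>\<close> is built as
  an additive map.\<close>

lemma tensor_bar_iso:
  assumes M: "graded_bimod G K A \<A> B \<B> M \<M>" and N: "graded_bimod G K B \<B> C \<C> N \<N>"
    and Q: "graded_bimod G K A \<A> C \<C> Q \<Q>" and P: "graded_bimod G K A \<A> C \<C> P \<P>"
    and iso: "isomorphic_graded G K A C (tensor_product B M N) (tensor_grading G B M \<M> N \<N>)
      (bimodule_sum Q P) (sum_grading \<Q> \<P>)"
  shows "isomorphic_bimodules K (Beilinson_Green G A \<A>) (Beilinson_Green G C \<C>)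
    (tensor_product (Beilinson_Green G B \<B>) (bar G M \<M>) (bar G N \<N>))
    (bimodule_sum (bar G Q \<Q>) (bar G P \<P>))"
proof -
  interpret Q: graded_bimod G K A \<A> C \<C> Q \<Q> by fact
  interpret P: graded_bimod G K A \<A> C \<C> P \<P> by fact
  interpret MN: graded_pair G K A \<A> B \<B> C \<C> M \<M> N \<N>
    by (intro graded_pair.intro M N)
  obtain \<theta> where \<theta>: "\<theta> \<in> graded_hom G K A C MN.t.T (tensor_grading G B M \<M> N \<N>)
      (bimodule_sum Q P) (sum_grading \<Q> \<P>)"
    and bij: "bij_betw \<theta> (carrier MN.t.T) (carrier (bimodule_sum Q P))"
    using iso by (auto simp: isomorphic_graded_def)
  have \<theta>_hom: "\<theta> \<in> bimodule_hom K A C MN.t.T (bimodule_sum Q P)"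
    using \<theta> by (simp add: graded_hom_def)
  have \<pi>: "(\<lambda>x. fst (\<theta> x)) \<in> graded_hom G K A C MN.t.T (tensor_grading G B M \<M> N \<N>) Q \<Q>"
    and \<pi>': "(\<lambda>x. snd (\<theta> x)) \<in> graded_hom G K A C MN.t.T (tensor_grading G B M \<M> N \<N>) P \<P>"
    using \<theta> fst_bimodule_hom[OF \<theta>_hom] snd_bimodule_hom[OF \<theta>_hom]
    by (fastforce simp: graded_hom_def sum_grading_def)+
  interpret q: graded_tensor_hom G K A \<A> B \<B> C \<C> M \<M> N \<N> Q \<Q> "\<lambda>x. fst (\<theta> x)"
    by (intro graded_tensor_hom.intro graded_tensor_hom_axioms.intro MN.graded_pair_axioms Q \<pi>)
  interpret p: graded_tensor_hom G K A \<A> B \<B> C \<C> M \<M> N \<N> P \<P> "\<lambda>x. snd (\<theta> x)"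
    by (intro graded_tensor_hom.intro graded_tensor_hom_axioms.intro MN.graded_pair_axioms P \<pi>')
  let ?T = "MN.t.T" and ?T' = "MN.bt.T" and ?S = "bimodule_sum Q P"
    and ?S' = "bimodule_sum (bar G Q \<Q>) (bar G P \<P>)"
  interpret bQ: bimodule K "Beilinson_Green G A \<A>" "Beilinson_Green G C \<C>" "bar G Q \<Q>"
    by (rule Q.bimodule_bar)
  interpret bP: bimodule K "Beilinson_Green G A \<A>" "Beilinson_Green G C \<C>" "bar G P \<P>"
    by (rule P.bimodule_bar)
  note abT = MN.t.Tab.abelian_group_axioms and abT' = MN.bt.Tab.abelian_group_axioms
  have abS: "abelian_group ?S"
    by (rule bimodule_sum_abelian_group[OF Q.ab.abelian_group_axioms P.ab.abelian_group_axioms])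
  have abS': "abelian_group ?S'"
    by (rule bimodule_sum_abelian_group[OF bQ.ab.abelian_group_axioms bP.ab.abelian_group_axioms])
  define \<iota> where "\<iota> = inv_into (carrier ?T) \<theta>"
  have \<iota>: "additive_map ?S ?T \<iota>"
    unfolding \<iota>_def by (rule additive_map_inverse[OF abT bimodule_hom_additive[OF \<theta>_hom] bij])
  have \<theta>\<iota>: "\<theta> (\<iota> s) = s" if "s \<in> carrier ?S" for s
    unfolding \<iota>_def using that bij by (intro f_inv_into_f) (auto simp: bij_betw_def)
  have \<iota>\<theta>: "\<iota> (\<theta> t) = t" if "t \<in> carrier ?T" for t
    unfolding \<iota>_def using that bij by (intro inv_into_f_f) (auto simp: bij_betw_def)
  define \<Phi> where "\<Phi> x = (q.bar_hom x, p.bar_hom x)" for x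
  \<comment> \<open>The entries of both matrices at (g, l) form one element of the direct sum; it is
    pulled back to a tensor over B and placed at that position.\<close>
  define \<Psi> where "\<Psi> s = (\<Oplus>\<^bsub>?T'\<^esub>g\<in>carrier G. \<Oplus>\<^bsub>?T'\<^esub>l\<in>carrier G.
    MN.entry_map g l (\<iota> (fst s (g, l), snd s (g, l))))" for s
  have \<Phi>: "\<Phi> \<in> bimodule_hom K (Beilinson_Green G A \<A>) (Beilinson_Green G C \<C>) ?T' ?S'"
    unfolding \<Phi>_def by (rule pair_bimodule_hom[OF q.bar_hom p.bar_hom])
  have term_additive: "additive_map ?S' ?T' (\<lambda>s. MN.entry_map g l (\<iota> (fst s (g, l), snd s (g, l))))"
    if gl: "g \<in> carrier G" "l \<in> carrier G" for g l
  proof -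
    have "additive_map ?S' ?S (\<lambda>s. (fst s (g, l), snd s (g, l)))"
      using gl Q.sp.matrices_carrier P.sp.matrices_carrier by (intro additive_mapI) auto
    from additive_map_compose[OF additive_map_compose[OF this \<iota>] MN.entry_map_additive[OF gl]]
    show ?thesis .
  qed
  have \<Psi>: "additive_map ?S' ?T' \<Psi>"
    unfolding \<Psi>_def by (intro additive_map_sum abT' term_additive)
  note term_closed = additive_map_closed[OF term_additive]
  have \<Phi>\<Psi>: "\<Phi> (\<Psi> s) = s" if s: "s \<in> carrier ?S'" for s
  proof -
    have mat: "fst s \<in> matrices G \<Q>" "snd s \<in> matrices G \<P>" using s by auto
    have ent: "(fst s (g, l), snd s (g, l)) \<in> carrier ?S" if "g \<in> carrier G" "l \<in> carrier G" for g l
      using that mat Q.sp.matrices_carrier P.sp.matrices_carrier by simp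
    have "q.bar_hom (\<Psi> s) = fst s"
    proof -
      have "q.bar_hom (\<Psi> s) = (\<Oplus>\<^bsub>bar G Q \<Q>\<^esub>g\<in>carrier G. \<Oplus>\<^bsub>bar G Q \<Q>\<^esub>l\<in>carrier G.
          q.bar_hom (MN.entry_map g l (\<iota> (fst s (g, l), snd s (g, l)))))"
        unfolding \<Psi>_def
        by (rule additive_map_double_sum[OF abT' bQ.ab.abelian_group_axioms bimodule_hom_additive[OF q.bar_hom]])
          (rule term_closed[OF _ _ s])
      \<comment> \<open>\<open>\<theta>\<close> undoes \<open>\<iota>\<close>, so each term becomes
        the matrix whose only entry is that of \<open>fst s\<close> at (g, l).\<close>
      also have "\<dots> = (\<Oplus>\<^bsub>bar G Q \<Q>\<^esub>g\<in>carrier G. \<Oplus>\<^bsub>bar G Q \<Q>\<^esub>l\<in>carrier G.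
          mmul G Q (lact Q) (Q.C.diag g) (mmul G Q (ract Q) (spread G Q \<Q> (fst s (g, l))) (Q.D.diag l)))"
      proof (intro bQ.ab.finsum_eqI bQ.ab.finsum_closed)
        fix g l assume gl: "g \<in> carrier G" "l \<in> carrier G"
        show eq: "q.bar_hom (MN.entry_map g l (\<iota> (fst s (g, l), snd s (g, l)))) =
            mmul G Q (lact Q) (Q.C.diag g) (mmul G Q (ract Q) (spread G Q \<Q> (fst s (g, l))) (Q.D.diag l))"
          using q.bar_hom_entry_map[OF gl additive_map_closed[OF \<iota> ent[OF gl]]] \<theta>\<iota>[OF ent[OF gl]] by simp
      qed (use mat in \<open>auto intro!: Q.L.mmul_matrices Q.R.mmul_matrices Q.C.diag_closed Q.D.diag_closed
          Q.sp.spread_matrices Q.sp.matrices_carrier\<close>)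
      finally show ?thesis by (simp only: Q.bar_expansion[OF mat(1)])
    qed
    moreover have "p.bar_hom (\<Psi> s) = snd s"
    proof -
      have "p.bar_hom (\<Psi> s) = (\<Oplus>\<^bsub>bar G P \<P>\<^esub>g\<in>carrier G. \<Oplus>\<^bsub>bar G P \<P>\<^esub>l\<in>carrier G.
          p.bar_hom (MN.entry_map g l (\<iota> (fst s (g, l), snd s (g, l)))))"
        unfolding \<Psi>_def
        by (rule additive_map_double_sum[OF abT' bP.ab.abelian_group_axioms bimodule_hom_additive[OF p.bar_hom]])
          (rule term_closed[OF _ _ s])
      also have "\<dots> = (\<Oplus>\<^bsub>bar G P \<P>\<^esub>g\<in>carrier G. \<Oplus>\<^bsub>bar G P \<P>\<^esub>l\<in>carrier G.
          mmul G P (lact P) (Q.C.diag g) (mmul G P (ract P) (spread G P \<P> (snd s (g, l))) (Q.D.diag l)))"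
      proof (intro bP.ab.finsum_eqI bP.ab.finsum_closed)
        fix g l assume gl: "g \<in> carrier G" "l \<in> carrier G"
        show eq: "p.bar_hom (MN.entry_map g l (\<iota> (fst s (g, l), snd s (g, l)))) =
            mmul G P (lact P) (Q.C.diag g) (mmul G P (ract P) (spread G P \<P> (snd s (g, l))) (Q.D.diag l))"
          using p.bar_hom_entry_map[OF gl additive_map_closed[OF \<iota> ent[OF gl]]] \<theta>\<iota>[OF ent[OF gl]] by simp
      qed (use mat in \<open>auto intro!: P.L.mmul_matrices P.R.mmul_matrices Q.C.diag_closed Q.D.diag_closed
          P.sp.spread_matrices P.sp.matrices_carrier\<close>)
      finally show ?thesis by (simp only: P.bar_expansion[OF mat(2)])
    qed
    ultimately show ?thesis by (simp add: \<Phi>_def)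
  qed
  have \<Psi>\<Phi>: "\<Psi> (\<Phi> x) = x" if x: "x \<in> carrier ?T'" for x
  proof (rule MN.bt.additive_eqI[OF abT' additive_map_compose[OF bimodule_hom_additive[OF \<Phi>] \<Psi>] _ _ x])
    show "additive_map ?T' ?T' (\<lambda>x. x)" by (rule additive_mapI) simp_all
    fix m n assume "m \<in> carrier (bar G M \<M>)" "n \<in> carrier (bar G N \<N>)"
    then have m: "m \<in> matrices G \<M>" and n: "n \<in> matrices G \<N>" by simp_all
    have mc: "m (g, h) \<in> carrier M" and nc: "n (g, h) \<in> carrier N" if "g \<in> carrier G" "h \<in> carrier G" for g h
      using that MN.M.sp.matrices_carrier[OF m] MN.N.sp.matrices_carrier[OF n] by auto
    let ?b = "\<lambda>g l h. MN.bt.pt (MN.row g (spread G M \<M> (m (g, h)))) (MN.col l (spread G N \<N> (n (h, l))))"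
    have b_closed: "?b g l h \<in> carrier ?T'" if "g \<in> carrier G" "l \<in> carrier G" "h \<in> carrier G" for g l h
      using that mc nc
      by (intro MN.bt.pt_closed) (simp_all add: MN.row_closed MN.col_closed MN.M.sp.spread_matrices MN.N.sp.spread_matrices)
    have "MN.entry_map g l (\<iota> (fst (\<Phi> (MN.bt.pt m n)) (g, l), snd (\<Phi> (MN.bt.pt m n)) (g, l))) =
        (\<Oplus>\<^bsub>?T'\<^esub>h\<in>carrier G. ?b g l h)"
      if gl: "g \<in> carrier G" "l \<in> carrier G" for g l
    proof -
      \<comment> \<open>The entry at (g, l) of the product of m and n, formed in M \<otimes> N. The
        corresponding entries of \<open>\<Phi>\<close> are the two components of
        \<open>\<theta> t\<close>, so \<open>\<iota>\<close> returns t.\<close>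
      define t where "t = (\<Oplus>\<^bsub>?T\<^esub>h\<in>carrier G. MN.t.pt (m (g, h)) (n (h, l)))"
      have ptc: "MN.t.pt (m (g, h)) (n (h, l)) \<in> carrier ?T" if "h \<in> carrier G" for h
        using that gl mc nc by (intro MN.t.pt_closed)
      have t: "t \<in> carrier ?T"
        unfolding t_def using ptc by (intro MN.t.Tab.finsum_closed) auto
      have "fst (\<Phi> (MN.bt.pt m n)) (g, l) = fst (\<theta> t)"
        using gl m n ptc
        by (simp add: \<Phi>_def q.bar_hom_pt t_def
            additive_map_finsum[OF abT Q.ab.abelian_group_axioms bimodule_hom_additive[OF q.\<pi>_hom]])
      moreover have "snd (\<Phi> (MN.bt.pt m n)) (g, l) = snd (\<theta> t)"
        using gl m n ptc
        by (simp add: \<Phi>_def p.bar_hom_pt t_def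
            additive_map_finsum[OF abT P.ab.abelian_group_axioms bimodule_hom_additive[OF p.\<pi>_hom]])
      ultimately have "\<iota> (fst (\<Phi> (MN.bt.pt m n)) (g, l), snd (\<Phi> (MN.bt.pt m n)) (g, l)) = t"
        using \<iota>\<theta>[OF t] by simp
      also have "MN.entry_map g l t = (\<Oplus>\<^bsub>?T'\<^esub>h\<in>carrier G. MN.entry_map g l (MN.t.pt (m (g, h)) (n (h, l))))"
        unfolding t_def by (rule additive_map_finsum[OF abT abT' MN.entry_map_additive[OF gl] ptc])
      also have "\<dots> = (\<Oplus>\<^bsub>?T'\<^esub>h\<in>carrier G. ?b g l h)"
        using gl mc nc b_closed by (intro MN.bt.Tab.finsum_eqI) (simp_all add: MN.entry_map_pt)
      finally show ?thesis .
    qed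
    then have "\<Psi> (\<Phi> (MN.bt.pt m n)) = (\<Oplus>\<^bsub>?T'\<^esub>g\<in>carrier G. \<Oplus>\<^bsub>?T'\<^esub>l\<in>carrier G. \<Oplus>\<^bsub>?T'\<^esub>h\<in>carrier G. ?b g l h)"
      unfolding \<Psi>_def using b_closed
      by (intro MN.bt.Tab.finsum_eqI) (auto intro!: MN.bt.Tab.finsum_closed)
    then show "\<Psi> (\<Phi> (MN.bt.pt m n)) = MN.bt.pt m n"
      by (simp only: MN.pt_expansion[OF m n])
  qed
  have "bij_betw \<Phi> (carrier ?T') (carrier ?S')"
    using bimodule_hom_closed[OF \<Phi>] additive_map_closed[OF \<Psi>] \<Phi>\<Psi> \<Psi>\<Phi>
    by (intro bij_betw_byWitness[where f' = \<Psi>]) (auto simp del: bimodule_sum_simps)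
  with \<Phi> show ?thesis unfolding isomorphic_bimodules_def by blast
qed

section \<open>Transport of structure\<close>

text \<open>A stable equivalence has to be realised by bimodules with elements of type
  \<^typ>\<open>nat \<Rightarrow> 'k\<close>, whereas those of \<^const>\<open>bar\<close> are matrices.\<close>

definition transport :: "('m \<Rightarrow> 'n) \<Rightarrow> ('k, 'c, 'd, 'm) bimodule \<Rightarrow> ('k, 'c, 'd, 'n) bimodule"
  where "transport i U = (let j = inv_into (carrier U) i in
    \<lparr>carrier = i ` carrier U,
     monoid.mult = (\<lambda>_ _. i \<zero>\<^bsub>U\<^esub>),
     one = i \<zero>\<^bsub>U\<^esub>,
     zero = i \<zero>\<^bsub>U\<^esub>,
     add = (\<lambda>x y. i (j x \<oplus>\<^bsub>U\<^esub> j y)),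
     smult = (\<lambda>k x. i (k \<odot>\<^bsub>U\<^esub> j x)),
     lact = (\<lambda>c x. i (lact U c (j x))),
     ract = (\<lambda>x d. i (ract U (j x) d))\<rparr>)"

lemma transport_simps [simp]:
  "carrier (transport i U) = i ` carrier U" "zero (transport i U) = i \<zero>\<^bsub>U\<^esub>"
  "add (transport i U) = (\<lambda>x y. i (inv_into (carrier U) i x \<oplus>\<^bsub>U\<^esub> inv_into (carrier U) i y))"
  "smult (transport i U) = (\<lambda>k x. i (k \<odot>\<^bsub>U\<^esub> inv_into (carrier U) i x))"
  "lact (transport i U) = (\<lambda>c x. i (lact U c (inv_into (carrier U) i x)))"
  "ract (transport i U) = (\<lambda>x d. i (ract U (inv_into (carrier U) i x) d))"
  by (simp_all add: transport_def Let_def)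

lemma bimodule_transport:
  assumes U: "bimodule K C D U" and inj: "inj_on i (carrier U)"
  shows "bimodule K C D (transport i U)"
proof -
  interpret bimodule K C D U by fact
  interpret v: vectorspace K U by (rule vs)
  note [simp] = inv_into_f_f[OF inj]
  have ab: "abelian_group (transport i U)"
  proof (rule abelian_groupI)
    show "\<exists>y\<in>carrier (transport i U). y \<oplus>\<^bsub>transport i U\<^esub> x = \<zero>\<^bsub>transport i U\<^esub>"
      if "x \<in> carrier (transport i U)" for x
    proof -
      from that obtain u where "u \<in> carrier U" "x = i u" by auto
      then show ?thesis by (intro bexI[of _ "i (\<ominus>\<^bsub>U\<^esub> u)"]) (auto simp: ab.l_neg)
    qed
  qed (auto simp: ab.a_ac)
  have "module K (transport i U)"
    by (intro moduleI ab v.R.cring_axioms)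
      (auto simp: v.smult_l_distr v.smult_r_distr v.smult_assoc1)
  then have "vectorspace K (transport i U)"
    by (simp add: vectorspace_def v.field.field_axioms vectorspace_field[OF vs])
  then show ?thesis
    by (rule bimodule.intro[OF left_algebra right_algebra])
      (auto simp: lact_closed lact_add_left lact_add_right lact_smult_left lact_smult_right lact_mult lact_one
        ract_closed ract_add_left ract_add_right ract_smult_left ract_smult_right ract_mult ract_one lact_ract)
qed

lemma transport_hom: "inj_on i (carrier U) \<Longrightarrow> bimodule K C D U \<Longrightarrow> i \<in> bimodule_hom K C D U (transport i U)"
  by (rule bimodule_homI) (simp_all add: inv_into_f_f)

lemma transport_bij: "inj_on i (carrier U) \<Longrightarrow> bij_betw i (carrier U) (carrier (transport i U))"
  by (simp add: bij_betw_def)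

lemma bimodule_hom_inverse:
  assumes U: "bimodule K C D U" and \<phi>: "\<phi> \<in> bimodule_hom K C D U V" and bij: "bij_betw \<phi> (carrier U) (carrier V)"
  shows "inv_into (carrier U) \<phi> \<in> bimodule_hom K C D V U"
proof -
  interpret U: bimodule K C D U by fact
  interpret v: vectorspace K U by (rule U.vs)
  let ?i = "inv_into (carrier U) \<phi>"
  have i: "?i y \<in> carrier U" "\<phi> (?i y) = y" if "y \<in> carrier V" for y
    using that bij inv_into_into[of y \<phi> "carrier U"] f_inv_into_f[of y \<phi> "carrier U"]
    by (auto simp: bij_betw_def)
  have inj: "inj_on \<phi> (carrier U)" using bij by (simp add: bij_betw_def)
  have eq: "?i y = u" if "u \<in> carrier U" "\<phi> u = y" for u y
    using inv_into_f_eq[OF inj that] .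
  show ?thesis
    by (rule bimodule_homI) (auto intro!: eq simp: i bimodule_homD[OF \<phi>] U.lact_closed U.ract_closed)
qed

text \<open>A subbimodule of V containing the images of the generators pulls back along
  \<open>\<phi>\<close> to one of U containing the generators.\<close>

lemma fg_bimodule_iso:
  assumes fg: "fg_bimodule K C D U" and V: "bimodule K C D V"
    and \<phi>: "\<phi> \<in> bimodule_hom K C D U V" and bij: "bij_betw \<phi> (carrier U) (carrier V)"
  shows "fg_bimodule K C D V"
proof -
  obtain S where S: "finite S" "S \<subseteq> carrier U" and U: "bimodule K C D U"
    and gen: "\<And>W. subbimodule K C D W U \<Longrightarrow> S \<subseteq> W \<Longrightarrow> W = carrier U"
    using fg by (auto simp: fg_bimodule_def)
  interpret U: bimodule K C D U by fact
  interpret V: bimodule K C D V by fact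
  interpret v: vectorspace K U by (rule U.vs)
  have "W = carrier V" if W: "subbimodule K C D W V" and SW: "\<phi> ` S \<subseteq> W" for W
  proof -
    have sub: "subspace K W V" using W by (simp add: subbimodule_def)
    have "\<phi> \<zero>\<^bsub>U\<^esub> = \<zero>\<^bsub>V\<^esub>"
      by (rule additive_map_zero[OF U.ab.abelian_group_axioms V.ab.abelian_group_axioms bimodule_hom_additive[OF \<phi>]])
    then have "subbimodule K C D {u \<in> carrier U. \<phi> u \<in> W} U"
      using W unfolding subbimodule_def
      by (intro conjI ballI subspaceI[OF U.vs])
        (auto simp: bimodule_homD[OF \<phi>] subspace_add[OF sub] subspace_smult[OF sub] subspace_zero[OF sub]
          U.lact_closed U.ract_closed)
    from gen[OF this] have "\<phi> u \<in> W" if "u \<in> carrier U" for u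
      using S SW that by blast
    moreover have "carrier V = \<phi> ` carrier U" using bij by (simp add: bij_betw_def)
    ultimately show ?thesis using subspace_subset[OF sub] by auto
  qed
  moreover have "finite (\<phi> ` S)" "\<phi> ` S \<subseteq> carrier V"
    using S bimodule_hom_closed[OF \<phi>] by auto
  ultimately show ?thesis
    by (auto simp: fg_bimodule_def V intro!: exI[of _ "\<phi> ` S"])
qed

text \<open>The composite of f with \<open>\<phi>\<close> is lifted, and the lift is precomposed
  with the inverse of \<open>\<phi>\<close>; X and Y stay the same.\<close>

lemma projective_bimodule_iso:
  assumes proj: "projective_bimodule K C D U" and V: "bimodule K C D V"
    and \<phi>: "\<phi> \<in> bimodule_hom K C D U V" and bij: "bij_betw \<phi> (carrier U) (carrier V)"
  shows "projective_bimodule K C D V"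
  unfolding projective_bimodule_def
proof (intro conjI allI impI)
  have fg: "fg_bimodule K C D U" using proj by (simp add: projective_bimodule_def)
  then have U: "bimodule K C D U" by (simp add: fg_bimodule_def)
  show "fg_bimodule K C D V" by (rule fg_bimodule_iso[OF fg V \<phi> bij])
  fix X Y :: "('a, 'c, 'd, nat \<Rightarrow> 'a) bimodule" and e f
  assume asm: "fg_bimodule K C D X \<and> fg_bimodule K C D Y \<and> e \<in> bimodule_hom K C D X Y \<and>
    e ` carrier X = carrier Y \<and> f \<in> bimodule_hom K C D V Y"
  then have "(\<lambda>u. f (\<phi> u)) \<in> bimodule_hom K C D U Y"
    using bimodule_hom_compose[OF \<phi>] by blast
  with asm proj obtain h where h: "h \<in> bimodule_hom K C D U X"
    and eh: "\<And>u. u \<in> carrier U \<Longrightarrow> e (h u) = f (\<phi> u)"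
    unfolding projective_bimodule_def by meson
  have "(\<lambda>v. h (inv_into (carrier U) \<phi> v)) \<in> bimodule_hom K C D V X"
    by (rule bimodule_hom_compose[OF bimodule_hom_inverse[OF U \<phi> bij] h])
  moreover have "e (h (inv_into (carrier U) \<phi> v)) = f v" if "v \<in> carrier V" for v
  proof -
    have v: "v \<in> \<phi> ` carrier U" using that bij by (simp add: bij_betw_def)
    show ?thesis by (simp add: eh[OF inv_into_into[OF v]] f_inv_into_f[OF v])
  qed
  ultimately show "\<exists>h\<in>bimodule_hom K C D V X. \<forall>p\<in>carrier V. e (h p) = f p"
    by (intro bexI[of _ "\<lambda>v. h (inv_into (carrier U) \<phi> v)"] ballI)
qed

lemma left_projective_iso:
  assumes proj: "left_projective K C U" and V: "bimodule K C D V"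
    and \<phi>: "\<phi> \<in> bimodule_hom K C D U V" and bij: "bij_betw \<phi> (carrier U) (carrier V)"
  shows "left_projective K C V"
  unfolding left_projective_def
proof (rule projective_bimodule_iso[OF proj[unfolded left_projective_def] bimodule_as_left[OF V]])
  show "\<phi> \<in> bimodule_hom K C (self_algebra K) (as_left_module U) (as_left_module V)"
    by (rule bimodule_homI) (simp_all add: bimodule_homD[OF \<phi>])
qed (simp add: bij)

lemma right_projective_iso:
  assumes proj: "right_projective K D U" and V: "bimodule K C D V"
    and \<phi>: "\<phi> \<in> bimodule_hom K C D U V" and bij: "bij_betw \<phi> (carrier U) (carrier V)"
  shows "right_projective K D V"
  unfolding right_projective_def
proof (rule projective_bimodule_iso[OF proj[unfolded right_projective_def] bimodule_as_right[OF V]])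
  show "\<phi> \<in> bimodule_hom K (self_algebra K) D (as_right_module U) (as_right_module V)"
    by (rule bimodule_homI) (simp_all add: bimodule_homD[OF \<phi>])
qed (simp add: bij)

text \<open>Maps in both directions come from the universal property and are inverse to each other
  on pure tensors; the backward one is taken as an additive map.\<close>

lemma tensor_product_iso:
  assumes U: "bimodule K C D U" and V: "bimodule K D E V"
    and U': "bimodule K C D U'" and V': "bimodule K D E V'"
    and \<phi>: "\<phi> \<in> bimodule_hom K C D U U'" "bij_betw \<phi> (carrier U) (carrier U')"
    and \<psi>: "\<psi> \<in> bimodule_hom K D E V V'" "bij_betw \<psi> (carrier V) (carrier V')"
  shows "isomorphic_bimodules K C E (tensor_product D U V) (tensor_product D U' V')"
proof -
  interpret t: bimodule_pair K C D E U V by (intro bimodule_pair.intro U V)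
  interpret t': bimodule_pair K C D E U' V' by (intro bimodule_pair.intro U' V')
  let ?\<phi> = "inv_into (carrier U) \<phi>" and ?\<psi> = "inv_into (carrier V) \<psi>"
  note \<phi>' = bimodule_hom_inverse[OF U \<phi>] and \<psi>' = bimodule_hom_inverse[OF V \<psi>]
  note simps = bimodule_homD[OF \<phi>(1)] bimodule_homD[OF \<psi>(1)] bimodule_homD[OF \<phi>'] bimodule_homD[OF \<psi>']
    t.pt_closed t'.pt_closed t.pt_add_left t.pt_add_right t'.pt_add_left t'.pt_add_right
    t.pt_balanced t'.pt_balanced t'.T_smult t'.T_lact t'.T_ract
  obtain F where F: "F \<in> bimodule_hom K C E t.T t'.T"
    and F_pt: "\<And>u v. u \<in> carrier U \<Longrightarrow> v \<in> carrier V \<Longrightarrow> F (t.pt u v) = t'.pt (\<phi> u) (\<psi> v)"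
    by (rule t.universal_hom[OF t'.Tab.abelian_group_axioms t'.T_smult_additive t'.T_lact_additive
          t'.T_ract_additive, where \<beta> = "\<lambda>u v. t'.pt (\<phi> u) (\<psi> v)"]) (simp_all add: simps)
  obtain F' where F': "additive_map t'.T t.T F'"
    and F'_pt: "\<And>u v. u \<in> carrier U' \<Longrightarrow> v \<in> carrier V' \<Longrightarrow> F' (t'.pt u v) = t.pt (?\<phi> u) (?\<psi> v)"
    by (rule t'.universal[OF t.Tab.abelian_group_axioms, where \<beta> = "\<lambda>u v. t.pt (?\<phi> u) (?\<psi> v)"])
      (simp_all add: simps)
  have inv: "?\<phi> (\<phi> u) = u" "?\<psi> (\<psi> v) = v" if "u \<in> carrier U" "v \<in> carrier V" for u v
    using that \<phi>(2) \<psi>(2) by (auto simp: bij_betw_def)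
  have inv': "\<phi> (?\<phi> u) = u" "\<psi> (?\<psi> v) = v" if "u \<in> carrier U'" "v \<in> carrier V'" for u v
    using that \<phi>(2) \<psi>(2) f_inv_into_f[of u \<phi> "carrier U"] f_inv_into_f[of v \<psi> "carrier V"]
    by (auto simp: bij_betw_def)
  have id: "additive_map Z Z (\<lambda>x. x)" for Z :: "('x, 'y) ring_scheme" by (rule additive_mapI) simp_all
  note Fa = bimodule_hom_additive[OF F]
  have "F' (F x) = x" if x: "x \<in> carrier t.T" for x
    by (rule t.additive_eqI[OF t.Tab.abelian_group_axioms additive_map_compose[OF Fa F'] id _ x])
      (simp add: F_pt F'_pt inv simps)
  moreover have "F (F' x) = x" if x: "x \<in> carrier t'.T" for x
    by (rule t'.additive_eqI[OF t'.Tab.abelian_group_axioms additive_map_compose[OF F' Fa] id _ x])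
      (simp add: F_pt F'_pt inv' simps)
  ultimately have "bij_betw F (carrier t.T) (carrier t'.T)"
    using additive_map_closed[OF Fa] additive_map_closed[OF F']
    by (intro bij_betw_byWitness[where f' = F']) auto
  with F show ?thesis unfolding isomorphic_bimodules_def by blast
qed

lemma isomorphic_bimodules_trans [trans]:
  assumes "isomorphic_bimodules K C D U V" "isomorphic_bimodules K C D V W"
  shows "isomorphic_bimodules K C D U W"
proof -
  obtain f g where f: "f \<in> bimodule_hom K C D U V" "bij_betw f (carrier U) (carrier V)"
    and g: "g \<in> bimodule_hom K C D V W" "bij_betw g (carrier V) (carrier W)"
    using assms by (auto simp: isomorphic_bimodules_def)
  have "bij_betw (\<lambda>u. g (f u)) (carrier U) (carrier W)"
    using bij_betw_trans[OF f(2) g(2)] by (simp add: comp_def)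
  with bimodule_hom_compose[OF f(1) g(1)] show ?thesis
    unfolding isomorphic_bimodules_def by blast
qed

lemma bimodule_sum_iso:
  assumes \<phi>: "\<phi> \<in> bimodule_hom K C D U U'" "bij_betw \<phi> (carrier U) (carrier U')"
    and \<psi>: "\<psi> \<in> bimodule_hom K C D V V'" "bij_betw \<psi> (carrier V) (carrier V')"
  shows "isomorphic_bimodules K C D (bimodule_sum U V) (bimodule_sum U' V')"
proof -
  have "(\<lambda>(u, v). (\<phi> u, \<psi> v)) \<in> bimodule_hom K C D (bimodule_sum U V) (bimodule_sum U' V')"
    by (rule bimodule_homI) (auto simp: bimodule_homD[OF \<phi>(1)] bimodule_homD[OF \<psi>(1)])
  moreover have "bij_betw (\<lambda>(u, v). (\<phi> u, \<psi> v)) (carrier (bimodule_sum U V)) (carrier (bimodule_sum U' V'))"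
    using bij_betw_map_prod[OF \<phi>(2) \<psi>(2)] by (simp add: map_prod_def)
  ultimately show ?thesis unfolding isomorphic_bimodules_def by blast
qed

text \<open>The finitely many positions are numbered, and a matrix of sequences is merged into one
  sequence by the pairing function on natural numbers. Outside the positions matrices are fixed by
  extensionality, so one coding is injective for every grading at once.\<close>

lemma matrix_coding:
  fixes G :: "('g, 'p) monoid_scheme"
  assumes "finite (carrier G)"
  obtains i :: "('g \<times> 'g \<Rightarrow> nat \<Rightarrow> 'k) \<Rightarrow> nat \<Rightarrow> 'k" where "\<And>\<U>. inj_on i (matrices G \<U>)"
proof -
  obtain c :: "'g \<times> 'g \<Rightarrow> nat" where c: "inj_on c (carrier G \<times> carrier G)"
    using finite_imp_inj_to_nat_seg[of "carrier G \<times> carrier G"] assms by auto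
  define d where "d = inv_into (carrier G \<times> carrier G) c"
  have dc: "d (c p) = p" if "p \<in> carrier G \<times> carrier G" for p
    unfolding d_def using c that by (rule inv_into_f_f)
  \<comment> \<open>The index n stands for a pair: the number of a position and an index into the
    sequence found there.\<close>
  have "inj_on (\<lambda>a n. a (d (fst (prod_decode n))) (snd (prod_decode n)) :: 'k) (matrices G \<U>)" for \<U>
  proof (rule inj_onI)
    fix a b :: "'g \<times> 'g \<Rightarrow> nat \<Rightarrow> 'k"
    assume a: "a \<in> matrices G \<U>" and b: "b \<in> matrices G \<U>"
      and eq: "(\<lambda>n. a (d (fst (prod_decode n))) (snd (prod_decode n))) =
        (\<lambda>n. b (d (fst (prod_decode n))) (snd (prod_decode n)))"
    show "a = b"
    proof (rule matrix_ext[OF matrices_extensional[OF a] matrices_extensional[OF b]], rule ext)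
      fix g h n assume "g \<in> carrier G" "h \<in> carrier G"
      then show "a (g, h) n = b (g, h) n"
        using fun_cong[OF eq, of "prod_encode (c (g, h), n)"] by (simp add: dc)
    qed
  qed
  then show thesis by (rule that)
qed

section \<open>Assembly of the stable equivalence\<close>

lemma (in graded_alg) bar_regular_hom:
  "(\<lambda>a. a) \<in> bimodule_hom K (Beilinson_Green G A \<A>) (Beilinson_Green G A \<A>)
    (bar G (regular_bimodule A) \<A>) (regular_bimodule (Beilinson_Green G A \<A>))"
  by (rule bimodule_homI) (simp_all add: mmul_eq_structure[of "regular_bimodule A" A])

text \<open>One half of the equivalence; exchanging A with B and M with N gives the other. The
  coding is removed from the tensor factors, and after the comparison over matrices it is applied
  again to the projective summand, while \<open>bar\<close> of the regular bimodule is already the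
  regular one.\<close>

lemma stable_iso_bar:
  fixes M :: "('k, 'a, 'b, nat \<Rightarrow> 'k) bimodule" and N :: "('k, 'b, 'a, nat \<Rightarrow> 'k) bimodule"
    and P :: "('k, 'a, 'a, nat \<Rightarrow> 'k) bimodule"
  assumes A: "graded_alg G K A \<A>"
    and M: "graded_bimod G K A \<A> B \<B> M \<M>" and N: "graded_bimod G K B \<B> A \<A> N \<N>"
    and P: "graded_bimod G K A \<A> A \<A> P \<P>"
    and iso: "isomorphic_graded G K A A (tensor_product B M N) (tensor_grading G B M \<M> N \<N>)
      (bimodule_sum (regular_bimodule A) P) (sum_grading \<A> \<P>)"
    and inj: "inj_on i (matrices G \<M>)" "inj_on i (matrices G \<N>)" "inj_on i (matrices G \<P>)"
  shows "isomorphic_bimodules K (Beilinson_Green G A \<A>) (Beilinson_Green G A \<A>)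
    (tensor_product (Beilinson_Green G B \<B>) (transport i (bar G M \<M>)) (transport i (bar G N \<N>)))
    (bimodule_sum (regular_bimodule (Beilinson_Green G A \<A>)) (transport i (bar G P \<P>)))"
proof -
  interpret A: graded_alg G K A \<A> by fact
  interpret M: graded_bimod G K A \<A> B \<B> M \<M> by fact
  interpret N: graded_bimod G K B \<B> A \<A> N \<N> by fact
  interpret P: graded_bimod G K A \<A> A \<A> P \<P> by fact
  have inj': "inj_on i (carrier (bar G M \<M>))" "inj_on i (carrier (bar G N \<N>))" "inj_on i (carrier (bar G P \<P>))"
    using inj by simp_all
  let ?A = "Beilinson_Green G A \<A>" and ?B = "Beilinson_Green G B \<B>"
  have i: "inv_into (carrier (bar G M \<M>)) i \<in> bimodule_hom K ?A ?B (transport i (bar G M \<M>)) (bar G M \<M>)"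
    "inv_into (carrier (bar G N \<N>)) i \<in> bimodule_hom K ?B ?A (transport i (bar G N \<N>)) (bar G N \<N>)"
    using bimodule_hom_inverse[OF M.bimodule_bar transport_hom transport_bij, OF inj'(1) M.bimodule_bar inj'(1)]
      bimodule_hom_inverse[OF N.bimodule_bar transport_hom transport_bij, OF inj'(2) N.bimodule_bar inj'(2)]
    by blast+
  have "isomorphic_bimodules K ?A ?A
      (tensor_product ?B (transport i (bar G M \<M>)) (transport i (bar G N \<N>)))
      (tensor_product ?B (bar G M \<M>) (bar G N \<N>))"
    by (rule tensor_product_iso[OF bimodule_transport[OF M.bimodule_bar inj'(1)]
          bimodule_transport[OF N.bimodule_bar inj'(2)] M.bimodule_bar N.bimodule_bar i(1) _ i(2)])
      (rule bij_betw_inv_into[OF transport_bij[OF inj'(1)]] bij_betw_inv_into[OF transport_bij[OF inj'(2)]])+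
  also note tensor_bar_iso[OF M N A.graded_bimod_regular P iso]
  also have "isomorphic_bimodules K ?A ?A (bimodule_sum (bar G (regular_bimodule A) \<A>) (bar G P \<P>))
      (bimodule_sum (regular_bimodule ?A) (transport i (bar G P \<P>)))"
    by (rule bimodule_sum_iso[OF A.bar_regular_hom _ transport_hom[OF inj'(3) P.bimodule_bar] transport_bij[OF inj'(3)]])
      (simp add: bij_betw_def)
  finally show ?thesis .
qed

theorem theorem1p5:
  fixes G :: "('g, 'p) monoid_scheme"
    and K :: "('k, 'q) ring_scheme"
    and A :: "('k, 'a) module" and \<A> :: "'g \<Rightarrow> 'a set"
    and B :: "('k, 'b) module" and \<B> :: "'g \<Rightarrow> 'b set"
  assumes "group G" and "finite (carrier G)"
    and "field K"
    and "fd_algebra K A" and "graded_algebra G K A \<A>"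
    and "fd_algebra K B" and "graded_algebra G K B \<B>"
    and "graded_stably_equivalent_Morita G K A \<A> B \<B>"
  shows "stably_equivalent_Morita K (Beilinson_Green G A \<A>) (Beilinson_Green G B \<B>)"
proof -
  have A: "graded_alg G K A \<A>" and B: "graded_alg G K B \<B>"
    using assms by (simp_all add: graded_alg_def)
  obtain M \<M> N \<N> P \<P> Q \<Q> where
    gM: "graded_bimodule G K A \<A> B \<B> (M :: ('k, 'a, 'b, nat \<Rightarrow> 'k) bimodule) \<M>"
    and lM: "left_graded_projective G K A \<A> M \<M>" and rM: "right_graded_projective G K B \<B> M \<M>"
    and gN: "graded_bimodule G K B \<B> A \<A> (N :: ('k, 'b, 'a, nat \<Rightarrow> 'k) bimodule) \<N>"
    and lN: "left_graded_projective G K B \<B> N \<N>" and rN: "right_graded_projective G K A \<A> N \<N>"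
    and pP: "graded_projective G K A \<A> A \<A> (P :: ('k, 'a, 'a, nat \<Rightarrow> 'k) bimodule) \<P>"
    and pQ: "graded_projective G K B \<B> B \<B> (Q :: ('k, 'b, 'b, nat \<Rightarrow> 'k) bimodule) \<Q>"
    and isoA: "isomorphic_graded G K A A (tensor_product B M N) (tensor_grading G B M \<M> N \<N>)
        (bimodule_sum (regular_bimodule A) P) (sum_grading \<A> \<P>)"
    and isoB: "isomorphic_graded G K B B (tensor_product A N M) (tensor_grading G A N \<N> M \<M>)
        (bimodule_sum (regular_bimodule B) Q) (sum_grading \<B> \<Q>)"
    using assms(8) unfolding graded_stably_equivalent_Morita_def by blast
  have M: "graded_bimod G K A \<A> B \<B> M \<M>" by (rule graded_bimodI[OF A B gM])
  have N: "graded_bimod G K B \<B> A \<A> N \<N>" by (rule graded_bimodI[OF B A gN])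
  have P: "graded_bimod G K A \<A> A \<A> P \<P>"
    using pP by (intro graded_bimodI[OF A A]) (simp add: graded_projective_def)
  have Q: "graded_bimod G K B \<B> B \<B> Q \<Q>"
    using pQ by (intro graded_bimodI[OF B B]) (simp add: graded_projective_def)
  interpret M: graded_bimod G K A \<A> B \<B> M \<M> by (rule M)
  interpret N: graded_bimod G K B \<B> A \<A> N \<N> by (rule N)
  interpret P: graded_bimod G K A \<A> A \<A> P \<P> by (rule P)
  interpret Q: graded_bimod G K B \<B> B \<B> Q \<Q> by (rule Q)
  \<comment> \<open>All four given bimodules have elements of type
    \<open>nat \<Rightarrow> 'k\<close>, so a single coding serves for their matrices.\<close>
  obtain i :: "('g \<times> 'g \<Rightarrow> nat \<Rightarrow> 'k) \<Rightarrow> nat \<Rightarrow> 'k" where i: "\<And>\<U>. inj_on i (matrices G \<U>)"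
    using matrix_coding[OF assms(2)] by blast
  have inj: "inj_on i (carrier (bar G U \<U>))" for U :: "('k, 'x, 'y, nat \<Rightarrow> 'k) bimodule" and \<U>
    by (simp add: i)
  note hM = transport_hom[OF inj M.bimodule_bar] transport_bij[OF inj]
    and hN = transport_hom[OF inj N.bimodule_bar] transport_bij[OF inj]
    and hP = transport_hom[OF inj P.bimodule_bar] transport_bij[OF inj]
    and hQ = transport_hom[OF inj Q.bimodule_bar] transport_bij[OF inj]
  note bM = bimodule_transport[OF M.bimodule_bar inj] and bN = bimodule_transport[OF N.bimodule_bar inj]
    and bP = bimodule_transport[OF P.bimodule_bar inj] and bQ = bimodule_transport[OF Q.bimodule_bar inj]
  have fg: "fg_bimodule K A B M" "fg_bimodule K B A N"
    using gM gN by (simp_all add: graded_bimodule_def)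
  show ?thesis
    unfolding stably_equivalent_Morita_def
    by (intro exI[of _ "transport i (bar G M \<M>)"] exI[of _ "transport i (bar G N \<N>)"]
        exI[of _ "transport i (bar G P \<P>)"] exI[of _ "transport i (bar G Q \<Q>)"] conjI
        fg_bimodule_iso[OF M.fg_bar[OF fg(1)] bM hM] left_projective_iso[OF M.left_projective_bar[OF lM] bM hM]
        right_projective_iso[OF M.right_projective_bar[OF rM] bM hM]
        fg_bimodule_iso[OF N.fg_bar[OF fg(2)] bN hN] left_projective_iso[OF N.left_projective_bar[OF lN] bN hN]
        right_projective_iso[OF N.right_projective_bar[OF rN] bN hN]
        projective_bimodule_iso[OF P.projective_bar[OF pP] bP hP]
        projective_bimodule_iso[OF Q.projective_bar[OF pQ] bQ hQ]
        stable_iso_bar[OF A M N P isoA i i i] stable_iso_bar[OF B N M Q isoB i i i])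
qed

end
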